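(* Let $y\in\mathcal I_\infty$ and $\mu=\mu(y)$. Then $\mu^T\le\mu$ in dominance order. If $\mu^T=\mu$ then $\hat F_y=s_\mu$, and otherwise $\hat F_y\in s_{\mu^T}+s_\mu+\mathbb{N}\text{-span}\{s_\lambda:\mu^T<\lambda<\mu\}$.
   Context: $\mathcal I_\infty$ is the set of involutions of $\mathbb{Z}$ with finite support contained in $\{1,2,\dots\}$. For $y\in\mathcal I_\infty$ and $i\ge1$, $\hat c_i(y)$ is the number of positive $j$ with $j\le i<y(j)$ and $j<y(i)$; $\mu(y)$ is the transpose of the partition obtained by sorting $(\hat c_i(y))_i$ decreasingly. $\hat F_y=\sum_{w\in\mathcal A(y)}F_w$ where $\mathcal A(y)$ is the set of minimal-length permutations $w$ with $w^{-1}\circ w=y$ for the Demazure product $\circ$ (associative, $u\circ v=uv$ if lengths add, $s_i\circ s_i=s_i$) and $F_w$ is the Stanley symmetric function. $s_\lambda$ is the Schur function, $\mu^T$ is the transpose partition, and $<$ is dominance order. *)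

theory Defs
  imports "HOL-Combinatorics.Perm" "HOL-Library.Multiset"
begin

unbundle permutation_syntax

section \<open>Finitely supported permutations of the integers\<close>

type_synonym zperm = "int perm"

definition involutions_pos :: "zperm set" where
  "involutions_pos = {y. y * y = 1 \<and> affected y \<subseteq> {1..}}"

abbreviation simple_refl :: "int \<Rightarrow> zperm" where
  "simple_refl i \<equiv> \<langle>i \<leftrightarrow> i + 1\<rangle>"

definition word_prod :: "int list \<Rightarrow> zperm" where
  "word_prod a = prod_list (map simple_refl a)"

definition perm_length :: "zperm \<Rightarrow> nat" where
  "perm_length w = (LEAST k. \<exists>a. length a = k \<and> word_prod a = w)"

definition reduced_words :: "zperm \<Rightarrow> int list set" where
  "reduced_words w = {a. word_prod a = w \<and> length a = perm_length w}"

definition is_demazure_product :: "(zperm \<Rightarrow> zperm \<Rightarrow> zperm) \<Rightarrow> bool" where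
  "is_demazure_product d \<longleftrightarrow>
     (\<forall>u v w. d (d u v) w = d u (d v w)) \<and>
     (\<forall>u v. perm_length (u * v) = perm_length u + perm_length v \<longrightarrow> d u v = u * v) \<and>
     (\<forall>i. d (simple_refl i) (simple_refl i) = simple_refl i)"

text \<open>That there is exactly one such operation is proved at the end of this theory
  (\<open>demazure_product_unique_existence\<close>).\<close>

definition demazure :: "zperm \<Rightarrow> zperm \<Rightarrow> zperm" where
  "demazure = (THE d. is_demazure_product d)"

definition atoms :: "zperm \<Rightarrow> zperm set" where
  "atoms y = {w. demazure (inverse w) w = y \<and>
     (\<forall>v. demazure (inverse v) v = y \<longrightarrow> perm_length w \<le> perm_length v)}"


section \<open>Partitions\<close>

text \<open>Partitions are weakly decreasing lists of positive integers; row and column indices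
  start at 0.\<close>

definition is_partition :: "nat list \<Rightarrow> bool" where
  "is_partition p \<longleftrightarrow> sorted_wrt (\<ge>) p \<and> 0 \<notin> set p"

definition conj_partition :: "nat list \<Rightarrow> nat list" where
  "conj_partition p =
     map (\<lambda>j. card {i. i < length p \<and> j < p ! i}) [0..<(case p of [] \<Rightarrow> 0 | k # _ \<Rightarrow> k)]"

text \<open>Dominance only compares partitions of the same integer.  Note that \<open>take k p = p\<close> for
  \<open>k \<ge> length p\<close>, which amounts to padding by zeros.\<close>

definition dominance_le :: "nat list \<Rightarrow> nat list \<Rightarrow> bool" where
  "dominance_le p q \<longleftrightarrow> sum_list p = sum_list q \<and> (\<forall>k. sum_list (take k p) \<le> sum_list (take k q))"

definition dominance_less :: "nat list \<Rightarrow> nat list \<Rightarrow> bool" where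
  "dominance_less p q \<longleftrightarrow> dominance_le p q \<and> p \<noteq> q"


section \<open>The shape of an involution\<close>

definition inv_code :: "zperm \<Rightarrow> int \<Rightarrow> nat" where
  "inv_code y i = card {j. 1 \<le> j \<and> j \<le> i \<and> i < y \<langle>$\<rangle> j \<and> j < y \<langle>$\<rangle> i}"

text \<open>Only finitely many \<open>inv_code y i\<close> are nonzero (\<open>finite_inv_code\<close> below).\<close>

definition inv_shape :: "zperm \<Rightarrow> nat list" where
  "inv_shape y = conj_partition (rev (sorted_list_of_multiset
     (image_mset (inv_code y) (mset_set {i. 1 \<le> i \<and> inv_code y i \<noteq> 0}))))"


section \<open>Symmetric functions\<close>

text \<open>A formal power series in countably many variables \<open>x\<^sub>0, x\<^sub>1, \<dots>\<close> with integer
  coefficients is given by its coefficient function; the monomial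
  \<open>x\<^bsub>i\<^sub>1\<^esub> \<cdots> x\<^bsub>i\<^sub>k\<^esub>\<close> is the multiset of its indices.\<close>

type_synonym power_series = "nat multiset \<Rightarrow> int"

text \<open>\<open>F\<^sub>w\<close> is the sum of \<open>x\<^bsub>b\<^sub>1\<^esub> \<cdots> x\<^bsub>b\<^sub>k\<^esub>\<close> over all reduced words \<open>a\<^sub>1 \<dots> a\<^sub>k\<close> of \<open>w\<close> and all
  \<open>b\<^sub>1 \<le> \<dots> \<le> b\<^sub>k\<close> such that \<open>b\<^sub>j < b\<^sub>j\<^sub>+\<^sub>1\<close> whenever \<open>a\<^sub>j < a\<^sub>j\<^sub>+\<^sub>1\<close>, that is, the stable limit of
  the Schubert polynomials of \<open>w\<close>.  (Stanley's original convention gives \<open>F\<close> of the inverse.)\<close>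

definition stanley :: "zperm \<Rightarrow> power_series" where
  "stanley w = (\<lambda>m. int (card {(a, b). a \<in> reduced_words w \<and> length b = length a \<and> sorted b \<and>
     (\<forall>j. Suc j < length a \<longrightarrow> a ! j < a ! Suc j \<longrightarrow> b ! j < b ! Suc j) \<and> mset b = m}))"

definition inv_stanley :: "zperm \<Rightarrow> power_series" where
  "inv_stanley y = (\<lambda>m. \<Sum>w\<in>atoms y. stanley w m)"

text \<open>A tableau is the list of its rows, from the longest row to the shortest one.\<close>

definition semistandard_tableaux :: "nat list \<Rightarrow> nat list list set" where
  "semistandard_tableaux p = {t. map length t = p \<and> (\<forall>r\<in>set t. sorted r) \<and>
     (\<forall>i j. Suc i < length t \<longrightarrow> j < length (t ! Suc i) \<longrightarrow> t ! i ! j < t ! Suc i ! j)}"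

definition schur_fun :: "nat list \<Rightarrow> power_series" where
  "schur_fun p = (\<lambda>m. int (card {t \<in> semistandard_tableaux p. mset (concat t) = m}))"

definition nat_span :: "power_series set \<Rightarrow> power_series set" where
  "nat_span S = {(\<lambda>m. \<Sum>f\<in>T. int (c f) * f m) | T c. finite T \<and> T \<subseteq> S}"


section \<open>Well-definedness\<close>

lemma affected_bound: obtains N :: int where "affected w \<subseteq> {-N..N}"
proof
  define N where "N = Max (insert 0 (abs ` affected w))"
  have "\<bar>i\<bar> \<le> N" if "i \<in> affected w" for i
    unfolding N_def by (rule Max_ge) (use that in auto)
  then show "affected w \<subseteq> {-N..N}" by (force simp: abs_le_iff)
qed

lemma finite_inv_code: "finite {i. 1 \<le> i \<and> inv_code y i \<noteq> 0}"
proof -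
  obtain N where N: "affected y \<subseteq> {-N..N}" by (rule affected_bound)
  have "i \<le> N" if "inv_code y i \<noteq> 0" for i
  proof -
    from that have "{j. 1 \<le> j \<and> j \<le> i \<and> i < y \<langle>$\<rangle> j \<and> j < y \<langle>$\<rangle> i} \<noteq> {}"
      unfolding inv_code_def by force
    then obtain j where j: "1 \<le> j" "j \<le> i" "i < y \<langle>$\<rangle> j" by blast
    then have "y \<langle>$\<rangle> j \<in> affected y" by (simp add: in_affected apply_inj)
    with N have "y \<langle>$\<rangle> j \<le> N" by (meson atLeastAtMost_iff subsetD)
    with j show ?thesis by simp
  qed
  then have "{i. 1 \<le> i \<and> inv_code y i \<noteq> 0} \<subseteq> {1..N}" by auto
  then show ?thesis by (rule finite_subset) simp
qed

definition invs :: "zperm \<Rightarrow> (int \<times> int) set" where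
  "invs w = {(i, j). i < j \<and> w \<langle>$\<rangle> j < w \<langle>$\<rangle> i}"

lemma finite_invs: "finite (invs w)"
proof -
  obtain N where N: "affected w \<subseteq> {-N..N}" using affected_bound by blast
  have ex: "w \<langle>$\<rangle> i = i \<or> (-N \<le> i \<and> i \<le> N \<and> -N \<le> w \<langle>$\<rangle> i \<and> w \<langle>$\<rangle> i \<le> N)" for i
    using N by (meson apply_affected atLeastAtMost_iff in_affected subsetD)
  have "invs w \<subseteq> {-N..N} \<times> {-N..N}"
    unfolding invs_def
  proof clarify
    fix i j assume "i < j" "w \<langle>$\<rangle> j < w \<langle>$\<rangle> i"
    then show "i \<in> {-N..N} \<and> j \<in> {-N..N}"
      using ex[of i] ex[of j] by auto
  qed
  then show ?thesis by (rule finite_subset) simp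
qed

lemma apply_simple_refl:
  "simple_refl i \<langle>$\<rangle> k = (if k = i then i + 1 else if k = i + 1 then i else k)"
  by (cases "k = i \<or> k = i + 1") auto

lemma apply_mult: "(u * v) \<langle>$\<rangle> k = u \<langle>$\<rangle> (v \<langle>$\<rangle> k)"
  by (simp add: apply_times)

lemma refl_involutive: "simple_refl i \<langle>$\<rangle> (simple_refl i \<langle>$\<rangle> k) = k"
  by (simp add: apply_simple_refl)

lemma refl_refl [simp]: "u * \<langle>a \<leftrightarrow> b\<rangle> * \<langle>a \<leftrightarrow> b\<rangle> = (u :: 'a perm)"
  by (simp add: mult.assoc)

lemma card_invs_ascent:
  assumes "w \<langle>$\<rangle> i < w \<langle>$\<rangle> (i + 1)"
  shows "card (invs (w * simple_refl i)) = Suc (card (invs w))"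
proof -
  let ?f = "\<lambda>(a, b). (simple_refl i \<langle>$\<rangle> a, simple_refl i \<langle>$\<rangle> b)"
  have eq: "invs (w * simple_refl i) = insert (i, i + 1) (?f ` invs w)"
  proof (intro set_eqI iffI)
    fix p assume "p \<in> invs (w * simple_refl i)"
    then obtain a b where p: "p = (a, b)" "a < b"
      "w \<langle>$\<rangle> (simple_refl i \<langle>$\<rangle> b) < w \<langle>$\<rangle> (simple_refl i \<langle>$\<rangle> a)"
      by (auto simp: invs_def apply_mult)
    show "p \<in> insert (i, i + 1) (?f ` invs w)"
    proof (cases "a = i \<and> b = i + 1")
      case False
      then have "simple_refl i \<langle>$\<rangle> a < simple_refl i \<langle>$\<rangle> b"
        using p(2) by (auto simp: apply_simple_refl)
      then have "(simple_refl i \<langle>$\<rangle> a, simple_refl i \<langle>$\<rangle> b) \<in> invs w"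
        using p by (auto simp: invs_def)
      moreover have "p = ?f (simple_refl i \<langle>$\<rangle> a, simple_refl i \<langle>$\<rangle> b)"
        by (simp add: p refl_involutive)
      ultimately show ?thesis by blast
    qed (use p in auto)
  next
    fix p assume "p \<in> insert (i, i + 1) (?f ` invs w)"
    then show "p \<in> invs (w * simple_refl i)"
    proof
      assume "p = (i, i + 1)"
      then show ?thesis using assms by (simp add: invs_def apply_mult)
    next
      assume "p \<in> ?f ` invs w"
      then obtain a b where p: "p = ?f (a, b)" "a < b" "w \<langle>$\<rangle> b < w \<langle>$\<rangle> a"
        by (auto simp: invs_def)
      then have "\<not> (a = i \<and> b = i + 1)" using assms by auto
      then have "simple_refl i \<langle>$\<rangle> a < simple_refl i \<langle>$\<rangle> b"
        using p(2) by (auto simp: apply_simple_refl)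
      then show ?thesis using p by (simp add: invs_def apply_mult refl_involutive)
    qed
  qed
  have "inj ?f" by (auto intro!: injI simp: apply_inj)
  then have "card (?f ` invs w) = card (invs w)" by (meson card_image inj_on_subset subset_UNIV)
  moreover have "(i, i + 1) \<notin> ?f ` invs w"
  proof
    assume "(i, i + 1) \<in> ?f ` invs w"
    then obtain a b where "(a, b) \<in> invs w" "i = simple_refl i \<langle>$\<rangle> a" "i + 1 = simple_refl i \<langle>$\<rangle> b"
      by auto
    then show False by (auto simp: invs_def apply_simple_refl split: if_splits)
  qed
  ultimately show ?thesis using finite_invs[of w] by (simp add: eq)
qed

lemma card_invs_descent:
  assumes "\<not> w \<langle>$\<rangle> i < w \<langle>$\<rangle> (i + 1)"
  shows "card (invs w) = Suc (card (invs (w * simple_refl i)))"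
proof -
  have "w \<langle>$\<rangle> i \<noteq> w \<langle>$\<rangle> (i + 1)" by (simp add: apply_inj)
  then have "(w * simple_refl i) \<langle>$\<rangle> i < (w * simple_refl i) \<langle>$\<rangle> (i + 1)"
    using assms by (simp add: apply_mult)
  from card_invs_ascent[OF this] show ?thesis by simp
qed

lemma card_invs_one: "card (invs 1) = 0"
proof -
  have "invs 1 = {}" by (auto simp: invs_def)
  then show ?thesis by simp
qed

lemma word_prod_simps [simp]:
  "word_prod [] = 1" "word_prod (i # a) = simple_refl i * word_prod a"
  "word_prod (a @ b) = word_prod a * word_prod b"
  by (simp_all add: word_prod_def)

lemma card_invs_refl: "card (invs (w * simple_refl i)) \<le> Suc (card (invs w))"
  by (cases "w \<langle>$\<rangle> i < w \<langle>$\<rangle> (i + 1)") (auto dest: card_invs_ascent card_invs_descent)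

lemma card_invs_word: "card (invs (word_prod a)) \<le> length a"
proof (induction a rule: rev_induct)
  case (snoc i a)
  then show ?case
    using card_invs_refl[of "word_prod a" i] by simp
qed (simp add: card_invs_one)

lemma no_descent:
  assumes "\<And>i. w \<langle>$\<rangle> i < w \<langle>$\<rangle> (i + 1)"
  shows "w = (1 :: zperm)"
proof (rule perm_eqI)
  fix k
  obtain N where N: "affected w \<subseteq> {-N..N}" by (rule affected_bound)
  have fixp: "w \<langle>$\<rangle> i = i" if "i < -N \<or> i > N" for i
    using that N by (auto simp: in_affected subset_iff)
  have up: "w \<langle>$\<rangle> i + int n \<le> w \<langle>$\<rangle> (i + int n)" for i n
  proof (induction n)
    case (Suc n)
    then show ?case using assms[of "i + int n"] by (simp add: algebra_simps)
  qed simp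
  define l where "l = min k (-N - 1)"
  define h where "h = max k (N + 1)"
  have "w \<langle>$\<rangle> l = l" "w \<langle>$\<rangle> h = h" by (rule fixp, simp add: l_def h_def, linarith?)+
  moreover have "l \<le> k" "k \<le> h" by (simp_all add: l_def h_def)
  ultimately have "w \<langle>$\<rangle> k = k"
    using up[of l "nat (k - l)"] up[of k "nat (h - k)"] by simp
  then show "w \<langle>$\<rangle> k = 1 \<langle>$\<rangle> k" by simp
qed

lemma word_exists: "\<exists>a. word_prod a = w \<and> length a = card (invs w)"
proof (induction "card (invs w)" arbitrary: w)
  case 0
  have "w = 1"
  proof (rule no_descent, rule ccontr)
    fix i assume "\<not> w \<langle>$\<rangle> i < w \<langle>$\<rangle> (i + 1)"
    from card_invs_descent[OF this] 0 show False by simp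
  qed
  then show ?case by (intro exI[of _ "[]"]) (simp add: card_invs_one)
next
  case (Suc n)
  have "w \<noteq> 1" using Suc.hyps(2) card_invs_one by force
  then obtain i where i: "\<not> w \<langle>$\<rangle> i < w \<langle>$\<rangle> (i + 1)" using no_descent by blast
  from card_invs_descent[OF this] Suc.hyps(2) have n: "n = card (invs (w * simple_refl i))" by simp
  from Suc.hyps(1)[OF n] obtain a where "word_prod a = w * simple_refl i" "length a = n"
    using n by auto
  then show ?case using Suc.hyps(2) by (intro exI[of _ "a @ [i]"]) simp
qed

lemma perm_length_eq: "perm_length w = card (invs w)"
  unfolding perm_length_def
proof (rule Least_equality)
  show "\<exists>a. length a = card (invs w) \<and> word_prod a = w" using word_exists[of w] by auto
next
  fix k assume "\<exists>a. length a = k \<and> word_prod a = w"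
  then show "card (invs w) \<le> k" using card_invs_word by auto
qed

lemma perm_length_word: "perm_length (word_prod a) \<le> length a"
  by (simp add: perm_length_eq card_invs_word)

lemma reduced_word_exists: "\<exists>a. a \<in> reduced_words w"
  using word_exists[of w] by (auto simp: reduced_words_def perm_length_eq)

definition rmul :: "zperm \<Rightarrow> int \<Rightarrow> zperm" where
  "rmul w i = (if w \<langle>$\<rangle> i < w \<langle>$\<rangle> (i + 1) then w * simple_refl i else w)"

definition lmul :: "int \<Rightarrow> zperm \<Rightarrow> zperm" where
  "lmul i w = inverse (rmul (inverse w) i)"

lemma lmul_alt:
  "lmul i w = (if inverse w \<langle>$\<rangle> i < inverse w \<langle>$\<rangle> (i + 1) then simple_refl i * w else w)"
  by (simp add: lmul_def rmul_def)

lemma apply_inverse_iff: "inverse w \<langle>$\<rangle> a = b \<longleftrightarrow> w \<langle>$\<rangle> b = (a :: int)"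
proof -
  have "w \<langle>$\<rangle> (inverse w \<langle>$\<rangle> a) = a" "inverse w \<langle>$\<rangle> (w \<langle>$\<rangle> b) = b"
    by (simp_all add: apply_sequence)
  then show ?thesis by metis
qed

lemma refl_less:
  "a \<noteq> b \<Longrightarrow> \<not> (a = i \<and> b = i + 1) \<Longrightarrow> \<not> (a = i + 1 \<and> b = i) \<Longrightarrow>
   simple_refl i \<langle>$\<rangle> a < simple_refl i \<langle>$\<rangle> b \<longleftrightarrow> a < b"
  by (auto simp: apply_simple_refl)

lemma lmul_rmul: "lmul i (rmul w j) = rmul (lmul i w) j"
proof -
  define a b where "a = w \<langle>$\<rangle> j" and "b = w \<langle>$\<rangle> (j + 1)"
  have ab: "inverse w \<langle>$\<rangle> a = j" "inverse w \<langle>$\<rangle> b = j + 1" by (simp_all add: a_def b_def apply_inverse_iff)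
  have ne: "a \<noteq> b" by (simp add: a_def b_def apply_inj)
  have ne': "inverse w \<langle>$\<rangle> i \<noteq> inverse w \<langle>$\<rangle> (i + 1)" by (simp add: apply_inj)
  consider "a = i \<and> b = i + 1" | "a = i + 1 \<and> b = i"
    | "\<not> (a = i \<and> b = i + 1)" "\<not> (a = i + 1 \<and> b = i)" by blast
  then show ?thesis
  proof cases
    case 1
    have eq: "simple_refl i * w = w * simple_refl j"
    proof (rule perm_eqI)
      fix k
      have "w \<langle>$\<rangle> k = i \<longleftrightarrow> k = j" "w \<langle>$\<rangle> k = i + 1 \<longleftrightarrow> k = j + 1"
        using 1 by (metis a_def apply_inj, metis b_def 1 apply_inj)
      then show "(simple_refl i * w) \<langle>$\<rangle> k = (w * simple_refl j) \<langle>$\<rangle> k"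
        using 1 a_def b_def by (simp add: apply_mult apply_simple_refl)
    qed
    have "lmul i w = simple_refl i * w" using ab 1 by (simp add: lmul_alt)
    moreover have "rmul w j = simple_refl i * w" using 1 eq by (simp add: rmul_def a_def b_def)
    moreover have "rmul (simple_refl i * w) j = simple_refl i * w"
      using 1 by (simp add: rmul_def apply_mult a_def b_def)
    moreover have "lmul i (simple_refl i * w) = simple_refl i * w"
      using 1 ab by (simp add: lmul_alt apply_mult)
    ultimately show ?thesis by simp
  next
    case 2
    then have "lmul i w = w" "rmul w j = w"
      using ab by (simp_all add: lmul_alt rmul_def flip: a_def b_def)
    then show ?thesis by simp
  next
    case 3
    have A: "(simple_refl i * w) \<langle>$\<rangle> j < (simple_refl i * w) \<langle>$\<rangle> (j + 1) \<longleftrightarrow> w \<langle>$\<rangle> j < w \<langle>$\<rangle> (j + 1)"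
      using refl_less[OF ne 3] by (simp add: apply_mult a_def b_def)
    have 4: "\<not> (inverse w \<langle>$\<rangle> i = j \<and> inverse w \<langle>$\<rangle> (i + 1) = j + 1)"
      "\<not> (inverse w \<langle>$\<rangle> i = j + 1 \<and> inverse w \<langle>$\<rangle> (i + 1) = j)"
      using 3 by (auto simp: apply_inverse_iff a_def b_def)
    have B: "inverse (w * simple_refl j) \<langle>$\<rangle> i < inverse (w * simple_refl j) \<langle>$\<rangle> (i + 1)
        \<longleftrightarrow> inverse w \<langle>$\<rangle> i < inverse w \<langle>$\<rangle> (i + 1)"
      using refl_less[OF ne' 4] by (simp add: apply_mult)
    show ?thesis
      using A B by (simp add: lmul_alt rmul_def mult.assoc del: perm.inverse_distrib_swap)
  qed
qed

lemma lmul_foldl: "lmul i (foldl rmul w b) = foldl rmul (lmul i w) b"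
  by (induction b arbitrary: w) (simp_all add: lmul_rmul)

lemma foldr_foldl: "foldr lmul a (foldl rmul w b) = foldl rmul (foldr lmul a w) b"
  by (induction a) (simp_all add: lmul_foldl)

lemma rmul_length:
  assumes "perm_length (w * simple_refl i) = Suc (perm_length w)"
  shows "rmul w i = w * simple_refl i"
  using assms by (auto simp: rmul_def perm_length_eq dest: card_invs_descent)

lemma perm_length_step: "perm_length (w * simple_refl i) \<le> Suc (perm_length w)"
  by (simp add: perm_length_eq card_invs_refl)

lemma perm_length_inverse: "perm_length (inverse w) = perm_length w"
proof -
  have *: "perm_length (inverse v) \<le> perm_length v" for v
  proof -
    obtain a where a: "word_prod a = v" "length a = perm_length v"
      using reduced_word_exists by (auto simp: reduced_words_def)
    have "word_prod (rev c) = inverse (word_prod c)" for c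
      by (induction c) simp_all
    with perm_length_word[of "rev a"] a show ?thesis by simp
  qed
  from *[of w] *[of "inverse w"] show ?thesis by simp
qed

lemma reduced_snoc:
  assumes "a @ [i] \<in> reduced_words w"
  shows "a \<in> reduced_words (w * simple_refl i)" "perm_length w = Suc (perm_length (w * simple_refl i))"
proof -
  have w: "word_prod a * simple_refl i = w" "Suc (length a) = perm_length w"
    using assms by (auto simp: reduced_words_def)
  then have wi: "word_prod a = w * simple_refl i" by (metis refl_refl)
  have "perm_length w \<le> Suc (perm_length (w * simple_refl i))"
    using perm_length_step[of "w * simple_refl i" i] by simp
  then show "a \<in> reduced_words (w * simple_refl i)"
    "perm_length w = Suc (perm_length (w * simple_refl i))"
    using perm_length_word[of a] w wi by (auto simp: reduced_words_def)
qed

lemma foldl_reduced: "a \<in> reduced_words w \<Longrightarrow> foldl rmul 1 a = w"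
proof (induction a arbitrary: w rule: rev_induct)
  case (snoc i a)
  note r = reduced_snoc[OF snoc.prems]
  have "rmul (w * simple_refl i) i = w" using rmul_length[of "w * simple_refl i" i] r(2) by simp
  with snoc.IH[OF r(1)] show ?case by simp
qed (simp add: reduced_words_def)

lemma foldr_reduced: "a \<in> reduced_words w \<Longrightarrow> foldr lmul a 1 = w"
proof -
  assume a: "a \<in> reduced_words w"
  have rev: "word_prod (rev c) = inverse (word_prod c)" for c
    by (induction c) simp_all
  have "rev a \<in> reduced_words (inverse w)"
    using a by (simp add: reduced_words_def rev perm_length_inverse)
  then have "foldl rmul 1 (rev a) = inverse w" by (rule foldl_reduced)
  moreover have "foldr lmul c 1 = inverse (foldl rmul 1 (rev c))" for c
    by (induction c) (simp_all add: lmul_def)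
  ultimately show ?thesis by simp
qed

definition dmul :: "zperm \<Rightarrow> zperm \<Rightarrow> zperm" where
  "dmul u v = foldr lmul (SOME a. a \<in> reduced_words u) v"

lemma dmul_foldl: "dmul u (foldl rmul 1 b) = foldl rmul u b"
proof -
  have "(SOME a. a \<in> reduced_words u) \<in> reduced_words u"
    using reduced_word_exists by (rule someI_ex)
  then show ?thesis by (simp add: dmul_def foldr_foldl foldr_reduced)
qed

lemma is_demazure_dmul: "is_demazure_product dmul"
  unfolding is_demazure_product_def
proof (intro conjI allI impI)
  fix u v w
  obtain b c where bc: "b \<in> reduced_words v" "c \<in> reduced_words w"
    using reduced_word_exists by blast
  have "dmul (dmul u v) w = foldl rmul u (b @ c)"
    using dmul_foldl[of u b] dmul_foldl[of _ c] bc[THEN foldl_reduced] by simp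
  also have "\<dots> = dmul u (dmul v w)"
    using dmul_foldl[of u "b @ c"] dmul_foldl[of v c] bc[THEN foldl_reduced] by simp
  finally show "dmul (dmul u v) w = dmul u (dmul v w)" .
next
  fix u v assume *: "perm_length (u * v) = perm_length u + perm_length v"
  obtain a b where ab: "a \<in> reduced_words u" "b \<in> reduced_words v"
    using reduced_word_exists by blast
  with * have "a @ b \<in> reduced_words (u * v)" by (simp add: reduced_words_def)
  from foldl_reduced[OF this] show "dmul u v = u * v"
    using dmul_foldl[of u b] ab[THEN foldl_reduced] by simp
next
  fix i
  have "foldl rmul 1 [i] = simple_refl i" by (simp add: rmul_def)
  with dmul_foldl[of "simple_refl i" "[i]"] show "dmul (simple_refl i) (simple_refl i) = simple_refl i"
    by (simp add: rmul_def)
qed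

lemma is_demazure_foldl:
  assumes d: "is_demazure_product d" and a: "a \<in> reduced_words v"
  shows "d u v = foldl rmul u a"
  using a
proof (induction a arbitrary: v rule: rev_induct)
  case Nil
  then have "v = 1" "perm_length v = 0" by (auto simp: reduced_words_def)
  then show ?case using d by (simp add: is_demazure_product_def)
next
  case (snoc i a)
  have assoc: "d (d x y) z = d x (d y z)" for x y z using d by (simp add: is_demazure_product_def)
  have add: "d x y = x * y" if "perm_length (x * y) = perm_length x + perm_length y" for x y
    using d that by (simp add: is_demazure_product_def)
  have idem: "d (simple_refl i) (simple_refl i) = simple_refl i" using d by (simp add: is_demazure_product_def)
  have len: "perm_length (simple_refl i) = 1"
    using card_invs_ascent[of 1 i] by (simp add: perm_length_eq card_invs_one)
  have step: "d x (simple_refl i) = rmul x i" for x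
  proof (cases "x \<langle>$\<rangle> i < x \<langle>$\<rangle> (i + 1)")
    case True
    then show ?thesis using add[of x "simple_refl i"] card_invs_ascent[OF True] len
      by (simp add: rmul_def perm_length_eq)
  next
    case False
    have "d (x * simple_refl i) (simple_refl i) = x"
      using add[of "x * simple_refl i" "simple_refl i"] card_invs_descent[OF False] len
      by (simp add: perm_length_eq)
    then have "d x (simple_refl i) = x" using assoc[of "x * simple_refl i" "simple_refl i" "simple_refl i"] idem by simp
    then show ?thesis using False by (simp add: rmul_def)
  qed
  note r = reduced_snoc[OF snoc.prems]
  have "d (v * simple_refl i) (simple_refl i) = v"
    using add[of "v * simple_refl i" "simple_refl i"] r(2) len by simp
  then have "d u v = d (d u (v * simple_refl i)) (simple_refl i)" by (simp add: assoc)
  then show ?case using snoc.IH[OF r(1)] step by simp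
qed

theorem demazure_product_unique_existence: "\<exists>!d. is_demazure_product d"
proof (rule ex1I[of _ dmul])
  show "is_demazure_product dmul" by (rule is_demazure_dmul)
next
  fix d assume d: "is_demazure_product d"
  show "d = dmul"
  proof (intro ext)
    fix u v
    obtain a where "a \<in> reduced_words v" using reduced_word_exists by blast
    then show "d u v = dmul u v"
      using is_demazure_foldl[OF d] is_demazure_foldl[OF is_demazure_dmul] by metis
  qed
qed

corollary is_demazure_product_demazure: "is_demazure_product demazure"
  unfolding demazure_def 
  using demazure_product_unique_existence by (rule theI'[where P = is_demazure_product])

end

theory Submission
  imports Defs "HOL-Library.FuncSet"
begin

text \<open>
  Edelman--Greene insertion maps the reduced words of a permutation \<open>w\<close> bijectively to pairs of an
  increasing tableau \<open>P\<close>, whose reading word is a reduced word of \<open>w\<close>, and a standard tableau of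
  the same shape, and it turns descents of the word into descents of the tableau.  Hence \<open>F\<^sub>w\<close> is
  the sum of \<open>s\<close> of the conjugate shapes of all \<open>P\<close>, and for the conjugate \<open>w\<^sup>*\<close> of \<open>w\<close> under
  \<open>x \<mapsto> -x\<close> the same tableaux give \<open>F\<close> as the sum of \<open>s\<close> of their shapes.

  The monomials of \<open>F\<^sub>w\<close> are bounded in dominance order by the conjugate of the sorted code of \<open>w\<close>,
  and the extreme one has coefficient 1.  If the inverse of an atom of \<open>y\<close> has three consecutive
  entries \<open>c a b\<close> with \<open>a < b < c\<close>, replacing them by \<open>b c a\<close> gives another atom, with a strictly
  larger bound; an atom without such entries is determined by \<open>y\<close>, and its bound is \<open>\<mu>(y)\<close>.  So \<open>\<mu>(y)\<close>
  is the leading exponent for \<open>y\<close>, and it is also the one for \<open>y\<^sup>*\<close>: both multisets of code entries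
  are read off the arc diagram of \<open>y\<close>, where they differ by the numbers of arcs above left and
  above right endpoints, which are equidistributed.  The bound for \<open>y\<^sup>*\<close>, conjugated, is the lower
  bound for \<open>y\<close>.
\<close>

section \<open>Reduced words\<close>

text \<open>Monomials bound shapes only from above: \<open>s_\<lambda>\<close> contains every
  monomial below its own exponent \<open>\<lambda>\<close>, so the smallest shape in the expansion
  of \<open>inv_stanley y\<close> cannot be seen there. This is why \<open>star y\<close> is brought
  in. Both expansions run over the same pairs of an atom of \<open>y\<close> and a tableau, with
  conjugate shapes, so the largest shape on one side is the smallest on the other.

  All terms are nonnegative. Hence every shape that occurs shows its own exponent in the sum, a
  bound on exponents is a bound on shapes, and the coefficient 1 says that the extreme shape occurs
  once.

  The detour forces generality: \<open>star y\<close> moves only negative points, so codes and atoms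
  are treated for involutions of all integers, and positivity serves only to match the given code
  with \<open>right_code\<close>.

  Insertion of a letter that is already in the row makes sense only if its successor is there as
  well. Insertion is therefore a relation, and reducedness of the word is what makes it
  total.\<close>

definition reduced :: "int list \<Rightarrow> bool" where
  "reduced a \<longleftrightarrow> perm_length (word_prod a) = length a"

lemma reduced_words_iff: "a \<in> reduced_words w \<longleftrightarrow> reduced a \<and> word_prod a = w"
  by (auto simp: reduced_words_def reduced_def)

lemma reduced_Nil [simp]: "reduced []"
  by (simp add: reduced_def perm_length_eq card_invs_one)

lemma perm_length_mult: "perm_length (u * v) \<le> perm_length u + perm_length v"
proof -
  obtain a b where ab: "a \<in> reduced_words u" "b \<in> reduced_words v"
    using reduced_word_exists by metis
  then show ?thesis using perm_length_word[of "a @ b"] by (simp add: reduced_words_def)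
qed

lemma reduced_appendD:
  assumes "reduced (a @ b)"
  shows "reduced a" "reduced b"
  using assms perm_length_mult[of "word_prod a" "word_prod b"]
    perm_length_word[of a] perm_length_word[of b]
  by (auto simp: reduced_def)

lemma reduced_cong:
  assumes "reduced a" "word_prod b = word_prod a" "length b = length a"
  shows "reduced b"
  using assms by (simp add: reduced_def)

lemma not_reducedI: "word_prod a = word_prod b \<Longrightarrow> length b < length a \<Longrightarrow> \<not> reduced a"
  using perm_length_word[of b] by (simp add: reduced_def)

lemma swap_mult_left [simp]: "\<langle>a \<leftrightarrow> b\<rangle> * (\<langle>a \<leftrightarrow> b\<rangle> * u) = (u :: 'a perm)"
  using refl_refl[of 1 a b] by (simp flip: mult.assoc)

lemma refl_commute:
  assumes "2 \<le> \<bar>i - j\<bar>"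
  shows "simple_refl i * simple_refl j = simple_refl j * simple_refl i"
  by (rule perm_eqI) (use assms in \<open>auto simp: apply_mult apply_simple_refl\<close>)

lemma refl_braid:
  "simple_refl (i + 1) * simple_refl i * simple_refl (i + 1) =
   simple_refl i * simple_refl (i + 1) * simple_refl i"
  by (rule perm_eqI) (auto simp: apply_mult apply_simple_refl)

lemma reduced_neighbours: "reduced (a @ x # y # b) \<Longrightarrow> x \<noteq> y"
proof
  assume "reduced (a @ x # y # b)" "x = y"
  then show False using not_reducedI[of "a @ x # x # b" "a @ b"] by simp
qed

lemma reduced_nth_neq: "reduced a \<Longrightarrow> Suc j < length a \<Longrightarrow> a ! j \<noteq> a ! Suc j"
  using reduced_neighbours[of "take j a" "a ! j" "a ! Suc j" "drop (Suc (Suc j)) a"]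
    id_take_nth_drop[of j a] Cons_nth_drop_Suc[of "Suc j" a] by simp

lemma perm_length_step_le: "perm_length (simple_refl i * w) \<le> Suc (perm_length w)"
  using perm_length_step[of "inverse w" i] perm_length_inverse[of "simple_refl i * w"]
    perm_length_inverse[of w]
  by simp

lemma perm_length_left_ascent:
  assumes "inverse w \<langle>$\<rangle> i < inverse w \<langle>$\<rangle> (i + 1)"
  shows "perm_length (simple_refl i * w) = Suc (perm_length w)"
  using card_invs_ascent[OF assms] perm_length_inverse[of "simple_refl i * w"]
    perm_length_inverse[of w]
  by (simp add: perm_length_eq)

lemma perm_length_left_descent:
  assumes "\<not> inverse w \<langle>$\<rangle> i < inverse w \<langle>$\<rangle> (i + 1)"
  shows "perm_length w = Suc (perm_length (simple_refl i * w))"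
  using card_invs_descent[OF assms] perm_length_inverse[of "simple_refl i * w"]
    perm_length_inverse[of w]
  by (simp add: perm_length_eq)

lemma reduced_Cons_iff:
  "reduced (i # a) \<longleftrightarrow>
    reduced a \<and> inverse (word_prod a) \<langle>$\<rangle> i < inverse (word_prod a) \<langle>$\<rangle> (i + 1)"
proof
  assume *: "reduced (i # a)"
  then have "reduced a" using reduced_appendD[of "[i]" a] by simp
  with * show "reduced a \<and> inverse (word_prod a) \<langle>$\<rangle> i < inverse (word_prod a) \<langle>$\<rangle> (i + 1)"
    using perm_length_left_descent[of "word_prod a" i] by (auto simp: reduced_def)
next
  assume "reduced a \<and> inverse (word_prod a) \<langle>$\<rangle> i < inverse (word_prod a) \<langle>$\<rangle> (i + 1)"
  then show "reduced (i # a)"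
    using perm_length_left_ascent[of "word_prod a" i] by (simp add: reduced_def)
qed

lemma reduced_snoc_iff:
  "reduced (a @ [i]) \<longleftrightarrow>
    reduced a \<and> word_prod a \<langle>$\<rangle> i < word_prod a \<langle>$\<rangle> (i + 1)"
proof
  assume *: "reduced (a @ [i])"
  then have "reduced a" by (rule reduced_appendD)
  with * show "reduced a \<and> word_prod a \<langle>$\<rangle> i < word_prod a \<langle>$\<rangle> (i + 1)"
    using card_invs_descent[of "word_prod a" i] by (auto simp: reduced_def perm_length_eq)
next
  assume "reduced a \<and> word_prod a \<langle>$\<rangle> i < word_prod a \<langle>$\<rangle> (i + 1)"
  then show "reduced (a @ [i])"
    using card_invs_ascent[of "word_prod a" i] by (simp add: reduced_def perm_length_eq)
qed

lemma apply_inverse_apply [simp]: "inverse w \<langle>$\<rangle> (w \<langle>$\<rangle> x) = (x :: int)"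
  by (simp add: apply_inverse_iff)

lemma apply_apply_inverse [simp]: "w \<langle>$\<rangle> (inverse w \<langle>$\<rangle> x) = (x :: int)"
  using apply_inverse_iff by blast


section \<open>Edelman--Greene insertion into a row\<close>

definition wset :: "int set \<Rightarrow> zperm" where
  "wset R = word_prod (sorted_list_of_set R)"

lemma sorted_list_of_set_Un:
  fixes A B :: "int set"
  assumes "finite A" "finite B" "\<And>a b. a \<in> A \<Longrightarrow> b \<in> B \<Longrightarrow> a < b"
  shows "sorted_list_of_set (A \<union> B) = sorted_list_of_set A @ sorted_list_of_set B"
proof -
  have "sorted_wrt (<) (sorted_list_of_set A @ sorted_list_of_set B)"
    using assms by (simp add: sorted_wrt_append)
  moreover have "sorted_wrt (<) (sorted_list_of_set (A \<union> B))" by simp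
  ultimately show ?thesis
    using strict_sorted_equal[of "sorted_list_of_set (A \<union> B)"] assms by simp
qed

lemma wset_Un:
  assumes "finite A" "finite B" "\<And>a b. a \<in> A \<Longrightarrow> b \<in> B \<Longrightarrow> a < b"
  shows "wset (A \<union> B) = wset A * wset B"
  using sorted_list_of_set_Un[OF assms] by (simp add: wset_def)

lemma wset_single [simp]: "wset {x} = simple_refl x"
  by (simp add: wset_def)

lemma word_prod_commute:
  "(\<And>i. i \<in> set a \<Longrightarrow> 2 \<le> \<bar>i - x\<bar>) \<Longrightarrow> simple_refl x * word_prod a = word_prod a * simple_refl x"
proof (induction a)
  case (Cons i a)
  have "simple_refl x * word_prod (i # a) = simple_refl i * (simple_refl x * word_prod a)"
    using refl_commute[of x i] Cons.prems by (simp add: abs_minus_commute flip: mult.assoc)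
  then show ?case using Cons by (simp add: mult.assoc)
qed simp

lemma wset_commute:
  assumes "finite A" "\<And>i. i \<in> A \<Longrightarrow> 2 \<le> \<bar>i - x\<bar>"
  shows "simple_refl x * wset A = wset A * simple_refl x"
  unfolding wset_def by (rule word_prod_commute) (use assms in auto)

lemma wset_split:
  assumes "finite R" "x \<in> R"
  shows "wset R = wset {r \<in> R. r < x} * (simple_refl x * wset {r \<in> R. x < r})"
proof -
  define L U where "L = {r \<in> R. r < x}" and "U = {r \<in> R. x < r}"
  have fin: "finite L" "finite U" using assms by (simp_all add: L_def U_def)
  have R: "R = L \<union> ({x} \<union> U)"
    unfolding L_def U_def using assms(2) by (blast intro: linorder_cases)
  have "wset (L \<union> ({x} \<union> U)) = wset L * wset ({x} \<union> U)"
    by (rule wset_Un) (use fin in \<open>auto simp: L_def U_def\<close>)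
  also have "wset ({x} \<union> U) = wset {x} * wset U"
    by (rule wset_Un) (use fin in \<open>auto simp: U_def\<close>)
  finally show ?thesis unfolding R[symmetric] L_def[symmetric] U_def[symmetric] by simp
qed

text \<open>Inserting \<open>x\<close> into the row \<open>R\<close> ejects \<open>y\<close> and leaves \<open>R'\<close>.  Rows are strictly increasing, hence
  represented by sets; \<open>x \<in> R\<close> is the special case of Edelman--Greene insertion, corresponding to a
  braid relation, in which the row does not change.\<close>

definition bump :: "int set \<Rightarrow> int \<Rightarrow> int \<Rightarrow> int set \<Rightarrow> bool" where
  "bump R x y R' \<longleftrightarrow> finite R \<and> y \<in> R \<and>
     (if x \<in> R then y = x + 1 \<and> R' = R
      else x < y \<and> (\<forall>r\<in>R. \<not> (x < r \<and> r < y)) \<and> R' = insert x (R - {y}))"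

text \<open>Letters above \<open>y\<close> commute with \<open>x\<close>, and letters below
  \<open>x\<close> commute with \<open>y\<close>. In between, either \<open>y\<close> and
  \<open>x\<close> simply stand next to each other, or the braid relation turns \<open>x\<close>,
  \<open>x + 1\<close>, \<open>x\<close> into \<open>x + 1\<close>, \<open>x\<close>,
  \<open>x + 1\<close>.\<close>

lemma bump_word:
  assumes "bump R x y R'"
  shows "wset R * simple_refl x = simple_refl y * wset R'"
proof (cases "x \<in> R")
  case True
  then have y: "y = x + 1" "y \<in> R" "R' = R" "finite R" using assms by (auto simp: bump_def)
  define L U where "L = {r \<in> R. r < x}" and "U = {r \<in> R. x + 1 < r}"
  have fin: "finite L" "finite U" using y by (simp_all add: L_def U_def)
  have "{r \<in> R. x < r} = {x + 1} \<union> U" using y by (auto simp: U_def)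
  moreover have "wset ({x + 1} \<union> U) = simple_refl (x + 1) * wset U"
    by (subst wset_Un) (use fin in \<open>auto simp: U_def\<close>)
  ultimately have R: "wset R = wset L * (simple_refl x * (simple_refl (x + 1) * wset U))"
    using wset_split[OF y(4) True] by (simp add: L_def)
  have cU: "simple_refl x * wset U = wset U * simple_refl x"
    by (rule wset_commute) (use fin in \<open>auto simp: U_def\<close>)
  have cL: "simple_refl (x + 1) * wset L = wset L * simple_refl (x + 1)"
    by (rule wset_commute) (use fin in \<open>auto simp: L_def\<close>)
  have "wset R * simple_refl x
      = wset L * (simple_refl x * simple_refl (x + 1) * simple_refl x) * wset U"
    by (simp add: R cU mult.assoc)
  also have "\<dots> = wset L * (simple_refl (x + 1) * simple_refl x * simple_refl (x + 1)) * wset U"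
    by (simp only: refl_braid)
  also have "\<dots> = simple_refl (x + 1) * wset R"
    using cL by (simp add: R flip: mult.assoc)
  finally show ?thesis using y by simp
next
  case False
  then have y: "y \<in> R" "x < y" "\<forall>r\<in>R. \<not> (x < r \<and> r < y)" "R' = insert x (R - {y})" "finite R"
    using assms by (auto simp: bump_def)
  define L U where "L = {r \<in> R. r < x}" and "U = {r \<in> R. y < r}"
  have fin: "finite L" "finite U" using y by (simp_all add: L_def U_def)
  have "{r \<in> R. r < y} = L" using y False by (force simp: L_def)
  then have R: "wset R = wset L * (simple_refl y * wset U)"
    using wset_split[of R y] y by (simp add: U_def)
  have "{r \<in> R'. r < x} = L" "{r \<in> R'. x < r} = U" using y False by (auto simp: L_def U_def)
  then have R': "wset R' = wset L * (simple_refl x * wset U)"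
    using wset_split[of R' x] y by simp
  have cU: "simple_refl x * wset U = wset U * simple_refl x"
    by (rule wset_commute) (use fin y in \<open>auto simp: U_def\<close>)
  have cL: "simple_refl y * wset L = wset L * simple_refl y"
    by (rule wset_commute) (use fin y in \<open>auto simp: L_def\<close>)
  show ?thesis
  proof -
    have "wset R * simple_refl x = wset L * simple_refl y * (simple_refl x * wset U)"
      by (simp add: R cU mult.assoc)
    also have "\<dots> = simple_refl y * wset R'"
      by (simp add: R' mult.assoc flip: cL)
    finally show ?thesis .
  qed
qed

lemma bump_card:
  assumes "bump R x y R'"
  shows "card R' = card R"
proof (cases "x \<in> R")
  case False
  then have "R' = insert x (R - {y})" "finite R" "y \<in> R" using assms by (auto simp: bump_def)
  then show ?thesis using False card_Suc_Diff1[of R y] by (simp del: card_Diff_insert card_Diff_singleton)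
qed (use assms in \<open>simp add: bump_def\<close>)

lemma bump_simps:
  assumes "bump R x y R'"
  shows "finite R" "finite R'" "y \<in> R" "x \<in> R'" "x < y" "R' \<noteq> {}" "R \<noteq> {}"
  using assms by (auto simp: bump_def split: if_splits)

lemma bump_unique: "bump R x y R' \<Longrightarrow> bump R x z S \<Longrightarrow> y = z \<and> R' = S"
  by (auto simp: bump_def split: if_splits) (metis linorder_neqE)+

text \<open>Prepares the inversion of a bump: whether \<open>x\<close> was in the old row is seen
  from whether \<open>y\<close> is in the new one, and in both cases \<open>x\<close> is the largest
  entry of \<open>R'\<close> below \<open>y\<close>.\<close>

lemma bump_left_cases:
  assumes "bump R x y R'"
  shows "(y \<in> R' \<and> x = y - 1 \<and> R = R') \<or>
    (y \<notin> R' \<and> x \<in> R' \<and> x < y \<and> (\<forall>r\<in>R'. \<not> (x < r \<and> r < y)) \<and> R = insert y (R' - {x}))"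
  using assms by (auto simp: bump_def split: if_splits)

lemma bump_unique_left:
  assumes "bump R x y R'" "bump S z y R'"
  shows "x = z \<and> R = S"
  using bump_left_cases[OF assms(1)] bump_left_cases[OF assms(2)]
  by (metis linorder_neqE)

lemma card_remove_split:
  assumes "finite (R :: int set)" "x \<in> R"
  shows "card {r \<in> R. r < x} + card {r \<in> R. x < r} < card R"
proof -
  have "card {r \<in> R. r < x} + card {r \<in> R. x < r} = card ({r \<in> R. r < x} \<union> {r \<in> R. x < r})"
    by (rule card_Un_disjoint[symmetric]) (use assms in auto)
  also have "\<dots> < card R" by (rule psubset_card_mono) (use assms in auto)
  finally show ?thesis .
qed

text \<open>Without \<open>x + 1\<close> in the row, the inserted \<open>x\<close> commutes with all
  larger letters, meets the \<open>x\<close> of the row and cancels, which shortens the word. So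
  reducedness is what makes the special case of insertion applicable.\<close>

lemma row_reduced_insert:
  assumes R: "finite R" "x \<in> R" and red: "reduced (sorted_list_of_set R @ [x])"
  shows "x + 1 \<in> R"
proof (rule ccontr)
  assume x1: "x + 1 \<notin> R"
  define L U where "L = {r \<in> R. r < x}" and "U = {r \<in> R. x < r}"
  have fin: "finite L" "finite U" using R by (simp_all add: L_def U_def)
  have R': "wset R = wset L * (simple_refl x * wset U)"
    using wset_split[OF R] by (simp add: L_def U_def)
  have cU: "simple_refl x * wset U = wset U * simple_refl x"
  proof (rule wset_commute)
    fix i assume "i \<in> U"
    then have "i \<noteq> x + 1" "x < i" using x1 by (auto simp: U_def)
    then show "2 \<le> \<bar>i - x\<bar>" by simp
  qed (use fin in auto)
  have "wset R * simple_refl x = wset L * wset U"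
    by (simp add: R' mult.assoc flip: cU)
  then have "word_prod (sorted_list_of_set R @ [x])
      = word_prod (sorted_list_of_set L @ sorted_list_of_set U)"
    by (simp add: wset_def)
  moreover have "length (sorted_list_of_set L @ sorted_list_of_set U) < card R"
    using card_remove_split[OF R] by (simp add: L_def U_def)
  ultimately show False using red not_reducedI by fastforce
qed

text \<open>The mirror image for reverse insertion: here \<open>y\<close> arrives from the left,
  past the smaller letters.\<close>

lemma row_reduced_insert_left:
  assumes R: "finite R" "y \<in> R" and red: "reduced (y # sorted_list_of_set R)"
  shows "y - 1 \<in> R"
proof (rule ccontr)
  assume y1: "y - 1 \<notin> R"
  define L U where "L = {r \<in> R. r < y}" and "U = {r \<in> R. y < r}"
  have fin: "finite L" "finite U" using R by (simp_all add: L_def U_def)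
  have R': "wset R = wset L * (simple_refl y * wset U)"
    using wset_split[OF R] by (simp add: L_def U_def)
  have cL: "simple_refl y * wset L = wset L * simple_refl y"
  proof (rule wset_commute)
    fix i assume "i \<in> L"
    then have "i \<noteq> y - 1" "i < y" using y1 by (auto simp: L_def)
    then show "2 \<le> \<bar>i - y\<bar>" by simp
  qed (use fin in auto)
  have "simple_refl y * wset R = wset L * wset U"
    using cL by (simp add: R' flip: mult.assoc)
  then have "word_prod (y # sorted_list_of_set R)
      = word_prod (sorted_list_of_set L @ sorted_list_of_set U)"
    by (simp add: wset_def)
  moreover have "length (sorted_list_of_set L @ sorted_list_of_set U) < card R"
    using card_remove_split[OF R] by (simp add: L_def U_def)
  ultimately show False using red not_reducedI by fastforce
qed

lemma bump_exists:
  assumes R: "finite R" "\<not> (\<forall>r\<in>R. r < x)" and red: "reduced (sorted_list_of_set R @ [x])"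
  shows "\<exists>y R'. bump R x y R'"
proof (cases "x \<in> R")
  case True
  then show ?thesis using row_reduced_insert[OF R(1) True red] R by (auto simp: bump_def)
next
  case False
  have fin: "finite {r \<in> R. x < r}" "{r \<in> R. x < r} \<noteq> {}"
    using R False by (auto, metis linorder_neqE_linordered_idom)
  define y where "y = Min {r \<in> R. x < r}"
  have "y \<in> {r \<in> R. x < r}" using Min_in[OF fin] by (simp add: y_def)
  moreover have "\<not> (x < r \<and> r < y)" if "r \<in> R" for r
    using Min_le[OF fin(1), of r] that by (auto simp: y_def)
  ultimately show ?thesis using False R by (auto simp: bump_def intro!: exI[of _ y])
qed

lemma bump_exists_left:
  assumes R: "finite R'" "\<exists>r\<in>R'. r < y" and red: "reduced (y # sorted_list_of_set R')"
  shows "\<exists>x R. bump R x y R'"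
proof (cases "y \<in> R'")
  case True
  then have "bump R' (y - 1) y R'"
    using row_reduced_insert_left[OF R(1) True red] R by (auto simp: bump_def)
  then show ?thesis by blast
next
  case False
  have fin: "finite {r \<in> R'. r < y}" "{r \<in> R'. r < y} \<noteq> {}" using R by auto
  define x where "x = Max {r \<in> R'. r < y}"
  have x: "x \<in> {r \<in> R'. r < y}" using Max_in[OF fin] by (simp add: x_def)
  have "\<not> (x < r \<and> r < y)" if "r \<in> R'" for r
    using Max_ge[OF fin(1), of r] that by (auto simp: x_def)
  then have "bump (insert y (R' - {x})) x y R'" using False R x by (auto simp: bump_def)
  then show ?thesis by blast
qed


section \<open>Edelman--Greene insertion into a tableau\<close>

text \<open>For the rows \<open>R\<close> and \<open>S\<close> sorted increasingly: \<open>S\<close> is not longer than \<open>R\<close>, and each entry of \<open>S\<close>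
  exceeds the entry of \<open>R\<close> in the same column.\<close>

definition colstrict :: "int set \<Rightarrow> int set \<Rightarrow> bool" where
  "colstrict R S \<longleftrightarrow> (\<forall>t. card (S \<inter> {..t}) \<le> card (R \<inter> {..<t}))"

text \<open>What the ejected \<open>y\<close> does to the next row alone. The empty set is allowed
  for \<open>S\<close>, so that the creation of a new row is the appending case.\<close>

definition row_step :: "int set \<Rightarrow> int \<Rightarrow> int set \<Rightarrow> bool" where
  "row_step S y S' \<longleftrightarrow> finite S \<and> ((\<forall>s\<in>S. s < y) \<and> S' = insert y S \<or> (\<exists>z. bump S y z S'))"

lemma row_step_simps:
  assumes "row_step S y S'"
  shows "finite S" "finite S'" "y \<in> S'"
  using assms bump_simps[of S y _ S'] by (auto simp: row_step_def)

lemma bump_not_above: "bump R x y R' \<Longrightarrow> \<forall>r\<in>R. r < x \<Longrightarrow> False"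
  using bump_simps(3,5)[of R x y R'] by fastforce

lemma bump_card_less:
  assumes "bump R x y R'"
  shows "card (R \<inter> {..<t}) \<le> card (R' \<inter> {..<t})"
proof (cases "x \<in> R \<or> t \<le> y")
  case True
  then have "R \<inter> {..<t} \<subseteq> R' \<inter> {..<t}" using assms by (auto simp: bump_def split: if_splits)
  then show ?thesis using bump_simps[OF assms] by (intro card_mono) auto
next
  case False
  then have "R \<inter> {..<t} = insert y (R \<inter> {..<t} - {y})"
    "R' \<inter> {..<t} = insert x (R \<inter> {..<t} - {y})" "finite (R \<inter> {..<t} - {y})" "x \<notin> R"
    using assms by (auto simp: bump_def)
  then show ?thesis
    using card_insert_disjoint[of "R \<inter> {..<t} - {y}" x] card_insert_disjoint[of "R \<inter> {..<t} - {y}" y]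
    by simp
qed

lemma bump_card_atMost:
  assumes "bump R x y R'"
  shows "card (R \<inter> {..t}) \<le> card (R' \<inter> {..t})"
proof -
  have "{..t} = {..<t + 1}" by auto
  then show ?thesis using bump_card_less[OF assms] by simp
qed

text \<open>The entry \<open>x\<close> is counted on the right but not on the left: either it is new
  in the row, or it equals \<open>y - 1\<close>. This is the room that the entry \<open>y\<close>
  needs in the next row.\<close>

lemma bump_card_Suc:
  assumes "bump R x y R'"
  shows "Suc (card (R \<inter> {..<y - 1})) \<le> card (R' \<inter> {..<y})"
proof -
  have "card (insert x (R \<inter> {..<y - 1})) \<le> card (R' \<inter> {..<y})"
    by (rule card_mono) (use assms bump_simps[OF assms] in \<open>auto simp: bump_def split: if_splits\<close>)
  moreover have "x \<notin> R \<inter> {..<y - 1}" using assms by (auto simp: bump_def split: if_splits)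
  ultimately show ?thesis using bump_simps[OF assms] by simp
qed

text \<open>A count can grow only because \<open>y\<close> came in while the entry it ejected, if
  any, lies above \<open>t\<close>; then all other entries up to \<open>t\<close> are below
  \<open>y\<close>.\<close>

lemma row_step_card:
  assumes "row_step S y S'"
  shows "card (S' \<inter> {..t}) \<le> card (S \<inter> {..t}) \<or>
    (y \<le> t \<and> card (S' \<inter> {..t}) \<le> Suc (card (S \<inter> {..y - 1})))"
proof -
  note fin = row_step_simps(1,2)[OF assms]
  consider (app) "\<forall>s\<in>S. s < y" "S' = insert y S" | (same) "S' = S"
    | (new) z where "y < z" "z \<in> S" "\<forall>s\<in>S. \<not> (y < s \<and> s < z)" "S' = insert y (S - {z})" "y \<notin> S"
    using assms by (auto simp: row_step_def bump_def split: if_splits)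
  then show ?thesis
  proof cases
    case app
    show ?thesis
    proof (cases "t < y")
      case True
      then have "S' \<inter> {..t} \<subseteq> S \<inter> {..t}" using app by auto
      then show ?thesis using fin by (simp add: card_mono)
    next
      case False
      have "S' \<inter> {..t} \<subseteq> insert y (S \<inter> {..y - 1})" using app by auto
      then have "card (S' \<inter> {..t}) \<le> card (insert y (S \<inter> {..y - 1}))" using fin by (intro card_mono) auto
      then show ?thesis using False fin by (simp add: card_insert_if split: if_splits)
    qed
  next
    case new
    consider "t < y" | "y \<le> t" "t < z" | "z \<le> t" by linarith
    then show ?thesis
    proof cases
      case 1
      then have "S' \<inter> {..t} \<subseteq> S \<inter> {..t}" using new by auto
      then show ?thesis using fin by (simp add: card_mono)
    next
      case 2
      then have "s < y" if "s \<in> S" "s \<le> t" for s using new that by (metis le_less_trans not_less_iff_gr_or_eq)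
      then have "S' \<inter> {..t} \<subseteq> insert y (S \<inter> {..y - 1})" using new by auto
      then have "card (S' \<inter> {..t}) \<le> card (insert y (S \<inter> {..y - 1}))" using fin by (intro card_mono) auto
      then show ?thesis using 2 fin by (simp add: card_insert_if split: if_splits)
    next
      case 3
      then have "S' \<inter> {..t} \<subseteq> insert y (S \<inter> {..t} - {z})" using new by auto
      then have "card (S' \<inter> {..t}) \<le> card (insert y (S \<inter> {..t} - {z}))" using fin by (intro card_mono) auto
      also have "\<dots> = Suc (card (S \<inter> {..t} - {z}))" using fin new by (intro card_insert_disjoint) auto
      also have "\<dots> = card (S \<inter> {..t})" using fin new 3 by (intro card_Suc_Diff1) auto
      finally show ?thesis by simp
    qed
  qed simp
qed

text \<open>Where the count for \<open>S'\<close> has not grown, the old inequality survives because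
  the counts for the upper row only grow. Where it has, the new entry \<open>y\<close> is paid for
  by \<open>bump_card_Suc\<close>.\<close>

lemma colstrict_forward:
  assumes b: "bump R x y R'" and c: "colstrict R S" and s: "row_step S y S'"
  shows "colstrict R' S'"
  unfolding colstrict_def
proof
  fix t
  show "card (S' \<inter> {..t}) \<le> card (R' \<inter> {..<t})"
    using row_step_card[OF s, of t]
  proof
    assume "card (S' \<inter> {..t}) \<le> card (S \<inter> {..t})"
    also have "\<dots> \<le> card (R \<inter> {..<t})" using c by (simp add: colstrict_def)
    also have "\<dots> \<le> card (R' \<inter> {..<t})" by (rule bump_card_less[OF b])
    finally show ?thesis .
  next
    assume *: "y \<le> t \<and> card (S' \<inter> {..t}) \<le> Suc (card (S \<inter> {..y - 1}))"
    then have "card (S' \<inter> {..t}) \<le> Suc (card (R \<inter> {..<y - 1}))"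
      using c unfolding colstrict_def by (meson Suc_le_mono order.trans)
    also have "\<dots> \<le> card (R' \<inter> {..<y})" by (rule bump_card_Suc[OF b])
    also have "\<dots> \<le> card (R' \<inter> {..<t})"
      by (rule card_mono) (use * bump_simps[OF b] in auto)
    finally show ?thesis .
  qed
qed

text \<open>The count for \<open>R\<close> falls below that for \<open>R'\<close> only if
  \<open>x < t \<le> y\<close> and \<open>y\<close> is not in \<open>R'\<close>, and then by one. In
  this range one unit has to be gained on the side of \<open>S\<close>.\<close>

lemma colstrict_backward:
  assumes b: "bump R x y R'" and c: "colstrict R' S'" and s: "row_step S y S'"
  shows "colstrict R S"
  unfolding colstrict_def
proof
  fix t
  note fin = row_step_simps[OF s] bump_simps[OF b]
  have mono: "card (S \<inter> {..t}) \<le> card (S' \<inter> {..t})" for t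
  proof (cases "S \<subseteq> S'")
    case True
    then show ?thesis using fin by (intro card_mono) auto
  next
    case False
    then show ?thesis using s bump_card_atMost by (auto simp: row_step_def)
  qed
  show "card (S \<inter> {..t}) \<le> card (R \<inter> {..<t})"
  proof (cases "y \<notin> R' \<and> x < t \<and> t \<le> y")
    case False
    have "card (R' \<inter> {..<t}) \<le> card (R \<inter> {..<t})"
    proof (cases "y < t \<and> y \<notin> R'")
      case True
      then have R: "R = insert y (R' - {x})" "x \<in> R'" "x < y" using bump_left_cases[OF b] by auto
      then have "R \<inter> {..<t} = insert y (R' \<inter> {..<t} - {x})" using True by auto
      then have "card (R \<inter> {..<t}) = Suc (card (R' \<inter> {..<t} - {x}))" using True fin by simp
      also have "\<dots> = card (R' \<inter> {..<t})" using R True fin by (intro card_Suc_Diff1) auto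
      finally show ?thesis by simp
    next
      case F: False
      then have "R' \<inter> {..<t} \<subseteq> R \<inter> {..<t}" using False bump_left_cases[OF b] by auto
      then show ?thesis using fin by (intro card_mono) auto
    qed
    then show ?thesis using mono[of t] c by (meson colstrict_def order.trans)
  next
    case True
    then have R: "R = insert y (R' - {x})" "x \<in> R'" "x < y" "\<forall>r\<in>R'. \<not> (x < r \<and> r < y)"
      using bump_left_cases[OF b] by auto
    \<comment> \<open>The gained unit: if \<open>y\<close> is in \<open>S\<close>, then so is
      \<open>y + 1\<close>, and column strictness is used at \<open>y + 1\<close>; otherwise
      \<open>y\<close> is new in \<open>S'\<close>.\<close>
    have "Suc (card (S \<inter> {..y})) \<le> card (R' \<inter> {..<y})"
    proof (cases "y \<in> S")
      case yS: True
      then have S: "S' = S" "y + 1 \<in> S" using s by (auto simp: row_step_def bump_def)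
      have "S \<inter> {..y + 1} = insert (y + 1) (S \<inter> {..y})" using S by auto
      then have "Suc (card (S \<inter> {..y})) = card (S' \<inter> {..y + 1})" using fin S by simp
      also have "\<dots> \<le> card (R' \<inter> {..<y + 1})" using c by (simp add: colstrict_def)
      also have "R' \<inter> {..<y + 1} = R' \<inter> {..<y}" using True by (auto simp: order.order_iff_strict)
      finally show ?thesis .
    next
      case False
      then have "S' \<inter> {..y} = insert y (S \<inter> {..y})"
        using s by (auto simp: row_step_def bump_def split: if_splits)
      then have "Suc (card (S \<inter> {..y})) = card (S' \<inter> {..y})" using fin False by simp
      also have "\<dots> \<le> card (R' \<inter> {..<y})" using c by (simp add: colstrict_def)
      finally show ?thesis .
    qed
    moreover have "card (S \<inter> {..t}) \<le> card (S \<inter> {..y})"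
      by (rule card_mono) (use True fin in auto)
    moreover
    have "r < t" if "r \<in> R'" "r < y" "r \<noteq> x" for r using R(4) that True by force
    then have "R \<inter> {..<t} = R' \<inter> {..<y} - {x}" using R True by auto
    then have "card (R \<inter> {..<t}) = card (R' \<inter> {..<y}) - 1" using R fin by simp
    ultimately show ?thesis by simp
  qed
qed

section \<open>Increasing tableaux, insertion and its inverse\<close>

fun top_row :: "int set list \<Rightarrow> int set" where
  "top_row [] = {}"
| "top_row (R # P) = R"

fun tableau :: "int set list \<Rightarrow> bool" where
  "tableau [] \<longleftrightarrow> True"
| "tableau (R # P) \<longleftrightarrow> finite R \<and> R \<noteq> {} \<and> colstrict R (top_row P) \<and> tableau P"

fun reading_word :: "int set list \<Rightarrow> int list" where
  "reading_word [] = []"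
| "reading_word (R # P) = reading_word P @ sorted_list_of_set R"

text \<open>The number \<open>k\<close> is the index of the row that grows, with
  \<open>k = length P\<close> for a new row. No rule applies when \<open>x\<close> meets a row that
  contains \<open>x\<close> but not \<open>x + 1\<close>.\<close>

inductive ins :: "int set list \<Rightarrow> int \<Rightarrow> nat \<Rightarrow> int set list \<Rightarrow> bool" where
  ins_Nil: "ins [] x 0 [{x}]"
| ins_app: "(\<forall>r\<in>R. r < x) \<Longrightarrow> ins (R # P) x 0 (insert x R # P)"
| ins_bump: "bump R x y R' \<Longrightarrow> ins P y k P' \<Longrightarrow> ins (R # P) x (Suc k) (R' # P')"

inductive_cases ins_NilE: "ins [] x k P'"
inductive_cases ins_ConsE: "ins (R # P) x k P'"
lemma top_row_finite: "tableau P \<Longrightarrow> finite (top_row P)"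
  by (cases P) auto

lemma ins_row_step: "ins P x k P' \<Longrightarrow> tableau P \<Longrightarrow> row_step (top_row P) x (top_row P')"
  by (induction rule: ins.cases) (auto simp: row_step_def)

lemma colstrict_mono:
  assumes "colstrict R S" "finite R'" "R \<subseteq> R'"
  shows "colstrict R' S"
proof -
  have "card (R \<inter> {..<t}) \<le> card (R' \<inter> {..<t})" for t
    by (rule card_mono) (use assms in auto)
  then show ?thesis using assms(1) unfolding colstrict_def by (meson order.trans)
qed

lemma ins_tableau: "ins P x k P' \<Longrightarrow> tableau P \<Longrightarrow> tableau P'"
proof (induction rule: ins.induct)
  case (ins_app R x P)
  then show ?case using colstrict_mono[of R "top_row P" "insert x R"] by auto
next
  case (ins_bump R x y R' P k P')
  then show ?case
    using colstrict_forward[of R x y R' "top_row P" "top_row P'"] ins_row_step[of P y k P']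
      bump_simps[of R x y R'] by auto
qed (simp add: colstrict_def)

lemma sorted_list_of_set_append1:
  "finite R \<Longrightarrow> (\<forall>r\<in>R. r < x) \<Longrightarrow> sorted_list_of_set (insert x R) = sorted_list_of_set R @ [x :: int]"
  using sorted_list_of_set_Un[of R "{x}"] by simp

lemma ins_word:
  "ins P x k P' \<Longrightarrow> tableau P \<Longrightarrow>
    word_prod (reading_word P') = word_prod (reading_word P) * simple_refl x"
proof (induction rule: ins.induct)
  case (ins_app R x P)
  then have "sorted_list_of_set (insert x R) = sorted_list_of_set R @ [x]"
    using sorted_list_of_set_append1[of R x] by simp
  then show ?case unfolding reading_word.simps by (simp add: mult.assoc)
next
  case (ins_bump R x y R' P k P')
  then show ?case using bump_word[of R x y R'] by (simp add: wset_def mult.assoc)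
qed simp

lemma length_reading_word: "tableau P \<Longrightarrow> length (reading_word P) = sum_list (map card P)"
  by (induction P) auto

lemma ins_shape:
  "ins P x k P' \<Longrightarrow> tableau P \<Longrightarrow> k \<le> length P \<and>
    map card P' = (if k < length P then (map card P)[k := Suc (card (P ! k))] else map card P @ [1])"
proof (induction rule: ins.induct)
  case (ins_app R x P)
  then have "x \<notin> R" by auto
  then show ?case using ins_app by simp
next
  case (ins_bump R x y R' P k P')
  then show ?case using bump_card[of R x y R'] by auto
qed simp

lemma sum_list_update_Suc:
  "k < length xs \<Longrightarrow> sum_list (xs[k := Suc (xs ! k)]) = Suc (sum_list xs :: nat)"
  by (induction xs arbitrary: k) (auto split: nat.splits)

lemma ins_length: "ins P x k P' \<Longrightarrow> tableau P \<Longrightarrow> length (reading_word P') = Suc (length (reading_word P))"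
  using ins_shape[of P x k P'] ins_tableau[of P x k P'] sum_list_update_Suc[of k "map card P"]
  by (auto simp: length_reading_word split: if_splits)

lemma ins_unique: "ins P x k P' \<Longrightarrow> ins P x l Q \<Longrightarrow> k = l \<and> P' = Q"
proof (induction arbitrary: l Q rule: ins.induct)
  case (ins_Nil x)
  then show ?case by (auto elim: ins_NilE)
next
  case (ins_app R x P)
  from ins_app(2) show ?case
    by (rule ins_ConsE) (use ins_app(1) in \<open>auto dest: bump_not_above\<close>)
next
  case (ins_bump R x y R' P k P')
  from ins_bump.prems show ?case
  proof (rule ins_ConsE)
    assume "\<forall>r\<in>R. r < x"
    then show ?thesis using bump_simps(3,5)[OF ins_bump.hyps(1)] by force
  next
    fix z S m T assume *: "l = Suc m" "Q = S # T" "bump R x z S" "ins P z m T"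
    then show ?thesis using bump_unique[OF ins_bump.hyps(1) *(3)] ins_bump.IH by auto
  qed
qed

text \<open>Reducedness passes from row to row: by \<open>bump_word\<close>, the word with
  \<open>x\<close> after the old row and the word with \<open>y\<close> before the new row have the
  same product and the same length.\<close>

lemma ins_exists: "tableau P \<Longrightarrow> reduced (reading_word P @ [x]) \<Longrightarrow> \<exists>k P'. ins P x k P'"
proof (induction P arbitrary: x)
  case Nil
  show ?case using ins_Nil by blast
next
  case (Cons R P)
  show ?case
  proof (cases "\<forall>r\<in>R. r < x")
    case True
    then show ?thesis using ins_app by blast
  next
    case False
    have fin: "finite R" and "tableau P" using Cons.prems by auto
    have red: "reduced (reading_word P @ sorted_list_of_set R @ [x])" using Cons.prems by simp
    then obtain y R' where b: "bump R x y R'"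
      using bump_exists[OF fin False] reduced_appendD(2) by blast
    have "reduced (reading_word P @ (y # sorted_list_of_set R'))"
    proof (rule reduced_cong[OF red])
      show "word_prod (reading_word P @ y # sorted_list_of_set R') =
        word_prod (reading_word P @ sorted_list_of_set R @ [x])"
        using bump_word[OF b] by (simp add: wset_def)
    qed (use bump_card[OF b] in simp)
    then have "reduced (reading_word P @ [y])"
      using reduced_appendD(1)[of "reading_word P @ [y]" "sorted_list_of_set R'"] by simp
    then obtain k P' where "ins P y k P'" using Cons.IH \<open>tableau P\<close> by blast
    then show ?thesis using ins_bump[OF b] by blast
  qed
qed

text \<open>The hypothesis on \<open>k\<close> says that row \<open>k\<close> ends in a corner. In
  row 0 its last entry is taken away; in a lower row the rows below the top are treated by
  induction, and the entry \<open>y\<close> that comes out of them is bumped back through the top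
  row.\<close>

lemma ins_exists_left:
  "tableau P' \<Longrightarrow> reduced (reading_word P') \<Longrightarrow> k < length P' \<Longrightarrow>
    Suc k = length P' \<or> card (P' ! Suc k) < card (P' ! k) \<Longrightarrow> \<exists>P x. tableau P \<and> ins P x k P'"
proof (induction k arbitrary: P')
  case 0
  then obtain R Q where P': "P' = R # Q" by (cases P') auto
  have R: "finite R" "R \<noteq> {}" "colstrict R (top_row Q)" "tableau Q" using 0 P' by auto
  define y where "y = Max R"
  have y: "y \<in> R" "\<And>r. r \<in> R \<Longrightarrow> r \<le> y" using R by (simp_all add: y_def)
  have lt: "\<forall>r\<in>R - {y}. r < y" using y by force
  show ?case
  proof (cases "R = {y}")
    case True
    have "Q = []"
    proof (rule ccontr)
      assume "Q \<noteq> []"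
      then have "card (Q ! 0) < 1" using 0 P' True by simp
      moreover have "finite (Q ! 0)" "Q ! 0 \<noteq> {}" using R(4) \<open>Q \<noteq> []\<close> by (cases Q; simp)+
      ultimately show False by (simp add: card_gt_0_iff)
    qed
    then show ?thesis using P' True ins_Nil[of y] tableau.simps(1) by metis
  next
    case False
    have "colstrict (R - {y}) (top_row Q)"
      unfolding colstrict_def
    proof
      fix t
      show "card (top_row Q \<inter> {..t}) \<le> card ((R - {y}) \<inter> {..<t})"
      proof (cases "t \<le> y")
        case True
        then have "(R - {y}) \<inter> {..<t} = R \<inter> {..<t}" by auto
        then show ?thesis using R by (simp add: colstrict_def)
      next
        case False
        then have "(R - {y}) \<inter> {..<t} = R - {y}" using lt by (auto simp: not_le dest: order.strict_trans)
        moreover have "card (top_row Q) < card R"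
          using 0 P' R by (cases Q) (auto simp: card_gt_0_iff)
        moreover have "card (top_row Q \<inter> {..t}) \<le> card (top_row Q)"
          using top_row_finite[OF R(4)] by (intro card_mono) auto
        ultimately show ?thesis using y R by simp
      qed
    qed
    then have "tableau ((R - {y}) # Q)" using R False y by auto
    moreover have "ins ((R - {y}) # Q) y 0 P'"
      using ins_app[OF lt, of Q] y P' by (simp add: insert_absorb)
    ultimately show ?thesis by blast
  qed
next
  case (Suc k)
  then obtain R Q where P': "P' = R # Q" by (cases P') auto
  have R: "finite R" "R \<noteq> {}" "colstrict R (top_row Q)" "tableau Q" using Suc.prems P' by auto
  have redQ: "reduced (reading_word Q)" and red: "reduced (reading_word Q @ sorted_list_of_set R)"
    using Suc.prems P' reduced_appendD(1) by auto
  have "\<exists>P x. tableau P \<and> ins P x k Q"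
    by (rule Suc.IH) (use R redQ Suc.prems P' in auto)
  then obtain P0 y where P0: "tableau P0" "ins P0 y k Q" by blast
  note st = ins_row_step[OF P0(2,1)]
  \<comment> \<open>Since \<open>y\<close> is in the second row, column strictness provides an entry
    of \<open>R\<close> below \<open>y\<close>, which the reverse bump needs.\<close>
  have "1 \<le> card (top_row Q \<inter> {..y})"
    using row_step_simps[OF st] by (auto simp: Suc_le_eq card_gt_0_iff)
  also have "\<dots> \<le> card (R \<inter> {..<y})" using R by (simp add: colstrict_def)
  finally have "R \<inter> {..<y} \<noteq> {}" by force
  then have ex: "\<exists>r\<in>R. r < y" by auto
  have "reduced (reading_word P0 @ (y # sorted_list_of_set R))"
    by (rule reduced_cong[OF red])
      (use ins_word[OF P0(2,1)] ins_length[OF P0(2,1)] in \<open>simp_all add: mult.assoc\<close>)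
  then have "reduced (y # sorted_list_of_set R)" by (rule reduced_appendD)
  then obtain x R0 where b: "bump R0 x y R" using bump_exists_left[OF R(1) ex] by blast
  have "tableau (R0 # P0)"
    using colstrict_backward[OF b R(3) st] bump_simps[OF b] P0 by simp
  moreover have "ins (R0 # P0) x (Suc k) P'" using ins_bump[OF b P0(2)] P' by simp
  ultimately show ?case by blast
qed

lemma insert_Max_unique:
  fixes x z :: int
  assumes "insert x R = insert z S" "\<forall>r\<in>R. r < x" "\<forall>s\<in>S. s < z"
  shows "x = z \<and> R = S"
proof -
  have "x = z" using assms by (metis insertE insertI1 order.asym)
  moreover have "x \<notin> R" "z \<notin> S" using assms by auto
  ultimately show ?thesis using assms(1) by (simp add: insert_ident)
qed

lemma ins_unique_left:
  "ins P x k P' \<Longrightarrow> tableau P \<Longrightarrow> ins S z k P' \<Longrightarrow> tableau S \<Longrightarrow> P = S \<and> x = z"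
proof (induction arbitrary: S z rule: ins.induct)
  case (ins_Nil x)
  have "\<not> (\<exists>R P. S = R # P)"
  proof
    assume "\<exists>R P. S = R # P"
    then obtain R P where S: "S = R # P" by blast
    with ins_Nil(2) have "insert z R = {x}" "\<forall>r\<in>R. r < z" by (auto elim: ins_ConsE)
    moreover have "R \<noteq> {}" using ins_Nil(3) S by simp
    ultimately show False by (metis all_not_in_conv insert_iff order.irrefl singletonD)
  qed
  then have "S = []" by (cases S) auto
  then show ?case using ins_Nil(2) by (auto elim: ins_NilE)
next
  case (ins_app R x P)
  show ?case
  proof (cases S)
    case Nil
    then have "insert x R = {z}" "P = []" using ins_app.prems by (auto elim: ins_NilE)
    then show ?thesis using ins_app.prems(1) ins_app.hyps by (metis all_not_in_conv insert_iff order.irrefl singletonD tableau.simps(2))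
  next
    case (Cons R2 P2)
    then show ?thesis
      using ins_app insert_Max_unique[of x R z R2] by (auto elim!: ins_ConsE)
  qed
next
  case (ins_bump R x y R' P k P')
  show ?case
  proof (cases S)
    case Nil
    then show ?thesis using ins_bump.prems by (auto elim: ins_NilE)
  next
    case (Cons R2 P2)
    with ins_bump.prems obtain u where u: "bump R2 z u R'" "ins P2 u k P'"
      by (auto elim: ins_ConsE)
    have "P = P2 \<and> y = u"
      by (rule ins_bump.IH) (use ins_bump.prems u Cons in auto)
    then show ?thesis using bump_unique_left[OF ins_bump.hyps(1), of R2 z] u Cons by auto
  qed
qed

lemma bump_bump_less:
  assumes "bump R x y R'" "bump R' x' y' R''"
  shows "x < x' \<Longrightarrow> y < y'" "x' < x \<Longrightarrow> y' < y"
proof -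
  have *: "r = y' \<or> r < y' \<longrightarrow> r \<le> x' \<or> r = y'" if "r \<in> R'" for r
    using assms(2) that by (auto simp: bump_def split: if_splits)
  show "y' < y" if "x' < x"
    using *[of x] bump_simps(4,5)[OF assms(1)] bump_simps(3,5)[OF assms(2)] that
    by (metis linorder_neqE not_less order.strict_trans)
  assume "x < x'"
  moreover have "x' < y'" "y' \<in> R'" using bump_simps[OF assms(2)] by auto
  ultimately show "y < y'"
    using assms(1) by (auto simp: bump_def split: if_splits)
qed

text \<open>The row bumping lemma: by \<open>bump_bump_less\<close> the order of two successive
  insertions persists from row to row, so the second path ends weakly above or strictly below the
  first. Equal letters do not arise next to each other in reduced words.\<close>

lemma ins_ins_less:
  "ins P x k P' \<Longrightarrow> ins P' x' l P'' \<Longrightarrow> (x < x' \<longrightarrow> l \<le> k) \<and> (x' < x \<longrightarrow> k < l)"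
proof (induction arbitrary: x' l P'' rule: ins.induct)
  case (ins_Nil x)
  from ins_Nil(1) show ?case
    by (rule ins_ConsE) (use bump_not_above[of "{x}" x'] in auto)
next
  case (ins_app R x P)
  from ins_app(2) show ?case
  proof (rule ins_ConsE)
    fix z S m T assume *: "l = Suc m" "bump (insert x R) x' z S"
    then have "x' < z" "z = x \<or> z < x" using bump_simps(3,5)[OF *(2)] ins_app(1) by auto
    then show ?thesis using * by auto
  qed auto
next
  case (ins_bump R x y R' P k P')
  from ins_bump.prems show ?case
  proof (rule ins_ConsE)
    assume "l = 0" "\<forall>r\<in>R'. r < x'"
    then show ?thesis using bump_simps(4)[OF ins_bump.hyps(1)] by auto
  next
    fix z S m T assume *: "l = Suc m" "bump R' x' z S" "ins P' z m T"
    show ?thesis using bump_bump_less[OF ins_bump.hyps(1) *(2)] ins_bump.IH[OF *(3)] * by auto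
  qed
qed


section \<open>The Edelman--Greene bijection\<close>

definition diagram :: "nat list \<Rightarrow> (nat \<times> nat) set" where
  "diagram p = {(i, j). i < length p \<and> j < p ! i}"

definition down_closed :: "(nat \<times> nat) set \<Rightarrow> bool" where
  "down_closed D \<longleftrightarrow> (\<forall>i j k l. (k, l) \<in> D \<longrightarrow> i \<le> k \<longrightarrow> j \<le> l \<longrightarrow> (i, j) \<in> D)"

text \<open>A standard tableau is stored as the list of its boxes in the order of their entries, so
  that it can be built and taken apart along with a word.\<close>

definition standard :: "(nat \<times> nat) list \<Rightarrow> bool" where
  "standard s \<longleftrightarrow> distinct s \<and> (\<forall>n\<le>length s. down_closed (set (take n s)))"

text \<open>With the value 0 past the last row, \<open>(k, row_len P k)\<close> is the added box
  also when a row is created.\<close>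

definition row_len :: "int set list \<Rightarrow> nat \<Rightarrow> nat" where
  "row_len P k = (if k < length P then card (P ! k) else 0)"

inductive edelman_greene :: "int list \<Rightarrow> int set list \<Rightarrow> (nat \<times> nat) list \<Rightarrow> bool" where
  eg_Nil: "edelman_greene [] [] []"
| eg_snoc: "edelman_greene a P s \<Longrightarrow> ins P x k P' \<Longrightarrow>
    edelman_greene (a @ [x]) P' (s @ [(k, row_len P k)])"

lemma standard_Nil [simp]: "standard []"
  by (simp add: standard_def down_closed_def)

lemma standard_snoc:
  "standard (s @ [c]) \<longleftrightarrow> standard s \<and> c \<notin> set s \<and> down_closed (insert c (set s))"
  by (auto simp: standard_def le_Suc_eq all_conj_distrib)

lemma down_closedD: "down_closed D \<Longrightarrow> (k, l) \<in> D \<Longrightarrow> i \<le> k \<Longrightarrow> j \<le> l \<Longrightarrow> (i, j) \<in> D"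
  by (auto simp: down_closed_def)

lemma standard_down_closed: "standard s \<Longrightarrow> n \<le> length s \<Longrightarrow> down_closed (set (take n s))"
  by (simp add: standard_def)

lemma standard_down_closed_set: "standard s \<Longrightarrow> down_closed (set s)"
  using standard_down_closed[of s "length s"] by simp

lemma finite_diagram: "finite (diagram p)"
proof -
  have "diagram p = (SIGMA i:{..<length p}. {..<p ! i})" by (auto simp: diagram_def)
  then show ?thesis by simp
qed

lemma card_diagram: "card (diagram p) = sum_list p"
proof -
  have "diagram p = (SIGMA i:{..<length p}. {..<p ! i})" by (auto simp: diagram_def)
  then have "card (diagram p) = (\<Sum>i<length p. p ! i)" by simp
  then show ?thesis by (simp add: sum_list_sum_nth atLeast0LessThan)
qed

lemma is_partition_nth: "is_partition p \<Longrightarrow> i \<le> k \<Longrightarrow> k < length p \<Longrightarrow> p ! k \<le> p ! i"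
  unfolding is_partition_def using sorted_wrt_nth_less[of "(\<ge>)" p i k] by (cases "i = k") auto

lemma down_closed_diagram: "is_partition p \<Longrightarrow> down_closed (diagram p)"
  using is_partition_nth[of p] by (fastforce simp: down_closed_def diagram_def)

lemma colstrict_card:
  assumes "colstrict R S" "finite R" "finite S"
  shows "card S \<le> card R"
proof (cases "S = {}")
  case False
  have "S \<inter> {..Max S} = S" using assms by auto
  then have "card S \<le> card (R \<inter> {..<Max S})" using assms unfolding colstrict_def by metis
  also have "\<dots> \<le> card R" by (rule card_mono) (use assms in auto)
  finally show ?thesis .
qed simp

lemma tableau_partition: "tableau P \<Longrightarrow> is_partition (map card P)"
proof (induction P)
  case (Cons R P)
  then have IH: "is_partition (map card P)" and R: "finite R" "R \<noteq> {}" "colstrict R (top_row P)" "tableau P"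
    by auto
  have "card S \<le> card R" if "S \<in> set P" for S
  proof (cases P)
    case (Cons T Q)
    have "card S \<le> card T" using IH that Cons by (auto simp: is_partition_def)
    moreover have "card T \<le> card R"
      using colstrict_card[of R T] R Cons by auto
    ultimately show ?thesis by simp
  qed (use that in simp)
  then show ?case using IH R by (auto simp: is_partition_def)
qed (simp add: is_partition_def)

lemma ins_diagram:
  assumes "ins P x k P'" "tableau P"
  shows "diagram (map card P') = insert (k, row_len P k) (diagram (map card P))"
    "(k, row_len P k) \<notin> diagram (map card P)"
proof -
  note sh = ins_shape[OF assms]
  show "(k, row_len P k) \<notin> diagram (map card P)" by (auto simp: diagram_def row_len_def)
  show "diagram (map card P') = insert (k, row_len P k) (diagram (map card P))"
  proof (cases "k < length P")
    case True
    then have "map card P' = (map card P)[k := Suc (card (P ! k))]" using sh by simp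
    then show ?thesis using True
      by (auto simp: diagram_def row_len_def nth_list_update less_Suc_eq split: if_splits)
  next
    case False
    then have "map card P' = map card P @ [1]" "k = length P" using sh by simp_all
    then show ?thesis
      by (auto simp: diagram_def row_len_def nth_append less_Suc_eq split: if_splits)
  qed
qed

lemma eg_correct:
  "edelman_greene a P s \<Longrightarrow> tableau P \<and> word_prod (reading_word P) = word_prod a \<and>
    length (reading_word P) = length a \<and> length s = length a \<and>
    standard s \<and> set s = diagram (map card P)"
proof (induction rule: edelman_greene.induct)
  case eg_Nil
  show ?case by (simp add: diagram_def)
next
  case (eg_snoc a P s x k P')
  then have P: "tableau P" by simp
  note tab = ins_tableau[OF eg_snoc.hyps(2) P]
  note d = ins_diagram[OF eg_snoc.hyps(2) P]
  have "down_closed (insert (k, row_len P k) (set s))"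
    using eg_snoc d down_closed_diagram[OF tableau_partition[OF tab]] by simp
  then show ?case
    using eg_snoc tab d ins_word[OF eg_snoc.hyps(2) P] ins_length[OF eg_snoc.hyps(2) P]
    by (simp add: standard_snoc)
qed

lemma eg_exists: "reduced a \<Longrightarrow> \<exists>P s. edelman_greene a P s"
proof (induction a rule: rev_induct)
  case Nil
  show ?case using eg_Nil by blast
next
  case (snoc x a)
  then obtain P s where eg: "edelman_greene a P s" using reduced_appendD by blast
  note c = eg_correct[OF eg]
  have "reduced (reading_word P @ [x])"
    by (rule reduced_cong[OF snoc.prems]) (use c in simp_all)
  then obtain k P' where "ins P x k P'" using ins_exists c by blast
  then show ?case using eg_snoc[OF eg] by blast
qed

inductive_cases eg_NilE: "edelman_greene [] P s"
inductive_cases eg_any: "edelman_greene a P s"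

lemma eg_snocE:
  assumes "edelman_greene (a @ [x]) P' s'"
  obtains P s k where "edelman_greene a P s" "ins P x k P'" "s' = s @ [(k, row_len P k)]"
  using assms by (rule eg_any) auto

lemma eg_unique: "edelman_greene a P s \<Longrightarrow> edelman_greene a Q t \<Longrightarrow> P = Q \<and> s = t"
proof (induction arbitrary: Q t rule: edelman_greene.induct)
  case eg_Nil
  then show ?case by (auto elim: eg_NilE)
next
  case (eg_snoc a P s x k P')
  from eg_snoc.prems obtain S u l where "edelman_greene a S u" "ins S x l Q" "t = u @ [(l, row_len S l)]"
    by (rule eg_snocE)
  then show ?case using eg_snoc.IH ins_unique[OF eg_snoc.hyps(2)] by blast
qed

lemma eg_unique_left: "edelman_greene a P s \<Longrightarrow> edelman_greene b P s \<Longrightarrow> a = b"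
proof (induction arbitrary: b rule: edelman_greene.induct)
  case eg_Nil
  then show ?case using eg_correct[of b] by fastforce
next
  case (eg_snoc a P s x k P')
  have "b \<noteq> []" using eg_snoc.prems eg_correct[OF eg_snoc.prems] by auto
  then obtain b' z where b: "b = b' @ [z]" by (metis rev_exhaust)
  from eg_snoc.prems[unfolded b] obtain S u l where
    *: "edelman_greene b' S u" "ins S z l P'" "s @ [(k, row_len P k)] = u @ [(l, row_len S l)]"
    by (rule eg_snocE)
  have "P = S \<and> x = z"
    using ins_unique_left[OF eg_snoc.hyps(2), of S z] * eg_correct[OF *(1)] eg_correct[OF eg_snoc.hyps(1)]
    by auto
  then show ?case using * eg_snoc.IH b by auto
qed

text \<open>The last box of \<open>s\<close> is maximal in the diagram, hence a corner. Reverse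
  insertion from its row recovers the last letter, and the remaining word is still reduced as a
  prefix.\<close>

lemma eg_exists_left:
  "tableau P \<Longrightarrow> reduced (reading_word P) \<Longrightarrow> standard s \<Longrightarrow> set s = diagram (map card P) \<Longrightarrow>
    \<exists>a. edelman_greene a P s"
proof (induction s arbitrary: P rule: rev_induct)
  case Nil
  have "P = []"
  proof (cases P)
    case (Cons R Q)
    then have "(0, 0) \<in> diagram (map card P)" using Nil by (auto simp: diagram_def card_gt_0_iff)
    then show ?thesis using Nil by simp
  qed
  then show ?case using eg_Nil by blast
next
  case (snoc c s)
  obtain k j where c: "c = (k, j)" by (cases c)
  have st: "standard s" "c \<notin> set s" using snoc.prems by (simp_all add: standard_snoc)
  have kj: "k < length P" "j < card (P ! k)"
  proof -
    have "set (s @ [c]) = diagram (map card P)" by (rule snoc.prems(4))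
    then have "(k, j) \<in> diagram (map card P)" unfolding c by auto
    then show "k < length P" "j < card (P ! k)" by (auto simp: diagram_def)
  qed
  have max: "(k', j') \<notin> diagram (map card P)" if "k \<le> k'" "j \<le> j'" "(k', j') \<noteq> (k, j)" for k' j'
  proof
    assume "(k', j') \<in> diagram (map card P)"
    then have "(k', j') \<in> set (s @ [c])" using snoc.prems(4) by blast
    then have "(k', j') \<in> set s" using c that by auto
    then show False using down_closedD[OF standard_down_closed_set[OF st(1)], of k' j' k j] that st c by simp
  qed
  have j: "card (P ! k) = Suc j" using max[of k "Suc j"] kj by (auto simp: diagram_def)
  have "Suc k = length P \<or> card (P ! Suc k) < card (P ! k)"
    using max[of "Suc k" j] kj j by (auto simp: diagram_def)
  then obtain P0 x where P0: "tableau P0" "ins P0 x k P"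
    using ins_exists_left snoc.prems kj by blast
  note d = ins_diagram[OF P0(2,1)]
  have "row_len P0 k = j"
    using ins_shape[OF P0(2,1)] j kj by (auto simp: row_len_def list_eq_iff_nth_eq nth_append split: if_splits)
  then have "insert c (diagram (map card P0)) = diagram (map card P)" "c \<notin> diagram (map card P0)"
    using d c by simp_all
  moreover have "insert c (set s) = diagram (map card P)" using snoc.prems(4) by simp
  ultimately have "set s = diagram (map card P0)" using st(2) by (metis insert_ident)
  moreover have "reduced (reading_word P0)"
  proof -
    have "reduced (reading_word P0 @ [x])"
      by (rule reduced_cong[OF snoc.prems(2)])
        (use ins_word[OF P0(2,1)] ins_length[OF P0(2,1)] in simp_all)
    then show ?thesis by (rule reduced_appendD)
  qed
  ultimately obtain a where "edelman_greene a P0 s" using snoc.IH P0 st by blast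
  then show ?case using eg_snoc[OF _ P0(2)] c \<open>row_len P0 k = j\<close> by blast
qed

lemma eg_descents:
  "edelman_greene a P s \<Longrightarrow> Suc j < length a \<Longrightarrow>
    (a ! j < a ! Suc j \<longrightarrow> fst (s ! Suc j) \<le> fst (s ! j)) \<and>
    (a ! Suc j < a ! j \<longrightarrow> fst (s ! j) < fst (s ! Suc j))"
proof (induction arbitrary: j rule: edelman_greene.induct)
  case (eg_snoc a P s x k P')
  have len: "length s = length a" using eg_correct[OF eg_snoc.hyps(1)] by simp
  show ?case
  proof (cases "Suc j < length a")
    case True
    then show ?thesis using eg_snoc.IH[OF True] len by (simp add: nth_append)
  next
    case False
    then have j: "Suc j = length a" using eg_snoc.prems by simp
    then have "a \<noteq> []" by auto
    then obtain b z where a: "a = b @ [z]" by (metis rev_exhaust)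
    from eg_snoc.hyps(1)[unfolded a] obtain Q t l where
      *: "edelman_greene b Q t" "ins Q z l P" "s = t @ [(l, row_len Q l)]"
      by (rule eg_snocE)
    have "length t = length b" using eg_correct[OF *(1)] by simp
    then show ?thesis
      using ins_ins_less[OF *(2) eg_snoc.hyps(2)] j a * by (simp add: nth_append)
  qed
qed simp

text \<open>The later of two consecutive boxes is not weakly above and left of the earlier one. It
  is not strictly below and right of it either, since a box between the two would have to be added
  in the meantime.\<close>

lemma standard_consecutive:
  assumes st: "standard s" and j: "Suc n < length s"
  shows "fst (s ! Suc n) \<le> fst (s ! n) \<longleftrightarrow> snd (s ! n) < snd (s ! Suc n)"
proof -
  obtain i j k l where c: "s ! n = (i, j)" "s ! Suc n = (k, l)" by fastforce
  have T1: "set (take (Suc n) s) = insert (i, j) (set (take n s))"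
    using assms c by (simp add: take_Suc_conv_app_nth)
  have T2: "set (take (Suc (Suc n)) s) = insert (k, l) (set (take (Suc n) s))"
    using assms c by (simp add: take_Suc_conv_app_nth insert_commute)
  have dist: "distinct (take (Suc (Suc n)) s)" using st by (simp add: standard_def)
  have "take (Suc (Suc n)) s = take n s @ [(i, j), (k, l)]"
    using assms c by (simp add: take_Suc_conv_app_nth)
  with dist have notin: "(i, j) \<notin> set (take n s)" "(k, l) \<notin> set (take n s)" "(k, l) \<noteq> (i, j)" by auto
  have d: "down_closed (set (take n s))" "down_closed (set (take (Suc n) s))"
    "down_closed (set (take (Suc (Suc n)) s))"
    using standard_down_closed[OF st] j by simp_all
  have "\<not> (k \<le> i \<and> l \<le> j)"
    using down_closedD[OF d(2), of i j k l] T1 notin by auto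
  moreover have "\<not> (i < k \<and> j < l)"
  proof
    assume ij: "i < k \<and> j < l"
    then have "(k, j) \<in> set (take (Suc (Suc n)) s)"
      using down_closedD[OF d(3), of k l k j] T2 by auto
    then have "(k, j) \<in> set (take n s)" using T1 T2 ij by auto
    then show False using down_closedD[OF d(1), of k j i j] ij notin by auto
  qed
  ultimately show ?thesis using c by auto
qed

text \<open>Insertion and standardization are given as relations; the bijection is extracted from
  unique existence in both directions.\<close>

lemma card_eq_relation:
  assumes "\<And>a. a \<in> A \<Longrightarrow> \<exists>!b. b \<in> B \<and> r a b" "\<And>b. b \<in> B \<Longrightarrow> \<exists>!a. a \<in> A \<and> r a b"
  shows "card A = card B"
proof -
  define f where "f a = (THE b. b \<in> B \<and> r a b)" for a
  have f: "f a \<in> B \<and> r a (f a)" if "a \<in> A" for a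
    unfolding f_def by (rule theI') (rule assms(1)[OF that])
  have "bij_betw f A B"
    unfolding bij_betw_def
  proof (intro conjI inj_onI equalityI subsetI)
    fix a b assume "a \<in> A" "b \<in> A" "f a = f b"
    then show "a = b" using f assms(2)[of "f a"] by metis
  next
    fix b assume b: "b \<in> B"
    then obtain a where a: "a \<in> A" "r a b" using assms(2) by blast
    then show "b \<in> f ` A" using f[of a] assms(1)[of a] b by blast
  qed (use f in auto)
  then show ?thesis by (rule bij_betw_same_card)
qed

definition eg_tableaux :: "zperm \<Rightarrow> int set list set" where
  "eg_tableaux w = {P. tableau P \<and> reading_word P \<in> reduced_words w}"

text \<open>The source of finiteness for \<open>eg_tableaux\<close>: both the shapes and the reduced
  words are finite in number.\<close>

lemma inj_on_reading_word: "inj_on (\<lambda>P. (map card P, reading_word P)) {P. tableau P}"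
proof (rule inj_onI, clarify)
  fix P Q assume "tableau P" "tableau Q" "map card P = map card Q" "reading_word P = reading_word Q"
  then show "P = Q"
  proof (induction P arbitrary: Q)
    case (Cons R P)
    then obtain S T where Q: "Q = S # T" by (cases Q) auto
    have P: "tableau P" "finite R" and T: "tableau T" "finite S" using Cons.prems Q by auto
    have "sum_list (map card P) = sum_list (map card T)" using Cons.prems(3) Q by simp
    then have "length (reading_word P) = length (reading_word T)"
      using P T by (simp only: length_reading_word)
    moreover have "reading_word P @ sorted_list_of_set R = reading_word T @ sorted_list_of_set S"
      using Cons.prems(4) Q by simp
    ultimately have eq: "reading_word P = reading_word T" "sorted_list_of_set R = sorted_list_of_set S"
      by (metis append_eq_append_conv)+
    have "R = S" using eq(2) P T by (metis sorted_list_of_set.set_sorted_key_list_of_set)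
    moreover have "P = T" by (rule Cons.IH) (use P T eq Cons.prems(3) Q in auto)
    ultimately show ?case using Q by simp
  qed simp
qed

text \<open>\<open>C\<close> is any property of words that can be read off the recording list as
  \<open>D\<close>. It is instantiated twice, by words that descend in blocks and by words that
  ascend in blocks.\<close>

lemma eg_count:
  assumes fin: "finite (eg_tableaux w)"
    and cd: "\<And>a P s. reduced a \<Longrightarrow> word_prod a = w \<Longrightarrow> edelman_greene a P s \<Longrightarrow> C a \<longleftrightarrow> D s"
  shows "card {a \<in> reduced_words w. C a} =
    (\<Sum>P\<in>eg_tableaux w. card {s. standard s \<and> set s = diagram (map card P) \<and> D s})"
proof -
  have fins: "finite {s. standard s \<and> set s = diagram (map card P) \<and> D s}" for P
  proof (rule finite_subset)
    show "{s. standard s \<and> set s = diagram (map card P) \<and> D s} \<subseteq>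
      {s. set s \<subseteq> diagram (map card P) \<and> length s = card (diagram (map card P))}"
      by (auto simp: standard_def simp flip: distinct_card)
  qed (rule finite_lists_length_eq[OF finite_diagram])
  define X where "X = (SIGMA P:eg_tableaux w. {s. standard s \<and> set s = diagram (map card P) \<and> D s})"
  have X_iff: "(P, s) \<in> X \<longleftrightarrow> tableau P \<and> reduced (reading_word P) \<and> word_prod (reading_word P) = w \<and>
      standard s \<and> set s = diagram (map card P) \<and> D s" for P s
    by (simp add: X_def eg_tableaux_def reduced_words_iff)
  have "card {a \<in> reduced_words w. C a} = card X"
  proof (rule card_eq_relation[where r = "\<lambda>a (P, s). edelman_greene a P s"])
    fix a assume "a \<in> {a \<in> reduced_words w. C a}"
    then have a: "reduced a" "word_prod a = w" "C a" by (auto simp: reduced_words_iff)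
    then obtain P s where eg: "edelman_greene a P s" using eg_exists by blast
    note c = eg_correct[OF eg]
    have "reduced (reading_word P)" by (rule reduced_cong[OF a(1)]) (use c in simp_all)
    then have "(P, s) \<in> X"
      unfolding X_iff using c a cd[OF a(1,2) eg] by simp
    moreover have "b = (P, s)" if "case b of (P, s) \<Rightarrow> edelman_greene a P s" for b
      using that eg_unique[OF eg] by (cases b) simp
    ultimately show "\<exists>!b. b \<in> X \<and> (case b of (P, s) \<Rightarrow> edelman_greene a P s)"
      using eg by (intro ex1I[of _ "(P, s)"]) auto
  next
    fix b assume b: "b \<in> X"
    obtain P s where bb: "b = (P, s)" by (cases b)
    note X = b[unfolded bb X_iff]
    then obtain a where eg: "edelman_greene a P s" using eg_exists_left by blast
    note c = eg_correct[OF eg]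
    have a: "reduced a" by (rule reduced_cong[of "reading_word P"]) (use c X in simp_all)
    moreover have "word_prod a = w" using c X by simp
    ultimately have "a \<in> {a \<in> reduced_words w. C a}"
      using cd[OF a _ eg] X by (simp add: reduced_words_iff)
    then show "\<exists>!a. a \<in> {a \<in> reduced_words w. C a} \<and> (case b of (P, s) \<Rightarrow> edelman_greene a P s)"
      unfolding bb case_prod_conv using eg by (blast intro: eg_unique_left)
  qed
  also have "\<dots> = (\<Sum>P\<in>eg_tableaux w. card {s. standard s \<and> set s = diagram (map card P) \<and> D s})"
    unfolding X_def using fin fins by (intro card_SigmaI) auto
  finally show ?thesis .
qed


section \<open>Finiteness of the set of reduced words\<close>

text \<open>Membership in the parabolic subgroup that omits the generator with index
  \<open>n\<close>. It confines the letters of reduced words and later the support of atoms.\<close>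

definition stabilises :: "int \<Rightarrow> zperm \<Rightarrow> bool" where
  "stabilises n w \<longleftrightarrow> (\<forall>x\<le>n. w \<langle>$\<rangle> x \<le> n)"

lemma apply_outside:
  fixes w :: zperm
  shows "affected w \<subseteq> {a..b} \<Longrightarrow> x < a \<or> b < x \<Longrightarrow> w \<langle>$\<rangle> x = x"
  by (meson atLeastAtMost_iff in_affected not_le subsetD)

lemma apply_inside:
  fixes w :: zperm
  assumes "affected w \<subseteq> {a..b}" "x \<in> {a..b}"
  shows "w \<langle>$\<rangle> x \<in> {a..b}"
  using assms by (metis apply_affected in_affected subsetD)

text \<open>Pigeonhole: otherwise a finite interval ending in \<open>i + 1\<close> would be mapped
  injectively into the one ending in \<open>i\<close>.\<close>

lemma no_squeeze:
  fixes w :: zperm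
  shows "\<exists>x\<le>i + 1. i < w \<langle>$\<rangle> x"
proof (rule ccontr)
  assume *: "\<not> ?thesis"
  obtain N where N: "affected w \<subseteq> {-N..N}" by (rule affected_bound)
  define M where "M = min (-N) i"
  have N': "affected w \<subseteq> {M..max N i}" using N by (rule order.trans) (auto simp: M_def)
  have "w \<langle>$\<rangle> x \<in> {M..i}" if "x \<in> {M..i + 1}" for x
  proof -
    have "M \<le> w \<langle>$\<rangle> x"
      using that apply_inside[OF N', of x] apply_outside[OF N', of x] by fastforce
    then show ?thesis using * that by auto
  qed
  then have "card {M..i + 1} \<le> card {M..i}"
    by (intro card_inj_on_le[of "apply w"]) (auto simp: inj_on_def apply_inj)
  moreover have "M \<le> i" by (simp add: M_def)
  ultimately show False by simp
qed

text \<open>A position \<open>x \<le> n\<close> with value above \<open>n\<close> is moved out of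
  the half-line only if \<open>x = n = i\<close>, and then the ascent puts an even larger value at
  \<open>n\<close>.\<close>

lemma not_stabilises_rmul:
  assumes "\<not> stabilises n w"
  shows "\<not> stabilises n (rmul w i)"
proof (cases "w \<langle>$\<rangle> i < w \<langle>$\<rangle> (i + 1)")
  case True
  obtain x where x: "x \<le> n" "n < w \<langle>$\<rangle> x" using assms by (auto simp: stabilises_def not_le)
  have eq: "(w * simple_refl i) \<langle>$\<rangle> (simple_refl i \<langle>$\<rangle> x) = w \<langle>$\<rangle> x"
    by (simp add: apply_mult refl_involutive)
  show ?thesis
  proof (cases "simple_refl i \<langle>$\<rangle> x \<le> n")
    case True
    then show ?thesis using x eq assms by (auto simp: stabilises_def rmul_def not_le intro!: exI[of _ "simple_refl i \<langle>$\<rangle> x"])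
  next
    case False
    then have "x = i" "i = n" using x by (auto simp: apply_simple_refl split: if_splits)
    then have "(w * simple_refl i) \<langle>$\<rangle> n > n" using x True by (simp add: apply_mult)
    then show ?thesis using True by (auto simp: stabilises_def rmul_def not_le)
  qed
qed (use assms in \<open>simp add: rmul_def\<close>)

text \<open>As the last letter, \<open>i\<close> creates a descent at \<open>i\<close>. If the
  half-line up to \<open>i\<close> were preserved, the value at \<open>i + 1\<close> would lie in it
  as well, against \<open>no_squeeze\<close>. Further letters cannot repair this.\<close>

lemma reduced_letter:
  "reduced a \<Longrightarrow> i \<in> set a \<Longrightarrow> \<not> stabilises i (word_prod a)"
proof (induction a rule: rev_induct)
  case (snoc j a)
  then have a: "reduced a" "word_prod a \<langle>$\<rangle> j < word_prod a \<langle>$\<rangle> (j + 1)"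
    by (simp_all add: reduced_snoc_iff)
  then have w: "word_prod (a @ [j]) = rmul (word_prod a) j" by (simp add: rmul_def)
  show ?case
  proof (cases "i \<in> set a")
    case True
    then show ?thesis using w not_stabilises_rmul[of i "word_prod a" j] snoc.IH a by simp
  next
    case False
    then have j: "j = i" using snoc.prems by simp
    show ?thesis
    proof
      assume st: "stabilises i (word_prod (a @ [j]))"
      have "word_prod (a @ [j]) \<langle>$\<rangle> (i + 1) < word_prod (a @ [j]) \<langle>$\<rangle> i"
        using a j by (simp add: apply_mult apply_simple_refl)
      with st have "word_prod (a @ [j]) \<langle>$\<rangle> x \<le> i" if "x \<le> i + 1" for x
        using that by (cases "x = i + 1") (force simp: stabilises_def)+
      with no_squeeze[of i "word_prod (a @ [j])"] show False by (meson not_le)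
    qed
  qed
qed simp

lemma finite_not_stabilises: "finite {i. \<not> stabilises i w}"
proof -
  obtain N where N: "affected w \<subseteq> {-N..N}" by (rule affected_bound)
  have "stabilises i w" if "i < -N \<or> N < i" for i
    unfolding stabilises_def
  proof (intro allI impI)
    fix x assume "x \<le> i"
    then show "w \<langle>$\<rangle> x \<le> i"
      using that apply_outside[OF N, of x] apply_inside[OF N, of x] by fastforce
  qed
  then have "{i. \<not> stabilises i w} \<subseteq> {-N..N}" by force
  then show ?thesis by (rule finite_subset) simp
qed

lemma finite_reduced_words: "finite (reduced_words w)"
proof (rule finite_subset)
  show "reduced_words w \<subseteq> {a. set a \<subseteq> {i. \<not> stabilises i w} \<and> length a = perm_length w}"
    using reduced_letter by (auto simp: reduced_words_iff reduced_def)
  show "finite {a. set a \<subseteq> {i. \<not> stabilises i w} \<and> length a = perm_length w}"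
    by (rule finite_lists_length_eq) (rule finite_not_stabilises)
qed


section \<open>Partitions and standardization\<close>

lemma initial_segment:
  fixes S :: "nat set"
  assumes "finite S" "\<And>i k. k \<in> S \<Longrightarrow> i \<le> k \<Longrightarrow> i \<in> S"
  shows "S = {..<card S}"
proof (cases "S = {}")
  case False
  then have "Max S \<in> S" "\<forall>k\<in>S. k \<le> Max S" using assms by auto
  then have "S = {..Max S}" using assms(2) by auto
  then have "S = {..<Suc (Max S)}" by (simp add: lessThan_Suc_atMost)
  then show ?thesis by (metis card_lessThan)
qed simp

lemma diagram_conj_partition:
  assumes p: "is_partition p"
  shows "(j, i) \<in> diagram (conj_partition p) \<longleftrightarrow> (i, j) \<in> diagram p"
proof (cases p)
  case Nil
  then show ?thesis by (simp add: diagram_def conj_partition_def)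
next
  case (Cons k q)
  define S where "S = {i. i < length p \<and> j < p ! i}"
  have S: "S = {..<card S}"
    by (rule initial_segment) (use is_partition_nth[OF p] in \<open>fastforce simp: S_def\<close>)+
  have hd: "p ! i \<le> k" if "i < length p" for i using is_partition_nth[OF p, of 0 i] that Cons by simp
  have "(j, i) \<in> diagram (conj_partition p) \<longleftrightarrow> j < k \<and> i < card S"
    using Cons by (auto simp: diagram_def conj_partition_def S_def)
  also have "\<dots> \<longleftrightarrow> j < k \<and> i \<in> S" using S by (metis lessThan_iff)
  also have "\<dots> \<longleftrightarrow> (i, j) \<in> diagram p" using hd by (fastforce simp: S_def diagram_def)
  finally show ?thesis .
qed

lemma is_partition_conj:
  assumes p: "is_partition p"
  shows "is_partition (conj_partition p)"
proof (cases p)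
  case (Cons k q)
  define f where "f j = card {i. i < length p \<and> j < p ! i}" for j
  have c: "conj_partition p = map f [0..<k]" using Cons by (simp add: conj_partition_def f_def[abs_def])
  have "f j \<le> f i" if "i \<le> j" for i j
    unfolding f_def by (rule card_mono) (use that in auto)
  then have "sorted_wrt (\<ge>) (map f [0..<k])" by (simp add: sorted_wrt_iff_nth_less)
  moreover have "f j \<noteq> 0" if "j < k" for j
  proof -
    have "0 \<in> {i. i < length p \<and> j < p ! i}" using that Cons by simp
    then show ?thesis unfolding f_def by (auto simp: card_eq_0_iff)
  qed
  then have "0 \<notin> set (map f [0..<k])" by fastforce
  ultimately show ?thesis unfolding c is_partition_def by blast
qed (simp add: conj_partition_def is_partition_def)

lemma diagram_inj:
  assumes "is_partition p" "is_partition q" "diagram p = diagram q"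
  shows "p = q"
proof (rule nth_equalityI)
  have 0: "i < length r \<longleftrightarrow> (i, 0) \<in> diagram r" if "is_partition r" for i r
    using that by (auto simp: is_partition_def diagram_def) (metis nth_mem gr0I)
  have iff: "i < length p \<longleftrightarrow> i < length q" for i
    using 0[OF assms(1)] 0[OF assms(2)] assms(3) by simp
  then show len: "length p = length q" by (metis less_irrefl linorder_neqE_nat)
  fix i assume "i < length p"
  then have "j < p ! i \<longleftrightarrow> j < q ! i" for j
    using assms(3) len unfolding diagram_def set_eq_iff by auto
  then show "p ! i = q ! i" by (metis less_irrefl linorder_neqE_nat)
qed

lemma conj_conj: "is_partition p \<Longrightarrow> conj_partition (conj_partition p) = p"
  by (rule diagram_inj) (auto simp: is_partition_conj diagram_conj_partition)

lemma diagram_Cons: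
  "diagram (n # p) = {0} \<times> {..<n} \<union> (\<lambda>(i, j). (Suc i, j)) ` diagram p"
proof (intro set_eqI iffI)
  fix c assume "c \<in> diagram (n # p)"
  then show "c \<in> {0} \<times> {..<n} \<union> (\<lambda>(i, j). (Suc i, j)) ` diagram p"
    by (cases c; cases "fst c") (auto simp: diagram_def image_iff)
qed (auto simp: diagram_def)

lemma mset_concat_diagram:
  "mset (concat t) = image_mset (\<lambda>(i, j). t ! i ! j) (mset_set (diagram (map length t)))"
proof (induction t)
  case Nil
  show ?case by (simp add: diagram_def)
next
  case (Cons r t)
  have "mset_set (diagram (map length (r # t))) =
      mset_set ({0} \<times> {..<length r}) + mset_set ((\<lambda>(i, j). (Suc i, j)) ` diagram (map length t))"
    unfolding list.map diagram_Cons by (rule mset_set_Union) (auto simp: finite_diagram)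
  moreover have "mset_set ({0 :: nat} \<times> {..<length r}) = image_mset (Pair 0) (mset_set {..<length r})"
    by (subst image_mset_mset_set) (auto simp: inj_on_def image_def intro!: arg_cong[of _ _ mset_set])
  moreover have "mset_set ((\<lambda>(i, j). (Suc i, j)) ` diagram (map length t)) =
      image_mset (\<lambda>(i, j). (Suc i, j)) (mset_set (diagram (map length t)))"
    by (subst image_mset_mset_set) (auto simp: inj_on_def)
  moreover have "mset r = image_mset (\<lambda>j. r ! j) (mset_set {..<length r})"
    by (metis atLeast0LessThan map_nth mset_map mset_upt)
  ultimately show ?case
    using Cons by (simp add: image_mset.compositionality comp_def case_prod_beta)
qed

text \<open>Here \<open>b ! n\<close> is meant as the entry of the box \<open>s ! n\<close>: equal
  entries form a horizontal strip, read from left to right. Applied to swapped boxes, it describes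
  vertical strips.\<close>

definition cols_increase :: "nat list \<Rightarrow> (nat \<times> nat) list \<Rightarrow> bool" where
  "cols_increase b s \<longleftrightarrow>
    (\<forall>n. Suc n < length b \<longrightarrow> b ! n = b ! Suc n \<longrightarrow> snd (s ! n) < snd (s ! Suc n))"

lemma standard_index_less:
  assumes s: "standard s" "m < length s" "n < length s" and le: "fst (s ! m) \<le> fst (s ! n)"
    "snd (s ! m) \<le> snd (s ! n)" "s ! m \<noteq> s ! n"
  shows "m < n"
proof -
  have "s ! n \<in> set (take (Suc n) s)" using s by (simp add: take_Suc_conv_app_nth)
  then have "s ! m \<in> set (take (Suc n) s)"
    using down_closedD[OF standard_down_closed[OF s(1), of "Suc n"], of "fst (s ! n)" "snd (s ! n)"
        "fst (s ! m)" "snd (s ! m)"] s le by simp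
  then obtain l where "l < Suc n" "s ! l = s ! m" "l < length s" using s by (auto simp: in_set_conv_nth)
  then have "m \<le> n" using s by (auto simp: standard_def nth_eq_iff_index_eq)
  then show ?thesis using le(3) by (cases "m = n") auto
qed

lemma cols_increase_block:
  assumes "cols_increase b s" "sorted b" "n < length b" "m < n" "b ! m = b ! n"
  shows "snd (s ! m) < snd (s ! n)"
  using assms(3-)
proof (induction n)
  case (Suc n)
  have "b ! m \<le> b ! n" "b ! n \<le> b ! Suc n"
    using Suc.prems(1,2) assms(2) sorted_nth_mono[of b m n] sorted_nth_mono[of b n "Suc n"] by simp_all
  then have eq: "b ! n = b ! Suc n" "b ! m = b ! n" using Suc.prems by auto
  then have "snd (s ! n) < snd (s ! Suc n)" using assms(1) Suc.prems by (simp add: cols_increase_def)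
  then show ?case using Suc.IH Suc.prems eq by (cases "m = n") auto
qed simp

lemma semistandard_column:
  assumes t: "t \<in> semistandard_tableaux p" and p: "is_partition p"
    and "i < k" "k < length t" "j < length (t ! k)"
  shows "t ! i ! j < t ! k ! j"
  using assms(3-)
proof (induction k)
  case (Suc k)
  have "map length t = p" using t by (simp add: semistandard_tableaux_def)
  then have "length (t ! Suc k) \<le> length (t ! k)"
    using is_partition_nth[OF p, of k "Suc k"] Suc.prems by auto
  moreover have "t ! k ! j < t ! Suc k ! j" using t Suc.prems by (simp add: semistandard_tableaux_def)
  ultimately show ?case using Suc by (cases "i = k") (auto intro: order.strict_trans)
qed simp

lemma mset_map_standard:
  assumes "standard s" "set s = D"
  shows "mset (map f s) = image_mset f (mset_set D)"
  using assms mset_set_set[of s] by (simp add: standard_def)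

text \<open>Standardization: a semistandard tableau is encoded by its boxes, sorted by entry and, among
  equal entries, by column.\<close>

lemma card_semistandard:
  assumes p: "is_partition p" and b: "sorted b"
  shows "card {t \<in> semistandard_tableaux p. mset (concat t) = mset b} =
    card {s. standard s \<and> set s = diagram p \<and> length s = length b \<and> cols_increase b s}"
proof (rule card_eq_relation[where r = "\<lambda>t s. \<forall>n<length s. t ! fst (s ! n) ! snd (s ! n) = b ! n"])
  fix t assume "t \<in> {t \<in> semistandard_tableaux p. mset (concat t) = mset b}"
  then have t: "t \<in> semistandard_tableaux p" and mb: "mset (concat t) = mset b" by auto
  have len: "map length t = p" "length t = length p" "\<And>i. i < length p \<Longrightarrow> length (t ! i) = p ! i"
    using t by (auto simp: semistandard_tableaux_def)
  define e where "e c = t ! fst c ! snd c" for c :: "nat \<times> nat"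
  have mset_e: "image_mset e (mset_set (diagram p)) = mset b"
    using mb mset_concat_diagram[of t] len by (simp add: e_def[abs_def] case_prod_unfold)
  have row: "e (i, j) \<le> e (i, l)" if "j \<le> l" "(i, l) \<in> diagram p" for i j l
  proof -
    have "sorted (t ! i)" using t that len by (auto simp: semistandard_tableaux_def diagram_def)
    then show ?thesis using that len by (auto simp: e_def diagram_def sorted_iff_nth_mono)
  qed
  have col: "e (i, j) < e (k, j)" if "i < k" "(k, j) \<in> diagram p" for i k j
    using semistandard_column[OF t p, of i k j] that len by (auto simp: e_def diagram_def)
  have dd: "down_closed (diagram p)" by (rule down_closed_diagram[OF p])
  \<comment> \<open>\<open>K\<close> exceeds every column index, so the key \<open>f\<close> below
    compares entries first and columns second. It is injective because entries in one column are
    distinct.\<close>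
  define K where "K = Suc (Max (insert 0 (snd ` diagram p)))"
  have K: "snd c < K" if "c \<in> diagram p" for c
    unfolding K_def using that finite_diagram by (simp add: le_imp_less_Suc Max_ge)
  define f where "f c = e c * K + snd c" for c
  have f_less: "f c < f d" if "c \<in> diagram p" "e c < e d \<or> e c = e d \<and> snd c < snd d" for c d
  proof (cases "e c < e d")
    case True
    have "f c < Suc (e c) * K" using K[OF that(1)] by (simp add: f_def)
    also have "\<dots> \<le> e d * K" using True by (intro mult_le_mono1) simp
    finally show ?thesis by (simp add: f_def)
  qed (use that in \<open>simp add: f_def\<close>)
  have f_inj: "c = d" if cd: "c \<in> diagram p" "d \<in> diagram p" "f c = f d" for c d
  proof -
    have e: "e c = e d" "snd c = snd d"
      using f_less[of c d] f_less[of d c] cd by (metis less_irrefl linorder_neqE_nat)+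
    obtain i j k where ij: "c = (i, j)" "d = (k, j)" using e(2) by (metis prod.collapse)
    show ?thesis
      using col[of i k j] col[of k i j] cd e ij by (metis less_irrefl linorder_neqE_nat)
  qed
  have f_mono: "f (i, j) < f (k, l)" if "i \<le> k" "j \<le> l" "(i, j) \<noteq> (k, l)" "(k, l) \<in> diagram p" for i j k l
  proof -
    have mem: "(i, j) \<in> diagram p" "(k, j) \<in> diagram p" using down_closedD[OF dd that(4)] that by auto
    have "e (k, j) \<le> e (k, l)" using row that by simp
    moreover have "e (i, j) < e (k, j)" if "i < k" using col that mem by simp
    ultimately have "e (i, j) < e (k, l) \<or> e (i, j) = e (k, l) \<and> j < l"
      using that by (cases "i < k") auto
    then show ?thesis using f_less[OF mem(1)] by simp
  qed
  obtain xs where xs: "distinct xs" "set xs = diagram p"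
    using finite_distinct_list[OF finite_diagram] by blast
  define s where "s = sort_key f xs"
  have s: "distinct s" "set s = diagram p" "sorted (map f s)" using xs by (simp_all add: s_def)
  have "distinct (map f s)" using s f_inj by (auto simp: distinct_map inj_on_def)
  then have strict: "sorted_wrt (<) (map f s)" using s by (simp add: strict_sorted_iff)
  have less_iff: "m < n" if "f (s ! m) < f (s ! n)" "m < length s" "n < length s" for m n
    using that s(3) by (metis length_map not_le nth_map sorted_iff_nth_mono)
  have less_iff2: "f (s ! m) < f (s ! n)" if "m < n" "n < length s" for m n
    using sorted_wrt_nth_less[OF strict, of m n] that by simp
  have std: "standard s"
    unfolding standard_def
  proof (intro conjI allI impI)
    fix n assume n: "n \<le> length s"
    show "down_closed (set (take n s))"
      unfolding down_closed_def
    proof (intro allI impI)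
      fix i j k l assume *: "(k, l) \<in> set (take n s)" "i \<le> k" "j \<le> l"
      then obtain m where m: "m < n" "s ! m = (k, l)" using n by (auto simp: in_set_conv_nth)
      then have kl: "(k, l) \<in> diagram p" using s n by (metis nth_mem order.strict_trans2)
      then have "(i, j) \<in> set s" using s down_closedD[OF dd] * by blast
      then obtain q where q: "q < length s" "s ! q = (i, j)" by (auto simp: in_set_conv_nth)
      have "q \<le> m"
      proof (cases "(i, j) = (k, l)")
        case True
        then show ?thesis using q m n nth_eq_iff_index_eq[OF s(1), of q m] by simp
      next
        case False
        then have "f (s ! q) < f (s ! m)" using f_mono * kl q m by simp
        then show ?thesis using less_iff q m n by (simp add: less_imp_le)
      qed
      then show "(i, j) \<in> set (take n s)" using q m n by (auto simp: in_set_conv_nth intro!: exI[of _ q])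
    qed
  qed (rule s)
  have "sorted (map e s)"
    unfolding sorted_iff_nth_Suc
  proof (intro allI impI)
    fix n assume n: "Suc n < length (map e s)"
    then have "f (s ! n) < f (s ! Suc n)" using less_iff2 by simp
    moreover have "s ! Suc n \<in> diagram p" using n s by (metis length_map nth_mem)
    ultimately have "e (s ! n) \<le> e (s ! Suc n)" using f_less[of "s ! Suc n" "s ! n"] by (meson not_le order.asym)
    then show "map e s ! n \<le> map e s ! Suc n" using n by simp
  qed
  moreover have "mset (map e s) = mset b" using mset_map_standard[OF std s(2), of e] mset_e by simp
  ultimately have es: "map e s = b" using b by (metis properties_for_sort sorted_sort_id)
  then have ls: "length s = length b" by auto
  have eb: "e (s ! n) = b ! n" if "n < length s" for n using es that by (metis nth_map)
  have ci: "cols_increase b s"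
    unfolding cols_increase_def
  proof (intro allI impI)
    fix n assume n: "Suc n < length b" "b ! n = b ! Suc n"
    then have "f (s ! n) < f (s ! Suc n)" using less_iff2 ls by simp
    then show "snd (s ! n) < snd (s ! Suc n)" using n eb ls by (simp add: f_def)
  qed
  \<comment> \<open>Every admissible list is strictly increasing for the key \<open>f\<close>, and a
    set has only one such enumeration.\<close>
  have uniq: "u = s" if u: "standard u" "set u = diagram p" "length u = length b" "cols_increase b u"
    "\<forall>n<length u. t ! fst (u ! n) ! snd (u ! n) = b ! n" for u
  proof -
    have "sorted_wrt (<) (map f u)"
      unfolding sorted_wrt_iff_nth_Suc_transp[OF transp_on_less]
    proof (intro allI impI)
      fix n assume n: "Suc n < length (map f u)"
      have "e (u ! n) = b ! n" "e (u ! Suc n) = b ! Suc n" using u n by (simp_all add: e_def)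
      moreover have "b ! n \<le> b ! Suc n" using b n u by (simp add: sorted_iff_nth_Suc)
      ultimately have "e (u ! n) < e (u ! Suc n) \<or> e (u ! n) = e (u ! Suc n) \<and> snd (u ! n) < snd (u ! Suc n)"
        using u n by (auto simp: cols_increase_def)
      moreover have "u ! n \<in> diagram p" using n u by (metis length_map nth_mem Suc_lessD)
      ultimately show "map f u ! n < map f u ! Suc n" using f_less n by simp
    qed
    then have "map f u = map f s" using strict s u by (metis image_set strict_sorted_equal)
    moreover have "inj_on f (set u \<union> set s)" using f_inj s u by (auto simp: inj_on_def)
    ultimately show ?thesis by (metis inj_on_map_eq_map)
  qed
  show "\<exists>!s. s \<in> {s. standard s \<and> set s = diagram p \<and> length s = length b \<and> cols_increase b s} \<and>
      (\<forall>n<length s. t ! fst (s ! n) ! snd (s ! n) = b ! n)"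
  proof (rule ex1I[of _ s])
    show "s \<in> {s. standard s \<and> set s = diagram p \<and> length s = length b \<and> cols_increase b s} \<and>
      (\<forall>n<length s. t ! fst (s ! n) ! snd (s ! n) = b ! n)"
      using std s(2) ls ci eb[unfolded e_def] by blast
  qed (use uniq in blast)
next
  fix s assume "s \<in> {s. standard s \<and> set s = diagram p \<and> length s = length b \<and> cols_increase b s}"
  then have s: "standard s" "set s = diagram p" "length s = length b" "cols_increase b s" by auto
  have dist: "distinct s" using s by (simp add: standard_def)
  define lab where "lab c = the (map_of (zip s b) c)" for c
  have lab: "lab (s ! n) = b ! n" if "n < length s" for n
    using that s dist by (simp add: lab_def map_of_zip_nth)
  define t where "t = map (\<lambda>i. map (\<lambda>j. lab (i, j)) [0..<p ! i]) [0..<length p]"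
  have len: "map length t = p" by (rule nth_equalityI) (simp_all add: t_def)
  have t_nth: "t ! i ! j = lab (i, j)" if "(i, j) \<in> diagram p" for i j
    using that by (simp add: t_def diagram_def)
  have idx: "\<exists>n<length s. s ! n = c" if "c \<in> diagram p" for c
    using that s by (metis in_set_conv_nth)
  have dd: "down_closed (diagram p)" by (rule down_closed_diagram[OF p])
  have row: "lab (i, j) \<le> lab (i, l)" if il: "j \<le> l" "(i, l) \<in> diagram p" for i j l
  proof -
    obtain n where n: "n < length s" "s ! n = (i, l)" using idx il by blast
    obtain m where m: "m < length s" "s ! m = (i, j)" using idx down_closedD[OF dd il(2)] il by blast
    have "m \<le> n" using standard_index_less[OF s(1) m(1) n(1)] m n il
        nth_eq_iff_index_eq[OF dist m(1) n(1)] by (cases "j = l") auto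
    then have "b ! m \<le> b ! n" using b n s by (simp add: sorted_iff_nth_mono)
    then show ?thesis using lab m n by metis
  qed
  have col: "lab (i, j) < lab (Suc i, j)" if il: "(Suc i, j) \<in> diagram p" for i j
  proof -
    obtain n where n: "n < length s" "s ! n = (Suc i, j)" using idx il by blast
    obtain m where m: "m < length s" "s ! m = (i, j)"
      using idx down_closedD[OF dd il, of i j] by auto
    have mn: "m < n" using standard_index_less[OF s(1) m(1) n(1)] m n by simp
    then have "b ! m \<le> b ! n" using b n s by (simp add: sorted_iff_nth_mono)
    moreover have "b ! m \<noteq> b ! n"
      using cols_increase_block[OF s(4) b, of n m] mn n m s by auto
    ultimately show ?thesis using lab m n by (metis order.not_eq_order_implies_strict)
  qed
  have "t \<in> semistandard_tableaux p"
    unfolding semistandard_tableaux_def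
  proof (intro CollectI conjI ballI allI impI)
    fix r assume "r \<in> set t"
    then obtain i where i: "i < length p" "r = map (\<lambda>j. lab (i, j)) [0..<p ! i]"
      by (auto simp: t_def)
    show "sorted r"
      unfolding i sorted_iff_nth_mono using row i by (auto simp: diagram_def)
  next
    fix i j assume ij: "Suc i < length t" "j < length (t ! Suc i)"
    then have "(Suc i, j) \<in> diagram p" by (simp add: t_def diagram_def)
    moreover from this have "(i, j) \<in> diagram p" using down_closedD[OF dd, of "Suc i" j i j] by simp
    ultimately show "t ! i ! j < t ! Suc i ! j" using col t_nth by simp
  qed (rule len)
  moreover have "mset (concat t) = mset b"
  proof -
    have "mset (concat t) = image_mset (\<lambda>(i, j). t ! i ! j) (mset_set (diagram p))"
      using mset_concat_diagram[of t] len by simp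
    also have "\<dots> = image_mset lab (mset_set (diagram p))"
      by (rule image_mset_cong) (use t_nth finite_diagram in auto)
    also have "\<dots> = mset (map lab s)" by (simp only: mset_map_standard[OF s(1,2)])
    also have "map lab s = b" by (rule nth_equalityI) (use lab s in auto)
    finally show ?thesis .
  qed
  moreover have "t ! fst (s ! n) ! snd (s ! n) = b ! n" if "n < length s" for n
  proof -
    have "s ! n \<in> diagram p" using that s by (metis nth_mem)
    then show ?thesis using t_nth[of "fst (s ! n)" "snd (s ! n)"] lab[OF that] by simp
  qed
  moreover have "u = t" if u: "u \<in> semistandard_tableaux p"
    "\<forall>n<length s. u ! fst (s ! n) ! snd (s ! n) = b ! n" for u
  proof -
    have lu: "map length u = p" using u by (simp add: semistandard_tableaux_def)
    have eq: "u ! i ! j = t ! i ! j" if ij: "(i, j) \<in> diagram p" for i j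
    proof -
      obtain n where "n < length s" "s ! n = (i, j)" using idx ij by blast
      then show ?thesis using u(2) t_nth[OF ij] lab by (metis fst_conv snd_conv)
    qed
    have ll: "length u = length t" using lu len by (metis length_map)
    have lr: "length (u ! i) = length (t ! i)" "length (t ! i) = p ! i" if "i < length t" for i
      using lu len ll that by (metis nth_map)+
    show ?thesis
    proof (rule nth_equalityI[OF ll])
      fix i assume i: "i < length u"
      show "u ! i = t ! i"
      proof (rule nth_equalityI)
        have it: "i < length t" "i < length p" using i ll len by auto
        show "length (u ! i) = length (t ! i)" by (rule lr(1)[OF it(1)])
        fix j assume "j < length (u ! i)"
        then have "j < p ! i" using lr[OF it(1)] by simp
        then have "(i, j) \<in> diagram p" using it by (simp add: diagram_def)
        then show "u ! i ! j = t ! i ! j" by (rule eq)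
      qed
    qed
  qed
  ultimately show "\<exists>!t. t \<in> {t \<in> semistandard_tableaux p. mset (concat t) = mset b} \<and>
      (\<forall>n<length s. t ! fst (s ! n) ! snd (s ! n) = b ! n)"
    by blast
qed


section \<open>Schur expansions of Stanley symmetric functions\<close>

lemma length_le_sum_list: "0 \<notin> set l \<Longrightarrow> length l \<le> sum_list (l :: nat list)"
  by (induction l) (auto simp: Suc_le_eq intro: add_le_imp_le_left)

lemma finite_eg_tableaux: "finite (eg_tableaux w)"
proof (rule inj_on_finite)
  show "inj_on (\<lambda>P. (map card P, reading_word P)) (eg_tableaux w)"
    by (rule inj_on_subset[OF inj_on_reading_word]) (auto simp: eg_tableaux_def)
  show "(\<lambda>P. (map card P, reading_word P)) ` eg_tableaux w \<subseteq>
    {l. set l \<subseteq> {..perm_length w} \<and> length l \<le> perm_length w} \<times> reduced_words w"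
  proof (rule image_subsetI)
    fix P assume P: "P \<in> eg_tableaux w"
    then have tab: "tableau P" and rw: "reading_word P \<in> reduced_words w" by (auto simp: eg_tableaux_def)
    then have sum: "sum_list (map card P) = perm_length w"
      using length_reading_word[OF tab] by (simp add: reduced_words_def)
    have "length (map card P) \<le> sum_list (map card P)"
      using tableau_partition[OF tab] unfolding is_partition_def by (blast intro: length_le_sum_list)
    moreover have "x \<le> sum_list (map card P)" if "x \<in> set (map card P)" for x
      using that by (intro member_le_sum_list) auto
    ultimately show "(map card P, reading_word P) \<in>
        {l. set l \<subseteq> {..perm_length w} \<and> length l \<le> perm_length w} \<times> reduced_words w"
      using rw sum by auto
  qed
  show "finite ({l. set l \<subseteq> {..perm_length w} \<and> length l \<le> perm_length w} \<times> reduced_words w)"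
    by (simp add: finite_lists_length_le finite_reduced_words)
qed

lemma schur_fun_eq:
  assumes "is_partition p"
  shows "schur_fun p m = int (card {s. standard s \<and> set s = diagram p \<and> length s = size m \<and>
    cols_increase (sorted_list_of_multiset m) s})"
proof -
  have "length (sorted_list_of_multiset m) = size m" by (metis mset_sorted_list_of_multiset size_mset)
  then show ?thesis
    using card_semistandard[OF assms, of "sorted_list_of_multiset m"] by (simp add: schur_fun_def)
qed

lemma down_closed_swap: "down_closed (prod.swap ` D) \<longleftrightarrow> down_closed D"
proof -
  have "(a, b) \<in> prod.swap ` D \<longleftrightarrow> (b, a) \<in> D" for a b by force
  then show ?thesis by (auto simp: down_closed_def)
qed

lemma standard_swap: "standard (map prod.swap s) \<longleftrightarrow> standard s"
  by (simp add: standard_def distinct_map take_map down_closed_swap)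

text \<open>Swapping coordinates turns standard lists of the conjugate shape into those of
  \<open>p\<close>. Thus the Schur functions of both shapes count recording lists of one shape,
  under different conditions.\<close>

lemma schur_fun_conj_eq:
  assumes p: "is_partition p"
  shows "schur_fun (conj_partition p) m = int (card {s. standard s \<and> set s = diagram p \<and>
    length s = size m \<and> cols_increase (sorted_list_of_multiset m) (map prod.swap s)})"
proof -
  let ?b = "sorted_list_of_multiset m"
  have d: "diagram (conj_partition p) = prod.swap ` diagram p"
    using diagram_conj_partition[OF p] by (auto simp: image_iff) (metis swap_simp)+
  have inj: "prod.swap ` A = prod.swap ` B \<longleftrightarrow> A = B" for A B :: "(nat \<times> nat) set"
    by (simp add: inj_image_eq_iff)
  have "bij_betw (map prod.swap)
     {s. standard s \<and> set s = diagram p \<and> length s = size m \<and> cols_increase ?b (map prod.swap s)}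
     {s. standard s \<and> set s = diagram (conj_partition p) \<and> length s = size m \<and> cols_increase ?b s}"
    by (rule bij_betw_byWitness[where f' = "map prod.swap"])
      (auto simp: standard_swap d image_image comp_def)
  from bij_betw_same_card[OF this] show ?thesis
    by (simp add: schur_fun_eq[OF is_partition_conj[OF p]])
qed

section \<open>From reduced words to Schur functions\<close>

definition block_descending :: "nat list \<Rightarrow> int list \<Rightarrow> bool" where
  "block_descending b a \<longleftrightarrow> (\<forall>n. Suc n < length a \<longrightarrow> b ! n = b ! Suc n \<longrightarrow> a ! Suc n < a ! n)"

definition block_ascending :: "nat list \<Rightarrow> int list \<Rightarrow> bool" where
  "block_ascending b a \<longleftrightarrow> (\<forall>n. Suc n < length a \<longrightarrow> b ! n = b ! Suc n \<longrightarrow> a ! n < a ! Suc n)"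

text \<open>The list \<open>b\<close> is determined by its multiset. Neighbours in a reduced word
  differ, so the condition on ascents says that the word descends wherever \<open>b\<close> is
  constant.\<close>

lemma stanley_eq:
  "stanley w m = int (card {a \<in> reduced_words w. length a = size m \<and>
    block_descending (sorted_list_of_multiset m) a})"
proof -
  let ?b = "sorted_list_of_multiset m"
  have lb: "length ?b = size m" by (metis mset_sorted_list_of_multiset size_mset)
  have bu: "b = ?b" if "sorted b" "mset b = m" for b
    using that by (metis sorted_list_of_multiset_mset sorted_sort_id)
  have eq: "(\<forall>j. Suc j < length a \<longrightarrow> a ! j < a ! Suc j \<longrightarrow> ?b ! j < ?b ! Suc j) \<longleftrightarrow> block_descending ?b a"
    if a: "reduced a" "length a = size m" for a
  proof -
    have "?b ! j < ?b ! Suc j \<longleftrightarrow> ?b ! j \<noteq> ?b ! Suc j" if "Suc j < length a" for j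
      using sorted_nth_mono[of ?b j "Suc j"] that a lb by (simp add: order.strict_iff_order)
    moreover have "a ! j < a ! Suc j \<longleftrightarrow> \<not> a ! Suc j < a ! j" if "Suc j < length a" for j
      using reduced_nth_neq[OF a(1) that] by auto
    ultimately show ?thesis unfolding block_descending_def by metis
  qed
  have "{(a, b). a \<in> reduced_words w \<and> length b = length a \<and> sorted b \<and>
     (\<forall>j. Suc j < length a \<longrightarrow> a ! j < a ! Suc j \<longrightarrow> b ! j < b ! Suc j) \<and> mset b = m} =
    (\<lambda>a. (a, ?b)) ` {a \<in> reduced_words w. length a = size m \<and> block_descending ?b a}"
    (is "?A = ?B")
  proof (intro equalityI subrelI)
    fix a b assume "(a, b) \<in> ?A"
    then have *: "a \<in> reduced_words w" "length b = length a" "sorted b" "mset b = m"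
      "\<forall>j. Suc j < length a \<longrightarrow> a ! j < a ! Suc j \<longrightarrow> b ! j < b ! Suc j" by auto
    note b = bu[OF *(3,4)]
    have "length a = size m" using * by auto
    then show "(a, b) \<in> ?B" using * eq[of a] b by (auto simp: reduced_words_iff)
  next
    fix a b assume "(a, b) \<in> ?B"
    then have *: "a \<in> reduced_words w" "length a = size m" "block_descending ?b a" "b = ?b" by auto
    then show "(a, b) \<in> ?A" using eq[of a] lb by (auto simp: reduced_words_iff)
  qed
  then show ?thesis by (simp add: stanley_def card_image inj_on_def)
qed

text \<open>A descent puts the next box into a strictly lower row, so descending blocks fill
  vertical strips. These are horizontal strips of the conjugate shape.\<close>

lemma stanley_schur:
  "stanley w m = (\<Sum>P\<in>eg_tableaux w. schur_fun (conj_partition (map card P)) m)"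
proof -
  let ?b = "sorted_list_of_multiset m"
  have lb: "length ?b = size m" by (metis mset_sorted_list_of_multiset size_mset)
  have "card {a \<in> reduced_words w. length a = size m \<and> block_descending ?b a} =
    (\<Sum>P\<in>eg_tableaux w. card {s. standard s \<and> set s = diagram (map card P) \<and>
      (length s = size m \<and> cols_increase ?b (map prod.swap s))})"
  proof (rule eg_count[OF finite_eg_tableaux], rule conj_cong)
    fix a P s assume a: "reduced a" "word_prod a = w" "edelman_greene a P s"
    note c = eg_correct[OF a(3)]
    show "length a = size m \<longleftrightarrow> length s = size m" using c by simp
    assume ls: "length s = size m"
    have "a ! Suc n < a ! n \<longleftrightarrow> fst (s ! n) < fst (s ! Suc n)" if "Suc n < length a" for n
      using eg_descents[OF a(3) that] reduced_nth_neq[OF a(1) that] by auto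
    then show "block_descending ?b a \<longleftrightarrow> cols_increase ?b (map prod.swap s)"
      using c ls lb by (auto simp: block_descending_def cols_increase_def)
  qed
  then show ?thesis
    unfolding stanley_eq using tableau_partition
    by (simp add: schur_fun_conj_eq eg_tableaux_def)
qed

text \<open>An ascent puts the next box weakly higher, hence by \<open>standard_consecutive\<close>
  strictly further right: ascending blocks fill horizontal strips of the shape itself.\<close>

lemma ascending_schur:
  "int (card {a \<in> reduced_words w. length a = size m \<and> block_ascending (sorted_list_of_multiset m) a})
    = (\<Sum>P\<in>eg_tableaux w. schur_fun (map card P) m)"
proof -
  let ?b = "sorted_list_of_multiset m"
  have lb: "length ?b = size m" by (metis mset_sorted_list_of_multiset size_mset)
  have "card {a \<in> reduced_words w. length a = size m \<and> block_ascending ?b a} =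
    (\<Sum>P\<in>eg_tableaux w. card {s. standard s \<and> set s = diagram (map card P) \<and>
      (length s = size m \<and> cols_increase ?b s)})"
  proof (rule eg_count[OF finite_eg_tableaux], rule conj_cong)
    fix a P s assume a: "reduced a" "word_prod a = w" "edelman_greene a P s"
    note c = eg_correct[OF a(3)]
    show "length a = size m \<longleftrightarrow> length s = size m" using c by simp
    assume ls: "length s = size m"
    have "a ! n < a ! Suc n \<longleftrightarrow> snd (s ! n) < snd (s ! Suc n)" if "Suc n < length a" for n
      using eg_descents[OF a(3) that] reduced_nth_neq[OF a(1) that]
        standard_consecutive[of s n] c that by auto
    then show "block_ascending ?b a \<longleftrightarrow> cols_increase ?b s"
      using c ls lb by (auto simp: block_ascending_def cols_increase_def)
  qed
  then show ?thesis
    using tableau_partition by (simp add: schur_fun_eq eg_tableaux_def)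
qed

section \<open>Conjugation by the reflection of the integers\<close>

lift_definition star :: "zperm \<Rightarrow> zperm" is "\<lambda>f x. - f (- x)"
proof -
  fix f :: "int \<Rightarrow> int" assume f: "bij f \<and> finite {a. f a \<noteq> a}"
  have "bij (uminus \<circ> f \<circ> uminus)" using f by (intro bij_comp bij_uminus) auto
  moreover have "{a. - f (- a) \<noteq> a} = uminus ` {a. f a \<noteq> a}"
  proof (intro set_eqI iffI)
    fix a assume "a \<in> {a. - f (- a) \<noteq> a}"
    then show "a \<in> uminus ` {a. f a \<noteq> a}" by (intro image_eqI[of _ _ "- a"]) auto
  qed auto
  ultimately show "bij (\<lambda>x. - f (- x)) \<and> finite {a. - f (- a) \<noteq> a}" using f by (simp add: comp_def)
qed

lemma apply_star: "star w \<langle>$\<rangle> x = - (w \<langle>$\<rangle> (- x))"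
  by transfer simp

lemma star_star [simp]: "star (star w) = w"
  by (rule perm_eqI) (simp add: apply_star)

lemma star_mult: "star (u * v) = star u * star v"
  by (rule perm_eqI) (simp add: apply_star apply_mult)

lemma star_one [simp]: "star 1 = 1"
  by (rule perm_eqI) (simp add: apply_star)

text \<open>The pair \<open>i\<close>, \<open>i + 1\<close> is reflected to \<open>- i\<close>,
  \<open>- i - 1\<close>, whose smaller member is the new letter.\<close>

lemma star_refl: "star (simple_refl i) = simple_refl (- i - 1)"
proof (rule perm_eqI)
  fix a
  show "star (simple_refl i) \<langle>$\<rangle> a = simple_refl (- i - 1) \<langle>$\<rangle> a"
    unfolding apply_star apply_simple_refl by auto
qed

lemma star_inverse: "star (inverse w) = inverse (star w)"
proof (rule perm_eqI)
  fix x
  have "inverse (star w) \<langle>$\<rangle> x = star (inverse w) \<langle>$\<rangle> x"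
    by (simp only: apply_inverse_iff apply_star) simp
  then show "star (inverse w) \<langle>$\<rangle> x = inverse (star w) \<langle>$\<rangle> x" by simp
qed

definition star_word :: "int list \<Rightarrow> int list" where
  "star_word a = map (\<lambda>i. - i - 1) a"

lemma length_star_word [simp]: "length (star_word a) = length a"
  by (simp add: star_word_def)

lemma star_word_star_word [simp]: "star_word (star_word a) = a"
  by (simp add: star_word_def comp_def)

lemma word_prod_star: "word_prod (star_word a) = star (word_prod a)"
  by (induction a) (simp_all add: star_word_def star_mult star_refl)

lemma perm_length_star [simp]: "perm_length (star w) = perm_length w"
proof -
  have *: "perm_length (star v) \<le> perm_length v" for v
  proof -
    obtain a where "a \<in> reduced_words v" using reduced_word_exists by blast
    then show ?thesis
      using perm_length_word[of "star_word a"] by (simp add: reduced_words_def word_prod_star)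
  qed
  from *[of w] *[of "star w"] show ?thesis by simp
qed

lemma reduced_words_star: "reduced_words (star w) = star_word ` reduced_words w"
proof (intro set_eqI iffI)
  fix a assume "a \<in> reduced_words (star w)"
  then have "star_word a \<in> reduced_words w"
    by (simp add: reduced_words_def word_prod_star)
  then show "a \<in> star_word ` reduced_words w" by (metis image_eqI star_word_star_word)
next
  fix a assume "a \<in> star_word ` reduced_words w"
  then show "a \<in> reduced_words (star w)"
    by (auto simp: reduced_words_def word_prod_star)
qed

text \<open>Replacing each letter \<open>i\<close> by \<open>- i - 1\<close> reverses the order of
  letters, so descending blocks for \<open>star w\<close> are ascending blocks for \<open>w\<close>,
  recorded by the same tableaux.\<close>

lemma stanley_star:
  "stanley (star w) m = (\<Sum>P\<in>eg_tableaux w. schur_fun (map card P) m)"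
proof -
  let ?b = "sorted_list_of_multiset m"
  have bd: "block_descending ?b (star_word a) \<longleftrightarrow> block_ascending ?b a" for a
    by (auto simp: block_descending_def block_ascending_def star_word_def)
  have "{a \<in> reduced_words (star w). length a = size m \<and> block_descending ?b a} =
      star_word ` {a \<in> reduced_words w. length a = size m \<and> block_ascending ?b a}"
    unfolding reduced_words_star by (auto simp: bd)
  moreover have "inj_on star_word A" for A by (metis inj_onI star_word_star_word)
  ultimately show ?thesis
    by (simp add: stanley_eq card_image flip: ascending_schur)
qed

text \<open>The operation transported by \<open>star\<close> satisfies the same axioms, so it is the
  Demazure product by uniqueness.\<close>

lemma demazure_star: "demazure (star u) (star v) = star (demazure u v)"
proof -
  have d: "is_demazure_product demazure" by (rule is_demazure_product_demazure)
  have "is_demazure_product (\<lambda>u v. star (demazure (star u) (star v)))"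
    unfolding is_demazure_product_def
  proof (intro conjI allI impI)
    fix u v w
    show "star (demazure (star (star (demazure (star u) (star v)))) (star w)) =
        star (demazure (star u) (star (star (demazure (star v) (star w)))))"
      using d by (simp add: is_demazure_product_def)
  next
    fix u v assume "perm_length (u * v) = perm_length u + perm_length v"
    then have "perm_length (star u * star v) = perm_length (star u) + perm_length (star v)"
      by (simp flip: star_mult)
    then show "star (demazure (star u) (star v)) = u * v"
      using d by (simp add: is_demazure_product_def star_mult)
  next
    fix i
    show "star (demazure (star (simple_refl i)) (star (simple_refl i))) = simple_refl i"
    proof -
      have "demazure (simple_refl (- i - 1)) (simple_refl (- i - 1)) = simple_refl (- i - 1)"
        using d unfolding is_demazure_product_def by blast
      then show ?thesis unfolding star_refl by (simp only: star_refl) simp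
    qed
  qed
  then have "(\<lambda>u v. star (demazure (star u) (star v))) = demazure"
    using demazure_product_unique_existence d by blast
  then show ?thesis by (metis star_star)
qed

lemma atoms_star: "atoms (star y) = star ` atoms y"
proof -
  have *: "star w \<in> atoms (star z)" if w: "w \<in> atoms z" for w z
    unfolding atoms_def
  proof (intro CollectI conjI allI impI)
    show "demazure (inverse (star w)) (star w) = star z"
      using w by (simp add: atoms_def demazure_star flip: star_inverse)
    fix v assume "demazure (inverse v) v = star z"
    then have "demazure (inverse (star v)) (star v) = z"
      by (simp add: demazure_star flip: star_inverse)
    then show "perm_length (star w) \<le> perm_length v" using w by (force simp: atoms_def)
  qed
  show ?thesis
  proof (intro equalityI subsetI)
    fix w assume "w \<in> atoms (star y)"
    then have "star w \<in> atoms y" using *[of w "star y"] by simp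
    then show "w \<in> star ` atoms y" by (metis image_eqI star_star)
  qed (use * in auto)
qed


section \<open>The code of a permutation\<close>

text \<open>The code is indexed by positions rather than values. A multiplication from the left that
  increases the length then changes it at one position only.\<close>

definition lcode :: "zperm \<Rightarrow> int \<Rightarrow> nat" where
  "lcode w p = card {q. q < p \<and> w \<langle>$\<rangle> p < w \<langle>$\<rangle> q}"

lemma finite_lcode_set:
  fixes w :: zperm
  shows "finite {q. q < p \<and> w \<langle>$\<rangle> p < w \<langle>$\<rangle> q}"
proof (rule finite_subset)
  show "{q. q < p \<and> w \<langle>$\<rangle> p < w \<langle>$\<rangle> q} \<subseteq> fst ` invs w" by (force simp: invs_def)
qed (simp add: finite_invs)

lemma lcode_pos_iff: "0 < lcode w p \<longleftrightarrow> (\<exists>q<p. w \<langle>$\<rangle> p < w \<langle>$\<rangle> q)"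
  using finite_lcode_set[of p w] by (auto simp: lcode_def card_gt_0_iff)

lemma finite_lcode_support: "finite {p. 0 < lcode w p}"
proof (rule finite_subset)
  show "{p. 0 < lcode w p} \<subseteq> snd ` invs w" by (force simp: invs_def lcode_pos_iff)
qed (simp add: finite_invs)

text \<open>Only the order of the values \<open>a\<close> and \<open>a + 1\<close> changes, so the
  right one of their two positions gains the left one.\<close>

lemma lcode_refl_left:
  assumes asc: "inverse w \<langle>$\<rangle> a < inverse w \<langle>$\<rangle> (a + 1)"
  shows "lcode (simple_refl a * w) p = lcode w p + (if w \<langle>$\<rangle> p = a + 1 then 1 else 0)"
proof -
  define x y where "x = inverse w \<langle>$\<rangle> a" and "y = inverse w \<langle>$\<rangle> (a + 1)"
  have xy: "x < y" "w \<langle>$\<rangle> x = a" "w \<langle>$\<rangle> y = a + 1" using asc by (simp_all add: x_def y_def)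
  have wx: "w \<langle>$\<rangle> q = a \<longleftrightarrow> q = x" "w \<langle>$\<rangle> q = a + 1 \<longleftrightarrow> q = y" for q
    using xy by (metis apply_inverse_apply)+
  have val: "(simple_refl a * w) \<langle>$\<rangle> q = (if q = x then a + 1 else if q = y then a else w \<langle>$\<rangle> q)" for q
    using wx[of q] xy by (auto simp: apply_mult apply_simple_refl)
  consider "p = y" | "p = x" | "p \<noteq> x" "p \<noteq> y" by blast
  then show ?thesis
  proof cases
    case 1
    have "{q. q < p \<and> (simple_refl a * w) \<langle>$\<rangle> p < (simple_refl a * w) \<langle>$\<rangle> q}
        = insert x {q. q < p \<and> w \<langle>$\<rangle> p < w \<langle>$\<rangle> q}"
    proof (intro set_eqI iffI)
      fix q assume "q \<in> {q. q < p \<and> (simple_refl a * w) \<langle>$\<rangle> p < (simple_refl a * w) \<langle>$\<rangle> q}"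
      then show "q \<in> insert x {q. q < p \<and> w \<langle>$\<rangle> p < w \<langle>$\<rangle> q}"
        using 1 xy wx[of q] by (auto simp: val split: if_splits)
    qed (use 1 xy in \<open>auto simp: val\<close>)
    moreover have "x \<notin> {q. q < p \<and> w \<langle>$\<rangle> p < w \<langle>$\<rangle> q}" using 1 xy by simp
    ultimately show ?thesis using 1 xy finite_lcode_set[of p w] by (simp add: lcode_def)
  next
    case 2
    have "(simple_refl a * w) \<langle>$\<rangle> p < (simple_refl a * w) \<langle>$\<rangle> q \<longleftrightarrow> w \<langle>$\<rangle> p < w \<langle>$\<rangle> q" if "q < p" for q
      using 2 xy that wx[of q] by (auto simp: val)
    then show ?thesis using 2 xy by (simp add: lcode_def cong: conj_cong)
  next
    case 3
    have "(simple_refl a * w) \<langle>$\<rangle> p < (simple_refl a * w) \<langle>$\<rangle> q \<longleftrightarrow> w \<langle>$\<rangle> p < w \<langle>$\<rangle> q" for q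
      using 3 xy wx[of p] by (auto simp: val)
    then show ?thesis using 3 wx[of p] by (simp add: lcode_def)
  qed
qed

text \<open>A letter raises the code at the position whose value it lowers to this letter, and the
  larger letters further left do not move that value again. So a descending factor raises distinct
  positions by one, and they can be read off from the final values.\<close>

lemma lcode_descending:
  assumes "reduced (a @ c)" "sorted_wrt (>) a"
  shows "lcode (word_prod (a @ c)) p =
    lcode (word_prod c) p + (if word_prod (a @ c) \<langle>$\<rangle> p \<in> set a then 1 else 0)"
  using assms
proof (induction a)
  case (Cons x a)
  define v where "v = word_prod (a @ c)"
  have red: "reduced (a @ c)" "inverse v \<langle>$\<rangle> x < inverse v \<langle>$\<rangle> (x + 1)"
    using Cons.prems(1) reduced_Cons_iff[of x "a @ c"] by (simp_all add: v_def)
  have less: "i < x" if "i \<in> set a" for i using Cons.prems(2) that by simp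
  have IH: "lcode v p = lcode (word_prod c) p + (if v \<langle>$\<rangle> p \<in> set a then 1 else 0)"
    using Cons.IH[OF red(1)] Cons.prems(2) by (simp add: v_def)
  have w: "word_prod ((x # a) @ c) = simple_refl x * v" by (simp add: v_def)
  have "(simple_refl x * v) \<langle>$\<rangle> p = x \<longleftrightarrow> v \<langle>$\<rangle> p = x + 1"
    by (simp add: apply_mult apply_simple_refl)
  moreover have "(simple_refl x * v) \<langle>$\<rangle> p \<in> set a \<longleftrightarrow> v \<langle>$\<rangle> p \<in> set a"
    using less[of "v \<langle>$\<rangle> p"] less[of x] less[of "x + 1"] by (auto simp: apply_mult apply_simple_refl)
  moreover have "x + 1 \<notin> set a" using less[of "x + 1"] by auto
  ultimately show ?case
    unfolding w lcode_refl_left[OF red(2)] IH by auto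
qed simp

text \<open>For the code of a permutation these are the partial sums of the conjugate of the sorted
  code.\<close>

definition psum :: "(int \<Rightarrow> nat) \<Rightarrow> nat \<Rightarrow> nat" where
  "psum c k = (\<Sum>j<k. card {p. j < c p})"

lemma psum_min:
  assumes "finite S" "\<And>p. p \<notin> S \<Longrightarrow> c p = 0"
  shows "psum c k = (\<Sum>p\<in>S. min k (c p))"
proof -
  have "psum c k = (\<Sum>j<k. \<Sum>p\<in>S. if j < c p then 1 else 0)"
    unfolding psum_def
  proof (rule sum.cong[OF refl])
    fix j
    have "{p. j < c p} = {p \<in> S. j < c p}" using assms(2) by fastforce
    then show "card {p. j < c p} = (\<Sum>p\<in>S. if j < c p then 1 else 0)"
      using assms(1) by (simp add: sum.If_cases Int_def)
  qed
  also have "\<dots> = (\<Sum>p\<in>S. \<Sum>j<k. if j < c p then 1 else 0)" by (rule sum.swap)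
  also have "\<dots> = (\<Sum>p\<in>S. min k (c p))"
  proof (rule sum.cong[OF refl])
    fix p
    have "{..<k} \<inter> {j. j < c p} = {..<min k (c p)}" by auto
    then show "(\<Sum>j<k. if j < c p then 1 else 0) = min k (c p)" by (simp add: sum.If_cases)
  qed
  finally show ?thesis .
qed

lemma descending_unique:
  fixes a b :: "int list"
  assumes "sorted_wrt (>) a" "sorted_wrt (>) b" "set a = set b"
  shows "a = b"
proof -
  have "sorted_wrt (<) (rev a)" "sorted_wrt (<) (rev b)" using assms by (simp_all add: sorted_wrt_rev)
  then have "rev a = rev b" using strict_sorted_equal assms(3) by (metis set_rev)
  then show ?thesis by simp
qed

lemma descending_distinct: "sorted_wrt (>) (a :: int list) \<Longrightarrow> distinct a"
  by (induction a) auto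

text \<open>Each descending block raises every entry of the code at most once. So the first
  \<open>k\<close> blocks together account for at most \<open>min k (lcode w p)\<close> at position
  \<open>p\<close>, and these minima add up to \<open>psum\<close>.\<close>

lemma block_length_bound:
  assumes "reduced (concat as)" "\<forall>x\<in>set as. sorted_wrt (>) x"
  shows "length (concat (take k as)) \<le> psum (lcode (word_prod (concat as))) k"
  using assms
proof (induction as arbitrary: k)
  case (Cons a as)
  define c w v where "c = concat as" and "w = word_prod (a @ c)" and "v = word_prod c"
  have red: "reduced (a @ c)" "reduced c" "sorted_wrt (>) a"
    using Cons.prems reduced_appendD(2) by (auto simp: c_def)
  have code: "lcode w p = lcode v p + (if w \<langle>$\<rangle> p \<in> set a then 1 else 0)" for p
    unfolding w_def v_def by (rule lcode_descending[OF red(1,3)])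
  define S where "S = {p. 0 < lcode w p}"
  have S: "finite S" "\<And>p. p \<notin> S \<Longrightarrow> lcode w p = 0" by (simp_all add: S_def finite_lcode_support)
  then have Sv: "\<And>p. p \<notin> S \<Longrightarrow> lcode v p = 0" using code by (metis add_is_0)
  have "apply (inverse w) ` set a \<subseteq> S" using code by (auto simp: S_def)
  then have "S \<inter> {p. w \<langle>$\<rangle> p \<in> set a} = apply (inverse w) ` set a"
    by (auto simp: image_iff) (metis apply_inverse_apply)
  moreover have "distinct a" by (rule descending_distinct) (rule red(3))
  then have "card (apply (inverse w) ` set a) = length a"
    by (subst card_image) (auto simp: inj_on_def apply_inj distinct_card)
  ultimately have len: "length a = (\<Sum>p\<in>S. if w \<langle>$\<rangle> p \<in> set a then 1 else 0)"
    using S(1) by (simp add: sum.If_cases)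
  show ?case
  proof (cases k)
    case (Suc l)
    have "length (concat (take l as)) \<le> psum (lcode v) l"
      unfolding v_def c_def by (rule Cons.IH) (use red Cons.prems in \<open>auto simp: c_def\<close>)
    also have "\<dots> = (\<Sum>p\<in>S. min l (lcode v p))" by (rule psum_min) (use S Sv in auto)
    finally have "length (concat (take k (a # as))) \<le>
        (\<Sum>p\<in>S. (if w \<langle>$\<rangle> p \<in> set a then 1 else 0) + min l (lcode v p))"
      unfolding sum.distrib using len Suc by simp
    also have "\<dots> \<le> (\<Sum>p\<in>S. min k (lcode w p))"
      by (rule sum_mono) (auto simp: code Suc)
    also have "\<dots> = psum (lcode w) k" by (rule psum_min[symmetric]) (use S in auto)
    finally show ?thesis by (simp add: w_def c_def)
  qed simp
qed simp

text \<open>Multiplying from the left by the simple reflections of the values with nonzero code, in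
  decreasing order, lowers each nonzero entry of the code by one.  At stage \<open>t\<close> the value \<open>t\<close>
  sits where \<open>w\<close> has its smallest left-to-right maximum of size at least \<open>t\<close>.\<close>

lemma strip_code:
  obtains a where "sorted_wrt (>) a" "set a = apply w ` {p. 0 < lcode w p}"
    "perm_length w = length a + perm_length (inverse (word_prod a) * w)"
proof -
  define V where "V = apply w ` {p. 0 < lcode w p}"
  have finV: "finite V" by (simp add: V_def finite_lcode_support)
  have inV: "v \<in> V \<longleftrightarrow> 0 < lcode w (inverse w \<langle>$\<rangle> v)" for v
    unfolding V_def image_iff by (metis apply_apply_inverse apply_inverse_apply mem_Collect_eq)
  obtain N where N: "affected w \<subseteq> {-N..N}" by (rule affected_bound)
  have VN: "V \<subseteq> {-N..N}"
  proof
    fix v assume "v \<in> V"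
    then obtain p q where p: "v = w \<langle>$\<rangle> p" "q < p" "w \<langle>$\<rangle> p < w \<langle>$\<rangle> q" by (auto simp: V_def lcode_pos_iff)
    show "v \<in> {-N..N}"
      using p apply_outside[OF N, of p] apply_inside[OF N, of p] apply_outside[OF N, of q]
        apply_inside[OF N, of q] by (metis atLeastAtMost_iff not_le order.asym order.strict_trans order.strict_trans2)
  qed
  have main: "\<exists>a. sorted_wrt (>) a \<and> set a = {v \<in> V. N + 1 - int n \<le> v} \<and>
      perm_length w = length a + perm_length (inverse (word_prod a) * w) \<and>
      (\<forall>p. w \<langle>$\<rangle> p < N + 1 - int n \<longrightarrow> (inverse (word_prod a) * w) \<langle>$\<rangle> p = w \<langle>$\<rangle> p) \<and>
      (\<exists>q. (inverse (word_prod a) * w) \<langle>$\<rangle> q = N + 1 - int n \<and> N + 1 - int n \<le> w \<langle>$\<rangle> q \<and> lcode w q = 0 \<and>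
        (\<forall>v. N + 1 - int n \<le> v \<and> v < w \<langle>$\<rangle> q \<longrightarrow> v \<in> V))" for n
  proof (induction n)
    case 0
    have fixN: "w \<langle>$\<rangle> (N + 1) = N + 1" using apply_outside[OF N, of "N + 1"] by simp
    then have "N + 1 \<notin> V" using VN by auto
    then have "lcode w (N + 1) = 0" using inV[of "N + 1"] fixN by (metis apply_inverse_apply gr0I)
    moreover have "{v \<in> V. N + 1 \<le> v} = {}" using VN by auto
    ultimately show ?case using fixN by (intro exI[of _ "[]"]) (auto intro!: exI[of _ "N + 1"])
  next
    case (Suc n)
    define t where "t = N - int n"
    have tn: "N + 1 - int n = t + 1" "N + 1 - int (Suc n) = t" by (simp_all add: t_def)
    from Suc obtain a q where a: "sorted_wrt (>) a" "set a = {v \<in> V. t + 1 \<le> v}"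
      "perm_length w = length a + perm_length (inverse (word_prod a) * w)"
      "\<And>p. w \<langle>$\<rangle> p < t + 1 \<Longrightarrow> (inverse (word_prod a) * w) \<langle>$\<rangle> p = w \<langle>$\<rangle> p"
      and q: "(inverse (word_prod a) * w) \<langle>$\<rangle> q = t + 1" "t + 1 \<le> w \<langle>$\<rangle> q" "lcode w q = 0"
        "\<And>v. t + 1 \<le> v \<Longrightarrow> v < w \<langle>$\<rangle> q \<Longrightarrow> v \<in> V"
      unfolding tn by blast
    define u where "u = inverse (word_prod a) * w"
    define p where "p = inverse w \<langle>$\<rangle> t"
    have p: "w \<langle>$\<rangle> p = t" "u \<langle>$\<rangle> p = t" using a(4)[of p] by (simp_all add: p_def u_def)
    show ?case
    proof (cases "t \<in> V")
      case False
      then have "lcode w p = 0" using inV by (simp add: p_def)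
      moreover have "{v \<in> V. t + 1 \<le> v} = {v \<in> V. t \<le> v}" using False by (auto simp: order.order_iff_strict)
      ultimately show ?thesis unfolding tn using a p
        by (intro exI[of _ a]) (auto simp: u_def intro!: exI[of _ p])
    next
      case True
      then have pos: "0 < lcode w p" using inV by (simp add: p_def)
      \<comment> \<open>Otherwise the largest value to the left of \<open>p\<close> is a
        left-to-right maximum above \<open>t\<close>, hence outside \<open>V\<close>, hence at least
        the value at \<open>q\<close>. Its position is also to the left of \<open>q\<close>, so the
        code at \<open>q\<close> would not vanish.\<close>
      have "q < p"
      proof (rule ccontr)
        assume "\<not> q < p"
        moreover have "q \<noteq> p" using q p by auto
        ultimately have pq: "p < q" by simp
        define A where "A = {r. r < p \<and> w \<langle>$\<rangle> p < w \<langle>$\<rangle> r}"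
        have A: "finite A" "A \<noteq> {}" using finite_lcode_set[of p w] pos by (auto simp: A_def lcode_pos_iff)
        define m where "m = Max (apply w ` A)"
        have "m \<in> apply w ` A" using A by (simp add: m_def)
        then obtain r where r: "r < p" "t < w \<langle>$\<rangle> r" "w \<langle>$\<rangle> r = m" using p by (auto simp: A_def)
        have "lcode w r = 0"
        proof (rule ccontr)
          assume "lcode w r \<noteq> 0"
          then obtain r' where r': "r' < r" "w \<langle>$\<rangle> r < w \<langle>$\<rangle> r'" using lcode_pos_iff[of w r] by auto
          then have "r' \<in> A" using r p by (auto simp: A_def)
          then have "w \<langle>$\<rangle> r' \<le> m" using A by (simp add: m_def)
          then show False using r r' by simp
        qed
        then have "w \<langle>$\<rangle> r \<notin> V" using inV by simp
        then have "w \<langle>$\<rangle> q \<le> w \<langle>$\<rangle> r" using q(4)[of "w \<langle>$\<rangle> r"] r by force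
        moreover have "w \<langle>$\<rangle> q \<noteq> w \<langle>$\<rangle> r" using r pq by (auto simp: apply_inj)
        ultimately have "0 < lcode w q" using r pq by (auto simp: lcode_pos_iff intro!: exI[of _ r])
        then show False using q by simp
      qed
      have "inverse u \<langle>$\<rangle> t = p" "inverse u \<langle>$\<rangle> (t + 1) = q"
        using p q(1) by (simp_all add: apply_inverse_iff flip: u_def)
      then have len: "perm_length u = Suc (perm_length (simple_refl t * u))"
        using perm_length_left_descent[of u t] \<open>q < p\<close> by simp
      have u': "inverse (word_prod (a @ [t])) * w = simple_refl t * u"
        by (simp add: u_def mult.assoc)
      have "insert t {v \<in> V. t + 1 \<le> v} = {v \<in> V. t \<le> v}"
      proof (intro set_eqI)
        fix v show "v \<in> insert t {v \<in> V. t + 1 \<le> v} \<longleftrightarrow> v \<in> {v \<in> V. t \<le> v}"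
          using True by (cases "v = t") auto
      qed
      then have set: "set (a @ [t]) = {v \<in> V. t \<le> v}" using a(2) by simp
      have st: "sorted_wrt (>) (a @ [t])" using a(1,2) by (auto simp: sorted_wrt_append)
      show ?thesis unfolding tn
      proof (intro exI[of _ "a @ [t]"] conjI exI[of _ q] allI impI)
        show "perm_length w = length (a @ [t]) + perm_length (inverse (word_prod (a @ [t])) * w)"
          unfolding u' using a(3) len by (simp flip: u_def)
        fix p' assume "w \<langle>$\<rangle> p' < t"
        then show "(inverse (word_prod (a @ [t])) * w) \<langle>$\<rangle> p' = w \<langle>$\<rangle> p'"
          unfolding u' using a(4)[of p'] by (simp add: apply_mult[of _ u] apply_simple_refl flip: u_def)
      next
        show "(inverse (word_prod (a @ [t])) * w) \<langle>$\<rangle> q = t"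
          unfolding u' using q(1) by (simp add: apply_mult[of _ u] flip: u_def)
        show "t \<le> w \<langle>$\<rangle> q" "lcode w q = 0" using q by simp_all
        fix v assume "t \<le> v \<and> v < w \<langle>$\<rangle> q"
        then show "v \<in> V" using True q(4)[of v] by (cases "v = t") auto
      qed (use st set in simp_all)
    qed
  qed
  obtain a where "sorted_wrt (>) a" "set a = {v \<in> V. N + 1 - int (nat (2 * N + 1)) \<le> v}"
      "perm_length w = length a + perm_length (inverse (word_prod a) * w)"
    using main[of "nat (2 * N + 1)"] by blast
  moreover have "{v \<in> V. N + 1 - int (nat (2 * N + 1)) \<le> v} = V" using VN by force
  ultimately show ?thesis using that by (simp add: V_def)
qed


section \<open>Coefficients by block lengths and the leading monomial\<close>

fun blocks :: "nat \<Rightarrow> nat list \<Rightarrow> nat list" where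
  "blocks i [] = []"
| "blocks i (k # ks) = replicate k i @ blocks (Suc i) ks"

lemma set_blocks: "x \<in> set (blocks i ks) \<Longrightarrow> i \<le> x"
  by (induction ks arbitrary: i) (auto, fastforce)

lemma length_blocks [simp]: "length (blocks i ks) = sum_list ks"
  by (induction ks arbitrary: i) auto

lemma sorted_blocks: "sorted (blocks i ks)"
  by (induction ks arbitrary: i) (auto simp: sorted_append dest: set_blocks)

lemma block_descending_append:
  assumes "length a = k" "\<forall>x\<in>set b. i < x" "length b = length c"
  shows "block_descending (replicate k i @ b) (a @ c) \<longleftrightarrow> sorted_wrt (>) a \<and> block_descending b c"
proof -
  have a: "sorted_wrt (>) a \<longleftrightarrow> (\<forall>n. Suc n < k \<longrightarrow> a ! Suc n < a ! n)"
    using assms(1) by (simp add: sorted_wrt_iff_nth_Suc_transp transp_on_greater)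
  show ?thesis
  proof
    assume *: "block_descending (replicate k i @ b) (a @ c)"
    have "a ! Suc n < a ! n" if "Suc n < k" for n
      using *[unfolded block_descending_def, rule_format, of n] that assms(1) by (simp add: nth_append)
    moreover have "c ! Suc n < c ! n" if "Suc n < length c" "b ! n = b ! Suc n" for n
      using *[unfolded block_descending_def, rule_format, of "k + n"] that assms(1) by (simp add: nth_append)
    ultimately show "sorted_wrt (>) a \<and> block_descending b c" using a by (auto simp: block_descending_def)
  next
    assume *: "sorted_wrt (>) a \<and> block_descending b c"
    show "block_descending (replicate k i @ b) (a @ c)"
      unfolding block_descending_def
    proof (intro allI impI)
      fix n assume n: "Suc n < length (a @ c)" "(replicate k i @ b) ! n = (replicate k i @ b) ! Suc n"
      consider "Suc n < k" | "Suc n = k" | "k \<le> n" by linarith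
      then show "(a @ c) ! Suc n < (a @ c) ! n"
      proof cases
        case 1
        then show ?thesis using * a assms(1) by (simp add: nth_append)
      next
        case 2
        then have "b ! 0 = i" "0 < length b" using n assms by (simp_all add: nth_append)
        then show ?thesis using assms(2) by (metis less_irrefl nth_mem)
      next
        case 3
        then have "b ! (n - k) = b ! Suc (n - k)" "Suc (n - k) < length c"
          using n assms(1) by (auto simp: nth_append Suc_diff_le)
        then show ?thesis using * 3 assms(1) by (simp add: nth_append Suc_diff_le block_descending_def)
      qed
    qed
  qed
qed

lemma block_descending_blocks:
  "length a = sum_list ks \<and> block_descending (blocks i ks) a \<longleftrightarrow>
    (\<exists>as. a = concat as \<and> map length as = ks \<and> (\<forall>x\<in>set as. sorted_wrt (>) x))"
proof (induction ks arbitrary: i a)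
  case Nil
  show ?case by (auto simp: block_descending_def)
next
  case (Cons k ks)
  have b: "\<forall>x\<in>set (blocks (Suc i) ks). i < x" using set_blocks by fastforce
  show ?case
  proof
    assume *: "length a = sum_list (k # ks) \<and> block_descending (blocks i (k # ks)) a"
    then have "length (take k a) = k" "length (drop k a) = sum_list ks" by simp_all
    with * block_descending_append[OF _ b, of "take k a" k "drop k a"]
    have "sorted_wrt (>) (take k a)" "block_descending (blocks (Suc i) ks) (drop k a)" by simp_all
    with Cons[of "drop k a" "Suc i"] \<open>length (drop k a) = sum_list ks\<close>
    obtain as where "drop k a = concat as" "map length as = ks" "\<forall>x\<in>set as. sorted_wrt (>) x" by blast
    then show "\<exists>as. a = concat as \<and> map length as = k # ks \<and> (\<forall>x\<in>set as. sorted_wrt (>) x)"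
      using \<open>sorted_wrt (>) (take k a)\<close> \<open>length (take k a) = k\<close>
      by (intro exI[of _ "take k a # as"]) (metis append_take_drop_id concat.simps(2) list.simps(9) set_ConsD)
  next
    assume "\<exists>as. a = concat as \<and> map length as = k # ks \<and> (\<forall>x\<in>set as. sorted_wrt (>) x)"
    then obtain x as where a: "a = x @ concat as" "length x = k" "map length as = ks"
      "sorted_wrt (>) x" "\<forall>x\<in>set as. sorted_wrt (>) x" by (auto simp: map_eq_Cons_conv)
    then have "length (concat as) = sum_list ks \<and> block_descending (blocks (Suc i) ks) (concat as)"
      using Cons[of "concat as" "Suc i"] by blast
    then show "length a = sum_list (k # ks) \<and> block_descending (blocks i (k # ks)) a"
      using block_descending_append[OF a(2) b, of "concat as"] a by simp
  qed
qed

text \<open>The list \<open>ks\<close> is an arbitrary exponent vector, neither sorted nor free of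
  zeros; the words counted are the factorizations into descending factors of these lengths.\<close>

lemma stanley_blocks:
  "stanley w (mset (blocks 0 ks)) = int (card {a \<in> reduced_words w.
    \<exists>as. a = concat as \<and> map length as = ks \<and> (\<forall>x\<in>set as. sorted_wrt (>) x)})"
proof -
  have "sorted_list_of_multiset (mset (blocks 0 ks)) = blocks 0 ks"
    by (simp add: sorted_sort_id sorted_blocks)
  then show ?thesis
    by (simp add: stanley_eq flip: block_descending_blocks[where i = 0])
qed

lemma stanley_bound:
  assumes "stanley w (mset (blocks 0 ks)) \<noteq> 0"
  shows "sum_list (take k ks) \<le> psum (lcode w) k"
proof -
  have "{a \<in> reduced_words w. \<exists>as. a = concat as \<and> map length as = ks \<and>
      (\<forall>x\<in>set as. sorted_wrt (>) x)} \<noteq> {}"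
    using assms unfolding stanley_blocks by force
  then obtain as where as: "reduced (concat as)" "word_prod (concat as) = w" "map length as = ks"
    "\<forall>x\<in>set as. sorted_wrt (>) x" by (auto simp: reduced_words_iff)
  have "sum_list (take k ks) = length (concat (take k as))"
    by (simp add: length_concat take_map flip: as(3))
  then show ?thesis using block_length_bound[OF as(1,4), of k] as(2) by simp
qed

text \<open>The first factor has as many letters as the code has nonzero entries, and each letter
  marks one of them by \<open>lcode_descending\<close>; so its letters, and being descending also
  their order, are forced. \<open>strip_code\<close> shows that this factor can be split off, and
  the rest has each nonzero entry lowered by one.\<close>

lemma leading_word:
  assumes "\<And>j p. r \<le> j \<Longrightarrow> lcode w p \<le> j"
  shows "\<exists>!a. a \<in> reduced_words w \<and> (\<exists>as. a = concat as \<and>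
    map length as = map (\<lambda>j. card {p. j < lcode w p}) [0..<r] \<and> (\<forall>x\<in>set as. sorted_wrt (>) x))"
  using assms
proof (induction r arbitrary: w)
  case 0
  then have 0: "lcode w p = 0" for p by (metis le_zero_eq order_refl)
  have "w = 1"
  proof (rule no_descent)
    fix i
    have "\<not> w \<langle>$\<rangle> (i + 1) < w \<langle>$\<rangle> i" using 0[of "i + 1"] lcode_pos_iff[of w "i + 1"] by force
    moreover have "w \<langle>$\<rangle> i \<noteq> w \<langle>$\<rangle> (i + 1)" by (simp add: apply_inj)
    ultimately show "w \<langle>$\<rangle> i < w \<langle>$\<rangle> (i + 1)" by simp
  qed
  then show ?case by (intro ex1I[of _ "[]"]) (auto simp: reduced_words_iff)
next
  case (Suc r)
  define V where "V = apply w ` {p. 0 < lcode w p}"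
  have cardV: "card V = card {p. 0 < lcode w p}"
    unfolding V_def by (rule card_image) (auto simp: inj_on_def apply_inj)
  have finV: "finite V" by (simp add: V_def finite_lcode_support)
  obtain a where a: "sorted_wrt (>) a" "set a = V"
    "perm_length w = length a + perm_length (inverse (word_prod a) * w)"
    by (rule strip_code[of w]) (simp add: V_def)
  define u where "u = inverse (word_prod a) * w"
  have w: "w = word_prod a * u" unfolding u_def by (metis mult.assoc mult_1 perm.right_inverse)
  have len_a: "length a = card V" using a(1,2) descending_distinct by (metis distinct_card)
  have code: "lcode w p = lcode v p + (if w \<langle>$\<rangle> p \<in> V then 1 else 0)" "lcode v p = lcode w p - 1"
    if "reduced (b @ c)" "word_prod (b @ c) = w" "sorted_wrt (>) b" "set b = V" "v = word_prod c" for b c v p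
  proof -
    show *: "lcode w p = lcode v p + (if w \<langle>$\<rangle> p \<in> V then 1 else 0)"
      using lcode_descending[OF that(1,3), of p] that by simp
    have "w \<langle>$\<rangle> p \<in> V \<longleftrightarrow> 0 < lcode w p" by (auto simp: V_def apply_inj image_iff)
    then show "lcode v p = lcode w p - 1" using * by auto
  qed
  have red: "a @ c \<in> reduced_words w" if "c \<in> reduced_words u" for c
  proof -
    have c: "word_prod c = u" "length c = perm_length u" using that by (auto simp: reduced_words_def)
    have "word_prod (a @ c) = w" unfolding word_prod_simps c(1) by (rule w[symmetric])
    moreover have "length (a @ c) = perm_length w" using a(3) c(2) by (simp add: u_def)
    ultimately show ?thesis by (simp add: reduced_words_def)
  qed
  obtain c0 where c0: "c0 \<in> reduced_words u" using reduced_word_exists by blast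
  have code_u: "lcode u p = lcode w p - 1" for p
  proof (rule code(2)[OF _ _ a(1,2)])
    show "reduced (a @ c0)" "word_prod (a @ c0) = w"
      using red[OF c0] unfolding reduced_words_iff by blast+
    show "u = word_prod c0" using c0 unfolding reduced_words_iff by blast
  qed
  have parts: "map (\<lambda>j. card {p. j < lcode w p}) [0..<Suc r] =
      card V # map (\<lambda>j. card {p. j < lcode u p}) [0..<r]"
  proof -
    have "{p. j < lcode u p} = {p. Suc j < lcode w p}" for j by (auto simp: code_u)
    then show ?thesis by (simp add: cardV map_Suc_upt[symmetric] upt_conv_Cons comp_def del: upt_Suc)
  qed
  have "lcode u p \<le> j" if "r \<le> j" for j p
    using Suc.prems[of "Suc j" p] that by (simp add: code_u)
  from Suc.IH[OF this] obtain c as where c: "c \<in> reduced_words u" "c = concat as"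
      "map length as = map (\<lambda>j. card {p. j < lcode u p}) [0..<r]" "\<forall>x\<in>set as. sorted_wrt (>) x"
    and c_uniq: "\<And>c' bs. c' \<in> reduced_words u \<Longrightarrow> c' = concat bs \<Longrightarrow>
      map length bs = map (\<lambda>j. card {p. j < lcode u p}) [0..<r] \<Longrightarrow>
      \<forall>x\<in>set bs. sorted_wrt (>) x \<Longrightarrow> c' = c"
    by blast
  show ?case
  proof (rule ex1I[of _ "a @ c"])
    show "a @ c \<in> reduced_words w \<and> (\<exists>as. a @ c = concat as \<and>
        map length as = map (\<lambda>j. card {p. j < lcode w p}) [0..<Suc r] \<and> (\<forall>x\<in>set as. sorted_wrt (>) x))"
      unfolding parts using red[OF c(1)] c a len_a by (intro conjI exI[of _ "a # as"]) auto
  next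
    fix d
    assume "d \<in> reduced_words w \<and> (\<exists>as. d = concat as \<and>
        map length as = map (\<lambda>j. card {p. j < lcode w p}) [0..<Suc r] \<and> (\<forall>x\<in>set as. sorted_wrt (>) x))"
    then obtain x bs where d: "d \<in> reduced_words w" "d = x @ concat bs" "length x = card V"
      "map length bs = map (\<lambda>j. card {p. j < lcode u p}) [0..<r]" "sorted_wrt (>) x"
      "\<forall>x\<in>set bs. sorted_wrt (>) x"
      unfolding parts by (auto simp: map_eq_Cons_conv)
    have red_d: "reduced (x @ concat bs)" "word_prod (x @ concat bs) = w"
      using d(1,2) by (auto simp: reduced_words_iff)
    have "set x \<subseteq> V"
    proof
      fix v assume v: "v \<in> set x"
      have "0 < lcode w (inverse w \<langle>$\<rangle> v)"
        using lcode_descending[OF red_d(1) d(5), of "inverse w \<langle>$\<rangle> v"] red_d(2) v by simp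
      then show "v \<in> V" unfolding V_def by (metis apply_apply_inverse imageI mem_Collect_eq)
    qed
    moreover have "card (set x) = card V" using descending_distinct[OF d(5)] d(3) by (simp add: distinct_card)
    ultimately have "set x = V" using finV by (simp add: card_subset_eq)
    then have x: "x = a" using descending_unique[OF d(5) a(1)] a(2) by simp
    have "word_prod (concat bs) = u"
      using red_d(2) x unfolding u_def by (auto simp: mult.assoc[symmetric])
    then have "concat bs \<in> reduced_words u"
      using reduced_appendD(2)[OF red_d(1)] by (simp add: reduced_words_iff)
    then have "concat bs = c" using c_uniq[OF _ refl d(4,6)] by blast
    then show "d = a @ c" using d x by simp
  qed
qed

lemma stanley_leading:
  assumes "\<And>j p. r \<le> j \<Longrightarrow> lcode w p \<le> j"
  shows "stanley w (mset (blocks 0 (map (\<lambda>j. card {p. j < lcode w p}) [0..<r]))) = 1"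
proof -
  obtain a where "{a \<in> reduced_words w. \<exists>as. a = concat as \<and>
      map length as = map (\<lambda>j. card {p. j < lcode w p}) [0..<r] \<and> (\<forall>x\<in>set as. sorted_wrt (>) x)} = {a}"
    using leading_word[OF assms] by blast
  then show ?thesis by (simp add: stanley_blocks)
qed


section \<open>Atoms and the Demazure product\<close>

definition dem :: "zperm \<Rightarrow> zperm" where
  "dem w = demazure (inverse w) w"

lemma demazure_assoc: "demazure (demazure u v) w = demazure u (demazure v w)"
  using is_demazure_product_demazure unfolding is_demazure_product_def by blast

lemma demazure_mult:
  "perm_length (u * v) = perm_length u + perm_length v \<Longrightarrow> demazure u v = u * v"
  using is_demazure_product_demazure unfolding is_demazure_product_def by blast

lemma demazure_idem: "demazure (simple_refl i) (simple_refl i) = simple_refl i"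
  using is_demazure_product_demazure unfolding is_demazure_product_def by blast

lemma perm_length_refl [simp]: "perm_length (simple_refl i) = 1"
  using card_invs_ascent[of 1 i] by (simp add: perm_length_eq card_invs_one)

lemma demazure_refl_right: "demazure w (simple_refl i) = rmul w i"
proof -
  have "[i] \<in> reduced_words (simple_refl i)" by (simp add: reduced_words_def)
  from is_demazure_foldl[OF is_demazure_product_demazure this, of w] show ?thesis by simp
qed

lemma demazure_refl_left: "demazure (simple_refl i) w = lmul i w"
proof (cases "inverse w \<langle>$\<rangle> i < inverse w \<langle>$\<rangle> (i + 1)")
  case True
  then show ?thesis
    using demazure_mult[of "simple_refl i" w] perm_length_left_ascent[OF True] by (simp add: lmul_alt)
next
  case False
  have "demazure (simple_refl i) (simple_refl i * w) = w"
    using demazure_mult[of "simple_refl i" "simple_refl i * w"] perm_length_left_descent[OF False] by simp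
  then have "demazure (simple_refl i) w = w" by (metis demazure_assoc demazure_idem)
  then show ?thesis using False by (simp add: lmul_alt)
qed

lemma inverse_rmul: "inverse (rmul w i) = lmul i (inverse w)"
  by (simp add: lmul_def)

lemma dem_rmul: "dem (rmul w i) = lmul i (rmul (dem w) i)"
proof -
  have "dem (rmul w i) = demazure (demazure (simple_refl i) (inverse w)) (demazure w (simple_refl i))"
    by (simp add: dem_def inverse_rmul demazure_refl_left demazure_refl_right)
  also have "\<dots> = demazure (simple_refl i) (demazure (dem w) (simple_refl i))"
    by (simp add: demazure_assoc dem_def)
  finally show ?thesis by (simp add: demazure_refl_left demazure_refl_right)
qed

lemma dem_one: "dem 1 = 1"
  using demazure_mult[of 1 1] by (simp add: dem_def perm_length_eq card_invs_one)

text \<open>The factor \<open>x\<close> enters only through \<open>dem x\<close>, so it may be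
  exchanged for another left factor with the same value as long as lengths add up.\<close>

lemma dem_mult:
  assumes "perm_length (x * u) = perm_length x + perm_length u"
  shows "dem (x * u) = demazure (inverse u) (demazure (dem x) u)"
proof -
  have "perm_length (inverse u * inverse x) = perm_length (inverse u) + perm_length (inverse x)"
    using assms perm_length_inverse[of "x * u"] by (simp add: perm_length_inverse)
  then have "inverse (x * u) = demazure (inverse u) (inverse x)" using demazure_mult by simp
  moreover have "x * u = demazure x u" using demazure_mult[OF assms] by simp
  ultimately show ?thesis by (simp add: dem_def demazure_assoc)
qed

lemma involution_inverse: "y * y = 1 \<Longrightarrow> inverse y = (y :: zperm)"
  by (rule perm.inverse_unique)

text \<open>If \<open>a\<close> and \<open>a + 1\<close> are fixed, then
  \<open>z * simple_refl a\<close> already has a left descent at \<open>a\<close>, and the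
  multiplication from the left has no effect. Otherwise the ascent persists and \<open>z\<close>
  gets conjugated.\<close>

lemma lmul_rmul_involution:
  assumes z: "z * z = 1" and asc: "z \<langle>$\<rangle> a < z \<langle>$\<rangle> (a + 1)"
  shows "lmul a (rmul z a) =
    (if z \<langle>$\<rangle> a = a \<and> z \<langle>$\<rangle> (a + 1) = a + 1 then z * simple_refl a else simple_refl a * z * simple_refl a)"
proof -
  have r: "rmul z a = z * simple_refl a" using asc by (simp add: rmul_def)
  have i: "inverse (z * simple_refl a) = simple_refl a * z" using involution_inverse[OF z] by simp
  show ?thesis
  proof (cases "z \<langle>$\<rangle> a = a \<and> z \<langle>$\<rangle> (a + 1) = a + 1")
    case True
    then show ?thesis unfolding r lmul_alt i by (simp add: apply_mult)
  next
    case False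
    then have "simple_refl a \<langle>$\<rangle> (z \<langle>$\<rangle> a) < simple_refl a \<langle>$\<rangle> (z \<langle>$\<rangle> (a + 1))"
      using refl_less[of "z \<langle>$\<rangle> a" "z \<langle>$\<rangle> (a + 1)" a] asc by auto
    then show ?thesis using False unfolding r lmul_alt i by (auto simp: apply_mult mult.assoc)
  qed
qed

section \<open>The atom built from the cycles of an involution\<close>

definition cycle_max :: "zperm \<Rightarrow> int \<Rightarrow> int" where
  "cycle_max y x = max x (y \<langle>$\<rangle> x)"

text \<open>The atom \<open>w\<close> of \<open>y\<close> whose inverse is, in one-line notation, the sequence of all cycles
  \<open>b a\<close> with \<open>a \<le> b = y(a)\<close>, ordered by \<open>b\<close>.\<close>

definition top_atom :: "zperm \<Rightarrow> zperm \<Rightarrow> bool" where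
  "top_atom w y \<longleftrightarrow> y * y = 1 \<and> (\<forall>x x'. x \<noteq> x' \<longrightarrow>
    (w \<langle>$\<rangle> x < w \<langle>$\<rangle> x' \<longleftrightarrow> cycle_max y x < cycle_max y x' \<or> cycle_max y x = cycle_max y x' \<and> x' < x))"

lemma involution_apply: "y * y = 1 \<Longrightarrow> y \<langle>$\<rangle> (y \<langle>$\<rangle> x) = (x :: int)"
  by (metis apply_mult apply_one id_apply)

lemma involutionI: "(\<And>x. y \<langle>$\<rangle> (y \<langle>$\<rangle> x) = x) \<Longrightarrow> y * y = (1 :: zperm)"
  by (rule perm_eqI) (simp add: apply_mult)

lemma top_atom_iff:
  "top_atom w y \<Longrightarrow> x \<noteq> x' \<Longrightarrow>
    w \<langle>$\<rangle> x < w \<langle>$\<rangle> x' \<longleftrightarrow> cycle_max y x < cycle_max y x' \<or> cycle_max y x = cycle_max y x' \<and> x' < x"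
  unfolding top_atom_def by blast

text \<open>Undoes a descent of \<open>w\<close> within the cycle of \<open>a\<close> and
  \<open>a + 1\<close>, which splits into two fixed points. No other cycle has its maximum at
  \<open>a\<close> or \<open>a + 1\<close>, so all other comparisons stay the same.\<close>

lemma top_atom_step_fixed:
  assumes w: "top_atom w y" and ya: "y \<langle>$\<rangle> a = a + 1"
  shows "top_atom (w * simple_refl a) (y * simple_refl a)"
proof -
  define s y1 where "s = simple_refl a" and "y1 = y * s"
  have y: "y * y = 1" using w by (simp add: top_atom_def)
  note yy = involution_apply[OF y]
  have ya1: "y \<langle>$\<rangle> (a + 1) = a" using yy[of a] ya by simp
  have s: "s \<langle>$\<rangle> a = a + 1" "s \<langle>$\<rangle> (a + 1) = a" "\<And>x. x \<noteq> a \<Longrightarrow> x \<noteq> a + 1 \<Longrightarrow> s \<langle>$\<rangle> x = x"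
    by (simp_all add: s_def)
  have y1: "y1 \<langle>$\<rangle> a = a" "y1 \<langle>$\<rangle> (a + 1) = a + 1" "\<And>x. x \<noteq> a \<Longrightarrow> x \<noteq> a + 1 \<Longrightarrow> y1 \<langle>$\<rangle> x = y \<langle>$\<rangle> x"
    using ya ya1 s by (simp_all add: y1_def apply_mult)
  have oth: "y \<langle>$\<rangle> x \<noteq> a" "y \<langle>$\<rangle> x \<noteq> a + 1" if "x \<noteq> a" "x \<noteq> a + 1" for x
    using that ya ya1 yy by metis+
  have y1y1: "y1 * y1 = 1"
  proof (rule involutionI)
    fix x show "y1 \<langle>$\<rangle> (y1 \<langle>$\<rangle> x) = x"
      using y1 oth[of x] yy[of x] by (cases "x = a \<or> x = a + 1") auto
  qed
  have t: "cycle_max y a = a + 1" "cycle_max y (a + 1) = a + 1" "cycle_max y1 a = a" "cycle_max y1 (a + 1) = a + 1"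
    using ya ya1 y1 by (simp_all add: cycle_max_def)
  have t': "cycle_max y1 x = cycle_max y x" "cycle_max y x \<noteq> a" "cycle_max y x \<noteq> a + 1" if "x \<noteq> a" "x \<noteq> a + 1" for x
    using that y1(3)[OF that] oth[OF that] by (simp_all add: cycle_max_def max_def)
  have "(w * s) \<langle>$\<rangle> x < (w * s) \<langle>$\<rangle> x' \<longleftrightarrow> cycle_max y1 x < cycle_max y1 x' \<or> cycle_max y1 x = cycle_max y1 x' \<and> x' < x"
    if ne: "x \<noteq> x'" for x x'
  proof -
    have "(w * s) \<langle>$\<rangle> x < (w * s) \<langle>$\<rangle> x' \<longleftrightarrow> w \<langle>$\<rangle> (s \<langle>$\<rangle> x) < w \<langle>$\<rangle> (s \<langle>$\<rangle> x')"
      by (simp add: apply_mult)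
    also have "\<dots> \<longleftrightarrow> cycle_max y (s \<langle>$\<rangle> x) < cycle_max y (s \<langle>$\<rangle> x') \<or>
        cycle_max y (s \<langle>$\<rangle> x) = cycle_max y (s \<langle>$\<rangle> x') \<and> s \<langle>$\<rangle> x' < s \<langle>$\<rangle> x"
      by (rule top_atom_iff[OF w]) (use ne in \<open>simp add: apply_inj\<close>)
    also have "\<dots> \<longleftrightarrow> cycle_max y1 x < cycle_max y1 x' \<or> cycle_max y1 x = cycle_max y1 x' \<and> x' < x"
    proof -
      consider "x = a" "x' = a + 1" | "x = a + 1" "x' = a" | "x = a" "x' \<noteq> a" "x' \<noteq> a + 1"
        | "x = a + 1" "x' \<noteq> a" "x' \<noteq> a + 1" | "x' = a" "x \<noteq> a" "x \<noteq> a + 1"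
        | "x' = a + 1" "x \<noteq> a" "x \<noteq> a + 1" | "x \<noteq> a" "x \<noteq> a + 1" "x' \<noteq> a" "x' \<noteq> a + 1"
        using ne by blast
      then show ?thesis
        using t'[of x] t'[of x'] by cases (auto simp: s t)
    qed
    finally show ?thesis .
  qed
  then show ?thesis using y1y1 unfolding top_atom_def y1_def s_def by blast
qed

text \<open>Undoes a descent of \<open>w\<close> between two different cycles. The partner of
  \<open>a\<close> lies beyond \<open>a + 1\<close>, so \<open>a\<close> is not the maximum of any
  cycle, and exchanging \<open>a\<close> with \<open>a + 1\<close> preserves the order of the
  maxima.\<close>

lemma top_atom_step_conj:
  assumes w: "top_atom w y" and lt: "cycle_max y (a + 1) < cycle_max y a"
  shows "top_atom (w * simple_refl a) (simple_refl a * y * simple_refl a)"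
proof -
  define s y1 where "s = simple_refl a" and "y1 = s * y * s"
  have y: "y * y = 1" using w by (simp add: top_atom_def)
  note yy = involution_apply[OF y]
  have ya: "a + 1 < y \<langle>$\<rangle> a" "cycle_max y a = y \<langle>$\<rangle> a" using lt by (auto simp: cycle_max_def max_def split: if_splits)
  have ss: "s \<langle>$\<rangle> (s \<langle>$\<rangle> x) = x" for x by (simp add: s_def refl_involutive)
  have y1: "y1 \<langle>$\<rangle> x = s \<langle>$\<rangle> (y \<langle>$\<rangle> (s \<langle>$\<rangle> x))" for x by (simp add: y1_def apply_mult)
  have y1y1: "y1 * y1 = 1" by (rule involutionI) (simp add: y1 ss yy)
  have s_less: "s \<langle>$\<rangle> u < s \<langle>$\<rangle> v \<longleftrightarrow> u < v"
    if "\<not> (u = a \<and> v = a + 1)" "\<not> (u = a + 1 \<and> v = a)" for u v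
    using refl_less[of u v a] that by (cases "u = v") (auto simp: s_def)
  have no_a: "cycle_max y z \<noteq> a" for z
  proof
    assume z: "cycle_max y z = a"
    then have "z = a \<or> y \<langle>$\<rangle> z = a" by (auto simp: cycle_max_def max_def split: if_splits)
    then have "z = a \<or> z = y \<langle>$\<rangle> a" using yy by metis
    then have "cycle_max y z = cycle_max y a" by (auto simp: cycle_max_def yy max.commute)
    then show False using z ya by simp
  qed
  have top1: "cycle_max y1 x = s \<langle>$\<rangle> (cycle_max y (s \<langle>$\<rangle> x))" for x
  proof -
    define z where "z = s \<langle>$\<rangle> x"
    have x: "x = s \<langle>$\<rangle> z" by (simp add: z_def ss)
    have "y \<langle>$\<rangle> (a + 1) \<noteq> a" using yy[of "a + 1"] ya by auto
    then have ne: "\<not> (z = a \<and> y \<langle>$\<rangle> z = a + 1)" "\<not> (z = a + 1 \<and> y \<langle>$\<rangle> z = a)" using ya by auto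
    have "cycle_max y1 x = max (s \<langle>$\<rangle> z) (s \<langle>$\<rangle> (y \<langle>$\<rangle> z))" by (simp add: cycle_max_def y1 x ss)
    also have "\<dots> = s \<langle>$\<rangle> (max z (y \<langle>$\<rangle> z))"
      using s_less[OF ne] ne by (auto simp: max_def not_le)
    finally show ?thesis by (simp add: cycle_max_def z_def)
  qed
  have "(w * s) \<langle>$\<rangle> x < (w * s) \<langle>$\<rangle> x' \<longleftrightarrow> cycle_max y1 x < cycle_max y1 x' \<or> cycle_max y1 x = cycle_max y1 x' \<and> x' < x"
    if ne: "x \<noteq> x'" for x x'
  proof -
    define z z' where "z = s \<langle>$\<rangle> x" and "z' = s \<langle>$\<rangle> x'"
    have x: "x = s \<langle>$\<rangle> z" "x' = s \<langle>$\<rangle> z'" "z \<noteq> z'" using ne by (simp_all add: z_def z'_def ss apply_inj)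
    have "(w * s) \<langle>$\<rangle> x < (w * s) \<langle>$\<rangle> x' \<longleftrightarrow> w \<langle>$\<rangle> z < w \<langle>$\<rangle> z'" by (simp add: apply_mult z_def z'_def)
    also have "\<dots> \<longleftrightarrow> cycle_max y z < cycle_max y z' \<or> cycle_max y z = cycle_max y z' \<and> z' < z" by (rule top_atom_iff[OF w x(3)])
    also have "cycle_max y z < cycle_max y z' \<longleftrightarrow> cycle_max y1 x < cycle_max y1 x'"
      unfolding top1 z_def[symmetric] z'_def[symmetric]
      by (rule s_less[symmetric]) (use no_a in auto)
    also have "cycle_max y z = cycle_max y z' \<longleftrightarrow> cycle_max y1 x = cycle_max y1 x'"
      unfolding top1 z_def[symmetric] z'_def[symmetric] by (simp add: apply_inj)
    also have "cycle_max y1 x = cycle_max y1 x' \<and> z' < z \<longleftrightarrow> cycle_max y1 x = cycle_max y1 x' \<and> x' < x"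
    proof (rule conj_cong[OF refl])
      assume "cycle_max y1 x = cycle_max y1 x'"
      then have "cycle_max y z = cycle_max y z'" unfolding top1 z_def[symmetric] z'_def[symmetric] by (simp add: apply_inj)
      then have "\<not> (z' = a \<and> z = a + 1)" "\<not> (z' = a + 1 \<and> z = a)" using lt by auto
      then show "z' < z \<longleftrightarrow> x' < x" unfolding x(1,2) by (rule s_less[symmetric])
    qed
    finally show ?thesis .
  qed
  then show ?thesis using y1y1 unfolding top_atom_def y1_def s_def by blast
qed

text \<open>Every right descent of \<open>w\<close> is of one of the two kinds just treated. Undoing
  it yields a shorter pair of the same type, and \<open>dem_rmul\<close> restores the descent on the
  side of \<open>y\<close>.\<close>

lemma top_atom_dem: "top_atom w y \<Longrightarrow> dem w = y"
proof (induction "perm_length w" arbitrary: w y rule: less_induct)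
  case less
  note w = less.prems
  have y: "y * y = 1" using w by (simp add: top_atom_def)
  note yy = involution_apply[OF y]
  show ?case
  proof (cases "w = 1")
    case True
    have "y = 1"
    proof (rule perm_eqI, rule ccontr)
      fix x assume "y \<langle>$\<rangle> x \<noteq> 1 \<langle>$\<rangle> x"
      then have ne: "x \<noteq> y \<langle>$\<rangle> x" by simp
      have "cycle_max y x = cycle_max y (y \<langle>$\<rangle> x)" by (simp add: cycle_max_def yy max.commute)
      then have "x < y \<langle>$\<rangle> x \<longleftrightarrow> y \<langle>$\<rangle> x < x" using top_atom_iff[OF w ne] True by simp
      then show False using ne by auto
    qed
    then show ?thesis using True dem_one by simp
  next
    case False
    then obtain a where "\<not> w \<langle>$\<rangle> a < w \<langle>$\<rangle> (a + 1)" using no_descent by blast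
    moreover have "w \<langle>$\<rangle> a \<noteq> w \<langle>$\<rangle> (a + 1)" by (simp add: apply_inj)
    ultimately have desc: "w \<langle>$\<rangle> (a + 1) < w \<langle>$\<rangle> a" by simp
    define w1 where "w1 = w * simple_refl a"
    have asc1: "w1 \<langle>$\<rangle> a < w1 \<langle>$\<rangle> (a + 1)" using desc by (simp add: w1_def apply_mult)
    then have w_eq: "w = rmul w1 a" by (simp add: rmul_def w1_def)
    have len: "perm_length w1 < perm_length w"
      using card_invs_descent[of w a] desc by (simp add: w1_def perm_length_eq)
    consider "cycle_max y (a + 1) < cycle_max y a" | "cycle_max y (a + 1) = cycle_max y a"
      using top_atom_iff[OF w, of "a + 1" a] desc by auto
    then show ?thesis
    proof cases
      case 1
      define y1 where "y1 = simple_refl a * y * simple_refl a"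
      have t1: "top_atom w1 y1" unfolding w1_def y1_def by (rule top_atom_step_conj[OF w 1])
      have dem1: "dem w1 = y1" by (rule less.hyps[OF len t1])
      have ya: "a + 1 < y \<langle>$\<rangle> a" "y \<langle>$\<rangle> (a + 1) < y \<langle>$\<rangle> a" "a + 1 < y \<langle>$\<rangle> a"
        using 1 by (auto simp: cycle_max_def max_def split: if_splits)
      have ya1: "y \<langle>$\<rangle> (a + 1) \<noteq> a" using yy[of "a + 1"] ya by auto
      have y1a: "y1 \<langle>$\<rangle> (a + 1) = y \<langle>$\<rangle> a" "y1 \<langle>$\<rangle> a = simple_refl a \<langle>$\<rangle> (y \<langle>$\<rangle> (a + 1))"
        using ya by (simp_all add: y1_def apply_mult apply_simple_refl)
      then have "y1 \<langle>$\<rangle> a < y1 \<langle>$\<rangle> (a + 1)" using ya ya1 by (simp add: apply_simple_refl)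
      moreover have "y1 * y1 = 1" using t1 by (simp add: top_atom_def)
      moreover have "\<not> (y1 \<langle>$\<rangle> a = a \<and> y1 \<langle>$\<rangle> (a + 1) = a + 1)" using y1a ya by simp
      ultimately have "lmul a (rmul y1 a) = simple_refl a * y1 * simple_refl a"
        using lmul_rmul_involution[of y1 a] by auto
      also have "\<dots> = y" by (simp add: y1_def mult.assoc)
      finally show ?thesis using dem_rmul[of w1 a] dem1 w_eq by simp
    next
      case 2
      have "y \<langle>$\<rangle> a \<noteq> y \<langle>$\<rangle> (a + 1)" by (simp add: apply_inj)
      then have ya: "y \<langle>$\<rangle> a = a + 1" using 2 by (auto simp: cycle_max_def max_def split: if_splits)
      then have ya1: "y \<langle>$\<rangle> (a + 1) = a" using yy[of a] by simp
      define y1 where "y1 = y * simple_refl a"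
      have t1: "top_atom w1 y1" unfolding w1_def y1_def by (rule top_atom_step_fixed[OF w ya])
      have dem1: "dem w1 = y1" by (rule less.hyps[OF len t1])
      have fx: "y1 \<langle>$\<rangle> a = a" "y1 \<langle>$\<rangle> (a + 1) = a + 1" using ya ya1 by (simp_all add: y1_def apply_mult)
      have "y1 * y1 = 1" using t1 by (simp add: top_atom_def)
      then have "lmul a (rmul y1 a) = y1 * simple_refl a"
        using lmul_rmul_involution[of y1 a] fx by simp
      also have "\<dots> = y" by (simp add: y1_def)
      finally show ?thesis using dem_rmul[of w1 a] dem1 w_eq by simp
    qed
  qed
qed

lemma top_atom_unique:
  assumes "top_atom w y" "top_atom v y"
  shows "w = v"
proof -
  have "w * inverse v = 1"
  proof (rule no_descent)
    fix i
    define x x' where "x = inverse v \<langle>$\<rangle> i" and "x' = inverse v \<langle>$\<rangle> (i + 1)"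
    have "x \<noteq> x'" by (simp add: x_def x'_def apply_inj)
    moreover have "v \<langle>$\<rangle> x < v \<langle>$\<rangle> x'" by (simp add: x_def x'_def)
    ultimately have "w \<langle>$\<rangle> x < w \<langle>$\<rangle> x'" using top_atom_iff assms by blast
    then show "(w * inverse v) \<langle>$\<rangle> i < (w * inverse v) \<langle>$\<rangle> (i + 1)"
      by (simp add: apply_mult x_def x'_def)
  qed
  then have "w * inverse v * v = v" by simp
  then show ?thesis by (simp add: mult.assoc)
qed

text \<open>In the one-line notation of the inverse, no entry exceeds both of the next two. Descents
  are therefore isolated, and their pairs are taken as the cycles of \<open>y\<close>.\<close>

lemma top_atom_exists:
  assumes free: "\<And>j. inverse w \<langle>$\<rangle> (j + 1) < inverse w \<langle>$\<rangle> j \<Longrightarrow> inverse w \<langle>$\<rangle> j < inverse w \<langle>$\<rangle> (j + 2)"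
  shows "\<exists>y. top_atom w y"
proof -
  define p where "p = apply (inverse w)"
  have p_inj: "p i = p j \<longleftrightarrow> i = j" for i j by (simp add: p_def apply_inj)
  have free: "p j < p (j + 2)" if "p (j + 1) < p j" for j using free that by (simp add: p_def)
  have no_adj: "\<not> p (j + 2) < p (j + 1)" if "p (j + 1) < p j" for j using free[OF that] that by simp
  define f where "f j = (if p (j + 1) < p j then j + 1 else if p j < p (j - 1) then j - 1 else j)" for j
  have ff: "f (f j) = j" for j
    using no_adj[of j] no_adj[of "j - 1"] no_adj[of "j - 2"] by (auto simp: f_def algebra_simps)
  have "bij f" by (rule o_bij[of f f]) (simp_all add: fun_eq_iff ff)
  obtain N where N: "affected (inverse w) \<subseteq> {-N..N}" by (rule affected_bound)
  have "f j = j" if "j < -N - 1 \<or> N + 1 < j" for j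
  proof -
    have "p j = j" "p (j + 1) = j + 1" "p (j - 1) = j - 1"
      unfolding p_def using that by (intro apply_outside[OF N]; auto)+
    then show ?thesis by (simp add: f_def)
  qed
  then have "{j. f j \<noteq> j} \<subseteq> {-N - 1..N + 1}" by force
  then have "finite {j. f j \<noteq> j}" by (rule finite_subset) simp
  with \<open>bij f\<close> have S: "apply (Perm f) = f" by (simp add: Perm_inverse)
  define y where "y = inverse w * Perm f * w"
  have y: "y \<langle>$\<rangle> x = p (f (w \<langle>$\<rangle> x))" for x by (simp add: y_def apply_mult S p_def)
  have wp: "w \<langle>$\<rangle> (p j) = j" for j by (simp add: p_def)
  have pw: "p (w \<langle>$\<rangle> x) = x" for x by (simp add: p_def)
  have yy: "y * y = 1" by (rule involutionI) (simp add: y wp ff pw)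
  \<comment> \<open>\<open>T j\<close> is the maximum of the cycle through the entry at position
    \<open>j\<close>. It remains to see that \<open>T\<close> increases weakly, with ties only
    inside a descent.\<close>
  define T where "T j = cycle_max y (p j)" for j
  have T: "T j = (if p j < p (j - 1) then p (j - 1) else p j)" for j
    using no_adj[of "j - 1"] by (auto simp: T_def cycle_max_def y wp f_def algebra_simps)
  have T_Suc: "T j \<le> T (j + 1)" "T j = T (j + 1) \<Longrightarrow> p (j + 1) < p j" for j
  proof -
    have "p j \<noteq> p (j + 1)" using p_inj by simp
    then show "T j \<le> T (j + 1)" "T j = T (j + 1) \<Longrightarrow> p (j + 1) < p j"
      using no_adj[of "j - 1"] free[of "j - 1"] p_inj[of "j - 1" "j + 1"]
      by (auto simp: T algebra_simps split: if_splits)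
  qed
  have T_mono': "T i \<le> T (i + int n)" for i n
  proof (induction n)
    case (Suc n)
    then show ?case using T_Suc(1)[of "i + int n"] by (simp add: algebra_simps)
  qed simp
  have T_mono: "T i \<le> T j" if "i \<le> j" for i j using T_mono'[of i "nat (j - i)"] that by simp
  have T_eq: "p j < p i" if "i < j" "T i = T j" for i j
  proof -
    have "T i = T (i + 1)" using T_mono[of "i + 1" j] T_Suc(1)[of i] that by simp
    then have d: "p (i + 1) < p i" by (rule T_Suc(2))
    have "j = i + 1"
    proof (rule ccontr)
      assume "j \<noteq> i + 1"
      then have "T (i + 1 + 1) \<le> T j" using that by (intro T_mono) simp
      then have "T (i + 1) = T (i + 1 + 1)" using T_Suc(1)[of "i + 1"] T_Suc(1)[of i] that by simp
      then have "p (i + 1 + 1) < p (i + 1)" by (rule T_Suc(2))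
      then show False using no_adj[OF d] by (simp add: algebra_simps)
    qed
    then show ?thesis using d by simp
  qed
  have fwd: "cycle_max y x < cycle_max y x' \<or> cycle_max y x = cycle_max y x' \<and> x' < x" if "w \<langle>$\<rangle> x < w \<langle>$\<rangle> x'" for x x'
    using T_mono[of "w \<langle>$\<rangle> x" "w \<langle>$\<rangle> x'"] T_eq[OF that] that by (auto simp: T_def pw)
  have "w \<langle>$\<rangle> x < w \<langle>$\<rangle> x' \<longleftrightarrow> cycle_max y x < cycle_max y x' \<or> cycle_max y x = cycle_max y x' \<and> x' < x" if "x \<noteq> x'" for x x'
  proof -
    have "w \<langle>$\<rangle> x \<noteq> w \<langle>$\<rangle> x'" using that by (simp add: apply_inj)
    then show ?thesis using fwd[of x x'] fwd[of x' x] by linarith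
  qed
  then show ?thesis using yy unfolding top_atom_def by blast
qed


section \<open>Moves between atoms\<close>

lemma atoms_iff: "w \<in> atoms y \<longleftrightarrow> dem w = y \<and> (\<forall>v. dem v = y \<longrightarrow> perm_length w \<le> perm_length v)"
  by (auto simp: atoms_def dem_def)

lemma inverse_refl_mult: "inverse (simple_refl i * w) \<langle>$\<rangle> x = inverse w \<langle>$\<rangle> (simple_refl i \<langle>$\<rangle> x)"
  by (simp add: apply_mult)

lemma dem_refl: "dem (simple_refl i) = simple_refl i"
proof -
  have "rmul 1 i = simple_refl i" by (simp add: rmul_def)
  then have "dem (simple_refl i) = lmul i (simple_refl i)" using dem_rmul[of 1 i] dem_one by simp
  then show ?thesis by (simp add: lmul_alt)
qed

text \<open>Both products of two letters yield the longest element of the group generated by these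
  letters. Exchanging one for the other is the move between atoms.\<close>

lemma dem_refl_refl:
  "dem (simple_refl j * simple_refl (j + 1)) = simple_refl j * simple_refl (j + 1) * simple_refl j"
  "dem (simple_refl (j + 1) * simple_refl j) = simple_refl j * simple_refl (j + 1) * simple_refl j"
proof -
  have r: "rmul (simple_refl j) (j + 1) = simple_refl j * simple_refl (j + 1)"
    "rmul (simple_refl (j + 1)) j = simple_refl (j + 1) * simple_refl j"
    unfolding rmul_def apply_simple_refl by simp_all
  have "lmul (j + 1) (simple_refl j * simple_refl (j + 1)) =
      simple_refl (j + 1) * simple_refl j * simple_refl (j + 1)"
    unfolding lmul_alt inverse_refl_mult by (simp add: apply_simple_refl mult.assoc)
  then show "dem (simple_refl j * simple_refl (j + 1)) = simple_refl j * simple_refl (j + 1) * simple_refl j"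
    using dem_rmul[of "simple_refl j" "j + 1"] unfolding r dem_refl by (simp only: refl_braid)
  have "lmul j (simple_refl (j + 1) * simple_refl j) = simple_refl j * simple_refl (j + 1) * simple_refl j"
    unfolding lmul_alt inverse_refl_mult by (simp add: apply_simple_refl mult.assoc)
  then show "dem (simple_refl (j + 1) * simple_refl j) = simple_refl j * simple_refl (j + 1) * simple_refl j"
    using dem_rmul[of "simple_refl (j + 1)" j] unfolding r dem_refl by simp
qed

lemma dem_refl_refl_refl:
  "dem (simple_refl j * simple_refl (j + 1) * simple_refl j) =
    simple_refl j * simple_refl (j + 1) * simple_refl j"
proof -
  define z where "z = simple_refl j * simple_refl (j + 1) * simple_refl j"
  have "rmul (simple_refl j * simple_refl (j + 1)) j = z"
    by (simp add: rmul_def z_def apply_mult apply_simple_refl)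
  then have "dem z = lmul j (rmul z j)"
    using dem_rmul[of "simple_refl j * simple_refl (j + 1)" j] dem_refl_refl(1)[of j] by (simp add: z_def)
  also have "rmul z j = z" by (simp add: rmul_def z_def apply_mult apply_simple_refl)
  also have "lmul j z = z"
  proof -
    have "inverse z = z" by (simp add: z_def mult.assoc)
    then show ?thesis by (simp add: lmul_alt) (simp add: z_def apply_mult apply_simple_refl)
  qed
  finally show ?thesis by (simp add: z_def)
qed

text \<open>Three decreasing entries allow the longest element on three letters to be split off from
  \<open>w\<close> on the left. A product of two letters has the same \<open>dem\<close>, so
  \<open>w\<close> is not of minimal length.\<close>

lemma perm_length_three_descents:
  assumes "inverse w \<langle>$\<rangle> (j + 2) < inverse w \<langle>$\<rangle> (j + 1)" "inverse w \<langle>$\<rangle> (j + 1) < inverse w \<langle>$\<rangle> j"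
  shows "\<exists>v. dem v = dem w \<and> perm_length v < perm_length w"
proof -
  define w1 where "w1 = simple_refl j * w"
  define w2 where "w2 = simple_refl (j + 1) * w1"
  define u where "u = simple_refl j * w2"
  have i1: "inverse w1 \<langle>$\<rangle> x = inverse w \<langle>$\<rangle> (simple_refl j \<langle>$\<rangle> x)" for x
    unfolding w1_def by (rule inverse_refl_mult)
  have i2: "inverse w2 \<langle>$\<rangle> x = inverse w \<langle>$\<rangle> (simple_refl j \<langle>$\<rangle> (simple_refl (j + 1) \<langle>$\<rangle> x))" for x
    unfolding w2_def inverse_refl_mult i1 ..
  have j2: "j + 1 + 1 = j + 2" by simp
  have l1: "perm_length w = Suc (perm_length w1)"
    unfolding w1_def by (rule perm_length_left_descent) (use assms in simp)
  have l2: "perm_length w1 = Suc (perm_length w2)"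
    unfolding w2_def by (rule perm_length_left_descent)
      (unfold i1 apply_simple_refl j2, use assms in simp)
  have l3: "perm_length w2 = Suc (perm_length u)"
    unfolding u_def by (rule perm_length_left_descent)
      (unfold i2 apply_simple_refl, unfold j2, use assms in simp)
  have w: "w = simple_refl j * simple_refl (j + 1) * simple_refl j * u"
    by (simp add: u_def w2_def w1_def mult.assoc)
  have le3: "perm_length (simple_refl j * simple_refl (j + 1) * simple_refl j) \<le> 3"
    using perm_length_word[of "[j, j + 1, j]"] by (simp add: mult.assoc)
  have le2: "perm_length (simple_refl j * simple_refl (j + 1)) \<le> 2"
    using perm_length_word[of "[j, j + 1]"] by simp
  define v where "v = simple_refl j * simple_refl (j + 1) * u"
  \<comment> \<open>\<open>v\<close> differs from \<open>w\<close> by a single letter on the left,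
    which forces its length to be exactly \<open>2 + perm_length u\<close>.\<close>
  have wv: "perm_length w \<le> Suc (perm_length v)"
  proof -
    have "w = simple_refl j * simple_refl (j + 1) * simple_refl j * simple_refl (j + 1) * simple_refl j * v"
      by (simp add: w v_def mult.assoc)
    also have "simple_refl j * simple_refl (j + 1) * simple_refl j * simple_refl (j + 1) * simple_refl j =
        simple_refl (j + 1)"
    proof -
      have "simple_refl j * simple_refl (j + 1) * simple_refl j * simple_refl (j + 1) * simple_refl j =
          simple_refl (j + 1) * simple_refl j * simple_refl (j + 1) * simple_refl (j + 1) * simple_refl j"
        by (simp only: refl_braid)
      then show ?thesis by (simp add: mult.assoc)
    qed
    finally show ?thesis using perm_length_step_le[of "j + 1" v] by simp
  qed
  have lw: "perm_length w = 3 + perm_length u" using l1 l2 l3 by simp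
  have lv: "perm_length v = 2 + perm_length u"
    using wv lw perm_length_mult[of "simple_refl j * simple_refl (j + 1)" u] le2 by (simp add: v_def)
  define x where "x = simple_refl j * simple_refl (j + 1) * simple_refl j"
  have wx: "x * u = w" using w by (simp only: x_def)
  have "perm_length x = 3"
    using perm_length_mult[of x u] le3 lw unfolding wx x_def[symmetric] by simp
  then have "dem (x * u) = demazure (inverse u) (demazure (dem x) u)"
    by (intro dem_mult) (simp only: wx lw)
  then have "dem w = demazure (inverse u) (demazure (simple_refl j * simple_refl (j + 1) * simple_refl j) u)"
    unfolding wx unfolding x_def dem_refl_refl_refl .
  moreover have "perm_length (simple_refl j * simple_refl (j + 1)) = 2"
    using perm_length_mult[of "simple_refl j * simple_refl (j + 1)" u] le2 lv by (simp add: v_def)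
  then have "dem v = demazure (inverse u) (demazure (simple_refl j * simple_refl (j + 1) * simple_refl j) u)"
    using dem_mult[of "simple_refl j * simple_refl (j + 1)" u] lv dem_refl_refl(1)[of j] by (simp add: v_def)
  ultimately show ?thesis using lw lv by (intro exI[of _ v]) simp
qed

text \<open>The common remainder \<open>u\<close> carries the entries \<open>a b c\<close>, and
  \<open>f\<close> is its code. Two ascents lead from it to \<open>c a b\<close>, which is
  \<open>w\<close>, adding two units at \<open>c\<close>; two others lead to \<open>b c a\<close>,
  which is \<open>v\<close>, adding one unit at \<open>b\<close> and one at \<open>c\<close>. As the
  values of \<open>u\<close> at \<open>b\<close> and \<open>c\<close> are consecutive, everything
  counted at \<open>b\<close> is counted at \<open>c\<close>.\<close>

lemma atom_move:
  assumes "inverse w \<langle>$\<rangle> (j + 1) < inverse w \<langle>$\<rangle> (j + 2)" "inverse w \<langle>$\<rangle> (j + 2) < inverse w \<langle>$\<rangle> j"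
  shows "\<exists>v f b c. dem v = dem w \<and> perm_length v = perm_length w \<and> b \<noteq> c \<and> f b \<le> f c \<and>
    (\<forall>p. lcode w p = f p + (if p = c then 2 else 0)) \<and>
    (\<forall>p. lcode v p = f p + (if p = b \<or> p = c then 1 else 0))"
proof -
  define a b c where "a = inverse w \<langle>$\<rangle> (j + 1)" and "b = inverse w \<langle>$\<rangle> (j + 2)"
    and "c = inverse w \<langle>$\<rangle> j"
  have abc: "a < b" "b < c" using assms by (simp_all add: a_def b_def c_def)
  define w1 where "w1 = simple_refl j * w"
  define u where "u = simple_refl (j + 1) * w1"
  define v1 where "v1 = simple_refl j * u"
  define v where "v = simple_refl (j + 1) * v1"
  have i1: "inverse w1 \<langle>$\<rangle> x = inverse w \<langle>$\<rangle> (simple_refl j \<langle>$\<rangle> x)" for x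
    unfolding w1_def by (rule inverse_refl_mult)
  have iu: "inverse u \<langle>$\<rangle> x = inverse w \<langle>$\<rangle> (simple_refl j \<langle>$\<rangle> (simple_refl (j + 1) \<langle>$\<rangle> x))" for x
    unfolding u_def inverse_refl_mult i1 ..
  have iv1: "inverse v1 \<langle>$\<rangle> x = inverse u \<langle>$\<rangle> (simple_refl j \<langle>$\<rangle> x)" for x
    unfolding v1_def by (rule inverse_refl_mult)
  have j2: "j + 1 + 1 = j + 2" by simp
  have w1: "inverse w1 \<langle>$\<rangle> j = a" "inverse w1 \<langle>$\<rangle> (j + 1) = c" "inverse w1 \<langle>$\<rangle> (j + 2) = b"
    by (simp_all add: i1 apply_simple_refl a_def b_def c_def)
  have u: "inverse u \<langle>$\<rangle> j = a" "inverse u \<langle>$\<rangle> (j + 1) = b" "inverse u \<langle>$\<rangle> (j + 2) = c"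
    unfolding iu apply_simple_refl unfolding j2 by (simp_all add: a_def b_def c_def)
  have v1: "inverse v1 \<langle>$\<rangle> j = b" "inverse v1 \<langle>$\<rangle> (j + 1) = a" "inverse v1 \<langle>$\<rangle> (j + 2) = c"
    by (simp_all add: iv1 apply_simple_refl u)
  have ww1: "w = simple_refl j * w1" and w1u: "w1 = simple_refl (j + 1) * u"
    by (simp_all add: w1_def u_def)
  have asc: "inverse w1 \<langle>$\<rangle> j < inverse w1 \<langle>$\<rangle> (j + 1)" "inverse u \<langle>$\<rangle> (j + 1) < inverse u \<langle>$\<rangle> (j + 1 + 1)"
    "inverse u \<langle>$\<rangle> j < inverse u \<langle>$\<rangle> (j + 1)" "inverse v1 \<langle>$\<rangle> (j + 1) < inverse v1 \<langle>$\<rangle> (j + 1 + 1)"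
    unfolding j2 w1 u v1 using abc by simp_all
  have l: "perm_length w = 2 + perm_length u" "perm_length v = 2 + perm_length u"
    using perm_length_left_ascent[OF asc(1)] perm_length_left_ascent[OF asc(2)]
      perm_length_left_ascent[OF asc(3)] perm_length_left_ascent[OF asc(4)]
    unfolding ww1[symmetric] w1u[symmetric] v1_def[symmetric] v_def[symmetric] by simp_all
  have w: "w = simple_refl j * simple_refl (j + 1) * u" "v = simple_refl (j + 1) * simple_refl j * u"
    by (simp_all add: ww1 w1u v_def v1_def mult.assoc)
  have le2: "perm_length (simple_refl j * simple_refl (j + 1)) \<le> 2"
    "perm_length (simple_refl (j + 1) * simple_refl j) \<le> 2"
    using perm_length_word[of "[j, j + 1]"] perm_length_word[of "[j + 1, j]"] by simp_all
  have "perm_length (simple_refl j * simple_refl (j + 1)) = 2"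
    using perm_length_mult[of "simple_refl j * simple_refl (j + 1)" u] le2 l unfolding w(1)[symmetric] by simp
  then have "dem w = demazure (inverse u) (demazure (simple_refl j * simple_refl (j + 1) * simple_refl j) u)"
    using dem_mult[of "simple_refl j * simple_refl (j + 1)" u] l(1) dem_refl_refl(1)[of j]
    unfolding w(1)[symmetric] by simp
  moreover have "perm_length (simple_refl (j + 1) * simple_refl j) = 2"
    using perm_length_mult[of "simple_refl (j + 1) * simple_refl j" u] le2 l unfolding w(2)[symmetric] by simp
  then have "dem v = demazure (inverse u) (demazure (simple_refl j * simple_refl (j + 1) * simple_refl j) u)"
    using dem_mult[of "simple_refl (j + 1) * simple_refl j" u] l(2) dem_refl_refl(2)[of j]
    unfolding w(2)[symmetric] by simp
  ultimately have dem: "dem v = dem w" by simp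
  have at: "w1 \<langle>$\<rangle> p = j + 1 \<longleftrightarrow> p = c" "u \<langle>$\<rangle> p = j + 1 + 1 \<longleftrightarrow> p = c" "u \<langle>$\<rangle> p = j + 1 \<longleftrightarrow> p = b"
    "v1 \<langle>$\<rangle> p = j + 1 + 1 \<longleftrightarrow> p = c" for p
    using w1 u v1 unfolding j2 by (metis apply_inverse_iff)+
  have cw: "lcode w p = lcode u p + (if p = c then 2 else 0)" for p
    using lcode_refl_left[OF asc(1), of p] lcode_refl_left[OF asc(2), of p]
    unfolding at ww1[symmetric] w1u[symmetric] by simp
  have cv: "lcode v p = lcode u p + (if p = b \<or> p = c then 1 else 0)" for p
    using lcode_refl_left[OF asc(3), of p] lcode_refl_left[OF asc(4), of p] abc
    unfolding at v1_def[symmetric] v_def[symmetric] by auto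
  have "lcode u b \<le> lcode u c"
    unfolding lcode_def
  proof (rule card_mono[OF finite_lcode_set], rule subsetI)
    fix q assume q: "q \<in> {q. q < b \<and> u \<langle>$\<rangle> b < u \<langle>$\<rangle> q}"
    have ub: "u \<langle>$\<rangle> b = j + 1" "u \<langle>$\<rangle> c = j + 2" using at(2)[of c] at(3)[of b] by simp_all
    have "u \<langle>$\<rangle> q \<noteq> j + 2" using at(2)[of q] q abc by auto
    then show "q \<in> {q. q < c \<and> u \<langle>$\<rangle> c < u \<langle>$\<rangle> q}" using q abc ub by auto
  qed
  then show ?thesis using dem l cw cv abc
    by (intro exI[of _ v] exI[of _ "lcode u"] exI[of _ b] exI[of _ c]) simp
qed

lemma sum_two:
  assumes "finite S" "b \<in> S" "c \<in> S" "b \<noteq> c"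
  shows "sum h S = h b + h c + (sum h (S - {b, c}) :: nat)"
proof -
  have "sum h S = h b + sum h (S - {b})" using assms by (simp add: sum.remove)
  also have "sum h (S - {b}) = h c + sum h (S - {b} - {c})" using assms by (intro sum.remove) auto
  also have "S - {b} - {c} = S - {b, c}" by auto
  finally show ?thesis by simp
qed

text \<open>One unit passes from the larger entry at \<open>c\<close> to the smaller one at
  \<open>b\<close>. This flattens the code: its conjugate grows in dominance order, while the sum of
  squares drops.\<close>

lemma move_codes:
  assumes "b \<noteq> c" "f b \<le> f c"
    and w: "\<And>p. lcode w p = f p + (if p = c then 2 else 0)"
    and v: "\<And>p. lcode v p = f p + (if p = b \<or> p = c then 1 else 0)"
  shows "psum (lcode w) k \<le> psum (lcode v) k" "\<exists>k. psum (lcode w) k < psum (lcode v) k"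
    "(\<Sum>p | 0 < lcode v p. (lcode v p)\<^sup>2) < (\<Sum>p | 0 < lcode w p. (lcode w p)\<^sup>2)"
proof -
  define S where "S = {p. 0 < lcode w p} \<union> {p. 0 < lcode v p}"
  have fin: "finite S" by (simp add: S_def finite_lcode_support)
  have bc: "b \<in> S" "c \<in> S" using w v by (simp_all add: S_def)
  have out: "lcode w p = 0" "lcode v p = 0" if "p \<notin> S" for p using that by (auto simp: S_def)
  have wp: "psum (lcode w) k = (\<Sum>p\<in>S. min k (lcode w p))" for k
    by (rule psum_min) (use fin out in auto)
  have vp: "psum (lcode v) k = (\<Sum>p\<in>S. min k (lcode v p))" for k
    by (rule psum_min) (use fin out in auto)
  have eq: "(\<Sum>p\<in>S - {b, c}. g (lcode w p)) = (\<Sum>p\<in>S - {b, c}. g (lcode v p))" for g :: "nat \<Rightarrow> nat"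
    by (rule sum.cong) (use w v in auto)
  have wb: "lcode w b = f b" "lcode w c = f c + 2" "lcode v b = f b + 1" "lcode v c = f c + 1"
    using w v assms(1) by auto
  show "psum (lcode w) k \<le> psum (lcode v) k"
    unfolding wp vp sum_two[OF fin bc assms(1)] using eq[of "min k"] wb assms(2) by (simp add: min_def)
  \<comment> \<open>At \<open>k = Suc (f c)\<close> the unit taken from \<open>c\<close> lies above
    the cut, while the one added at \<open>b\<close> lies below it.\<close>
  show "\<exists>k. psum (lcode w) k < psum (lcode v) k"
    unfolding wp vp sum_two[OF fin bc assms(1)] using eq[of "min (Suc (f c))"] wb assms(2)
    by (intro exI[of _ "Suc (f c)"]) (simp add: min_def)
  have sw: "(\<Sum>p | 0 < lcode w p. (lcode w p)\<^sup>2) = (\<Sum>p\<in>S. (lcode w p)\<^sup>2)"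
    by (rule sum.mono_neutral_left) (auto simp: S_def finite_lcode_support)
  have sv: "(\<Sum>p | 0 < lcode v p. (lcode v p)\<^sup>2) = (\<Sum>p\<in>S. (lcode v p)\<^sup>2)"
    by (rule sum.mono_neutral_left) (auto simp: S_def finite_lcode_support)
  show "(\<Sum>p | 0 < lcode v p. (lcode v p)\<^sup>2) < (\<Sum>p | 0 < lcode w p. (lcode w p)\<^sup>2)"
    unfolding sw sv sum_two[OF fin bc assms(1)] using eq[of "\<lambda>n. n\<^sup>2"] wb assms(2)
    by (simp add: power2_eq_square algebra_simps)
qed

text \<open>The sum of squares is the measure of the induction. Minimal length excludes three
  decreasing consecutive entries, so an atom that is not of the form \<open>top_atom\<close> admits
  a move.\<close>

lemma atoms_dominated:
  "w \<in> atoms y \<Longrightarrow> \<exists>v\<in>atoms y. top_atom v y \<and> (w = v \<or>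
    (\<forall>k. psum (lcode w) k \<le> psum (lcode v) k) \<and> (\<exists>k. psum (lcode w) k < psum (lcode v) k))"
proof (induction "\<Sum>p | 0 < lcode w p. (lcode w p)\<^sup>2" arbitrary: w rule: less_induct)
  case less
  have w: "dem w = y" "\<And>v. dem v = y \<Longrightarrow> perm_length w \<le> perm_length v"
    using less.prems by (auto simp: atoms_iff)
  show ?case
  proof (cases "\<exists>j. inverse w \<langle>$\<rangle> (j + 1) < inverse w \<langle>$\<rangle> j \<and> \<not> inverse w \<langle>$\<rangle> j < inverse w \<langle>$\<rangle> (j + 2)")
    case False
    then obtain z where z: "top_atom w z" using top_atom_exists by blast
    then have "z = y" using top_atom_dem w(1) by blast
    then show ?thesis using z less.prems by blast
  next
    case True
    then obtain j where j: "inverse w \<langle>$\<rangle> (j + 1) < inverse w \<langle>$\<rangle> j"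
      "\<not> inverse w \<langle>$\<rangle> j < inverse w \<langle>$\<rangle> (j + 2)" by blast
    have ne: "inverse w \<langle>$\<rangle> j \<noteq> inverse w \<langle>$\<rangle> (j + 2)" "inverse w \<langle>$\<rangle> (j + 1) \<noteq> inverse w \<langle>$\<rangle> (j + 2)"
      by (simp_all add: apply_inj)
    have "\<not> inverse w \<langle>$\<rangle> (j + 2) < inverse w \<langle>$\<rangle> (j + 1)"
      using perm_length_three_descents[of w j] j w by (metis not_le)
    then obtain v f b c where v: "dem v = dem w" "perm_length v = perm_length w" and bc: "b \<noteq> c" "f b \<le> f c"
      "\<And>p. lcode w p = f p + (if p = c then 2 else 0)"
      "\<And>p. lcode v p = f p + (if p = b \<or> p = c then 1 else 0)"
      using atom_move[of w j] j ne by force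
    note mc = move_codes[of b c f w v, OF bc]
    have "v \<in> atoms y" using v w by (simp add: atoms_iff)
    from less.hyps[OF mc(3) this] obtain x where x: "x \<in> atoms y" "top_atom x y"
      "v = x \<or> (\<forall>k. psum (lcode v) k \<le> psum (lcode x) k)" by blast
    then have "psum (lcode v) k \<le> psum (lcode x) k" for k by auto
    then have "\<forall>k. psum (lcode w) k \<le> psum (lcode x) k" "\<exists>k. psum (lcode w) k < psum (lcode x) k"
      using mc(1,2) by (meson order.trans order.strict_trans2)+
    then show ?thesis using x by blast
  qed
qed

section \<open>Existence and finiteness of atoms\<close>

lemma dem_surj:
  "y * y = 1 \<Longrightarrow> \<exists>w. dem w = y"
proof (induction "perm_length y" arbitrary: y rule: less_induct)
  case less
  note y = less.prems
  note yy = involution_apply[OF y]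
  show ?case
  proof (cases "y = 1")
    case True
    then show ?thesis using dem_one by blast
  next
    case False
    then obtain a where "\<not> y \<langle>$\<rangle> a < y \<langle>$\<rangle> (a + 1)" using no_descent by blast
    moreover have "y \<langle>$\<rangle> a \<noteq> y \<langle>$\<rangle> (a + 1)" by (simp add: apply_inj)
    ultimately have desc: "y \<langle>$\<rangle> (a + 1) < y \<langle>$\<rangle> a" by simp
    \<comment> \<open>Conjugation would leave \<open>y\<close> unchanged if it exchanges
      \<open>a\<close> and \<open>a + 1\<close>, so in this case the reflection is multiplied on one
      side only.\<close>
    define z where "z = (if y \<langle>$\<rangle> a = a + 1 then y * simple_refl a else simple_refl a * y * simple_refl a)"
    have z: "z * z = 1 \<and> z \<langle>$\<rangle> a < z \<langle>$\<rangle> (a + 1) \<and> lmul a (rmul z a) = y"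
    proof (cases "y \<langle>$\<rangle> a = a + 1")
      case True
      then have ya: "y \<langle>$\<rangle> (a + 1) = a" using yy[of a] by simp
      have z: "z = y * simple_refl a" using True by (simp add: z_def)
      have za: "z \<langle>$\<rangle> a = a" "z \<langle>$\<rangle> (a + 1) = a + 1" using True ya by (simp_all add: z apply_mult)
      have zx: "z \<langle>$\<rangle> x = y \<langle>$\<rangle> x" if "x \<noteq> a" "x \<noteq> a + 1" for x
        using that by (simp add: z apply_mult apply_simple_refl)
      have "z * z = 1"
      proof (rule involutionI)
        fix x
        show "z \<langle>$\<rangle> (z \<langle>$\<rangle> x) = x"
        proof (cases "x = a \<or> x = a + 1")
          case False
          then have "y \<langle>$\<rangle> x \<noteq> a" "y \<langle>$\<rangle> x \<noteq> a + 1" using yy ya True by metis+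
          then show ?thesis using False zx yy by simp
        qed (use za in auto)
      qed
      then show ?thesis using lmul_rmul_involution[of z a] za by (simp add: z)
    next
      case False
      have z: "z = simple_refl a * y * simple_refl a" using False by (simp add: z_def)
      have zz: "z * z = 1"
        by (rule involutionI) (simp add: z apply_mult refl_involutive yy)
      have "simple_refl a \<langle>$\<rangle> (y \<langle>$\<rangle> (a + 1)) < simple_refl a \<langle>$\<rangle> (y \<langle>$\<rangle> a)"
        using refl_less[of "y \<langle>$\<rangle> (a + 1)" "y \<langle>$\<rangle> a" a] desc False by auto
      then have asc: "z \<langle>$\<rangle> a < z \<langle>$\<rangle> (a + 1)" by (simp add: z apply_mult)
      have "\<not> (z \<langle>$\<rangle> a = a \<and> z \<langle>$\<rangle> (a + 1) = a + 1)"
      proof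
        assume "z \<langle>$\<rangle> a = a \<and> z \<langle>$\<rangle> (a + 1) = a + 1"
        then have "simple_refl a \<langle>$\<rangle> (y \<langle>$\<rangle> (a + 1)) = a" "simple_refl a \<langle>$\<rangle> (y \<langle>$\<rangle> a) = a + 1"
          by (simp_all add: z apply_mult)
        then have "y \<langle>$\<rangle> (a + 1) = a + 1" "y \<langle>$\<rangle> a = a"
          by (auto simp: apply_simple_refl split: if_splits)
        then show False using desc by simp
      qed
      then show ?thesis using lmul_rmul_involution[OF zz asc] zz asc by (auto simp: z mult.assoc)
    qed
    have "perm_length z < perm_length (rmul z a)"
      using z card_invs_ascent[of z a] by (simp add: rmul_def perm_length_eq)
    also have "\<dots> \<le> perm_length (lmul a (rmul z a))"
      using perm_length_left_ascent[of "rmul z a" a] by (simp add: lmul_alt)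
    finally have "perm_length z < perm_length y" using z by simp
    then obtain w where "dem w = z" using less.hyps z by blast
    then have "dem (rmul w a) = y" using dem_rmul[of w a] z by simp
    then show ?thesis by blast
  qed
qed

lemma atoms_nonempty:
  assumes "y * y = 1"
  shows "atoms y \<noteq> {}"
proof -
  obtain w where "dem w = y" using dem_surj[OF assms] by blast
  then obtain v where "dem v = y" "\<forall>u. dem u = y \<longrightarrow> perm_length v \<le> perm_length u"
    using ex_has_least_nat[of "\<lambda>w. dem w = y" w perm_length] by blast
  then have "v \<in> atoms y" by (simp add: atoms_iff)
  then show ?thesis by blast
qed

lemma finite_affected_subset:
  fixes A :: "int set"
  assumes "finite A"
  shows "finite {w. affected w \<subseteq> A}"
proof (rule inj_on_finite)
  let ?g = "\<lambda>w. restrict (apply w) A"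
  show "inj_on ?g {w. affected w \<subseteq> A}"
  proof (rule inj_onI)
    fix v w assume vw: "v \<in> {w. affected w \<subseteq> A}" "w \<in> {w. affected w \<subseteq> A}" "?g v = ?g w"
    show "v = w"
    proof (rule perm_eqI)
      fix x show "v \<langle>$\<rangle> x = w \<langle>$\<rangle> x"
      proof (cases "x \<in> A")
        case True
        then show ?thesis using vw(3) by (metis restrict_apply')
      next
        case False
        then have "x \<notin> affected v" "x \<notin> affected w" using vw by auto
        then show ?thesis by (simp add: in_affected)
      qed
    qed
  qed
  show "?g ` {w. affected w \<subseteq> A} \<subseteq> A \<rightarrow>\<^sub>E A"
  proof (rule image_subsetI)
    fix w assume w: "w \<in> {w. affected w \<subseteq> A}"
    have "w \<langle>$\<rangle> x \<in> A" if "x \<in> A" for x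
      using w that by (metis apply_affected in_affected mem_Collect_eq subsetD)
    then show "?g w \<in> A \<rightarrow>\<^sub>E A" by auto
  qed
  show "finite (A \<rightarrow>\<^sub>E A)" using assms by (simp add: finite_PiE)
qed

text \<open>\<open>dem w\<close> arises from \<open>inverse w\<close> by a sequence of
  \<open>rmul\<close> steps, and these never make an unstable half-line stable.\<close>

lemma stabilises_dem:
  assumes "stabilises n (dem w)"
  shows "stabilises n (inverse w)"
proof (rule ccontr)
  assume n: "\<not> stabilises n (inverse w)"
  obtain a where a: "a \<in> reduced_words w" using reduced_word_exists by blast
  have "\<not> stabilises n (foldl rmul v b)" if "\<not> stabilises n v" for v b
    using that by (induction b arbitrary: v) (simp_all add: not_stabilises_rmul)
  then have "\<not> stabilises n (dem w)"
    unfolding dem_def is_demazure_foldl[OF is_demazure_product_demazure a] using n by blast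
  then show False using assms by simp
qed

text \<open>If \<open>y\<close> preserves the half-lines up to \<open>x\<close> and up to
  \<open>x - 1\<close>, so does the inverse of each atom, which then fixes \<open>x\<close>.
  Finiteness gives \<open>inv_stanley\<close> its meaning, since a sum over an infinite set is
  0.\<close>

lemma finite_atoms: "finite (atoms y)"
proof -
  define B where "B = {n. \<not> stabilises n y} \<union> (\<lambda>n. n + 1) ` {n. \<not> stabilises n y}"
  have "finite B" by (simp add: B_def finite_not_stabilises)
  moreover have "atoms y \<subseteq> {w. affected w \<subseteq> B}"
  proof clarify
    fix w x assume w: "w \<in> atoms y" and x: "x \<in> affected w"
    show "x \<in> B"
    proof (rule ccontr)
      assume "x \<notin> B"
      have "stabilises x y" "stabilises (x - 1) y"
      proof -
        show "stabilises x y" using \<open>x \<notin> B\<close> by (simp add: B_def)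
        show "stabilises (x - 1) y"
        proof (rule ccontr)
          assume "\<not> stabilises (x - 1) y"
          then have "x \<in> (\<lambda>n. n + 1) ` {n. \<not> stabilises n y}" by (intro image_eqI[of _ _ "x - 1"]) auto
          then show False using \<open>x \<notin> B\<close> by (simp add: B_def)
        qed
      qed
      then have st: "stabilises x (inverse w)" "stabilises (x - 1) (inverse w)"
        using w stabilises_dem by (auto simp: atoms_iff)
      obtain z where z: "z \<le> x - 1 + 1" "x - 1 < inverse w \<langle>$\<rangle> z" using no_squeeze by blast
      have "\<not> z \<le> x - 1" using st(2) z(2) by (meson not_le stabilises_def)
      then have "z = x" using z by simp
      moreover have "inverse w \<langle>$\<rangle> z \<le> x" using st(1) z(1) by (simp add: stabilises_def)
      ultimately have "inverse w \<langle>$\<rangle> x = x" using z by simp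
      then have "w \<langle>$\<rangle> x = x" by (simp only: apply_inverse_iff)
      then show False using x by (simp add: in_affected)
    qed
  qed
  ultimately show ?thesis by (metis finite_affected_subset finite_subset)
qed


section \<open>Codes of involutions\<close>

text \<open>The code of the extreme atom, position by position, in terms of \<open>y\<close>
  alone.\<close>

definition cyc_code :: "zperm \<Rightarrow> int \<Rightarrow> nat" where
  "cyc_code y k = card {j. j < k \<and> k \<le> y \<langle>$\<rangle> j \<and> y \<langle>$\<rangle> k < y \<langle>$\<rangle> j}"

lemma top_atom_lcode:
  assumes "top_atom w y"
  shows "lcode w k = cyc_code y k"
proof -
  have "w \<langle>$\<rangle> k < w \<langle>$\<rangle> q \<longleftrightarrow> k \<le> y \<langle>$\<rangle> q \<and> y \<langle>$\<rangle> k < y \<langle>$\<rangle> q" if "q < k" for q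
  proof -
    have "y \<langle>$\<rangle> k \<noteq> y \<langle>$\<rangle> q" using that by (simp add: apply_inj)
    then show ?thesis
      using top_atom_iff[OF assms, of k q] that by (auto simp: cycle_max_def max_def)
  qed
  then show ?thesis by (simp add: lcode_def cyc_code_def cong: conj_cong)
qed

definition straddle :: "zperm \<Rightarrow> int \<Rightarrow> int set" where
  "straddle y x = {m. m < x \<and> x < y \<langle>$\<rangle> m}"

text \<open>The number of arcs crossing the gap between \<open>x\<close> and
  \<open>x + 1\<close>.\<close>

definition height :: "zperm \<Rightarrow> int \<Rightarrow> nat" where
  "height y x = card {m. m \<le> x \<and> x < y \<langle>$\<rangle> m}"

lemma finite_straddle: "finite (straddle y x)"
  by (rule finite_subset[of _ "affected y"]) (auto simp: straddle_def in_affected)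

text \<open>The formula for \<open>inv_code\<close> with each \<open>j\<close> replaced by its
  partner, without reference to positive numbers. Up to reflection of the index it is also
  \<open>cyc_code\<close> for \<open>star y\<close>.\<close>

definition right_code :: "zperm \<Rightarrow> int \<Rightarrow> nat" where
  "right_code y i = card {j. i < j \<and> y \<langle>$\<rangle> j \<le> i \<and> y \<langle>$\<rangle> j < y \<langle>$\<rangle> i}"

lemma cyc_code_star: "cyc_code (star y) (- i) = right_code y i"
proof -
  have "bij_betw uminus {j. j < - i \<and> - i \<le> star y \<langle>$\<rangle> j \<and> star y \<langle>$\<rangle> (- i) < star y \<langle>$\<rangle> j}
      {j. i < j \<and> y \<langle>$\<rangle> j \<le> i \<and> y \<langle>$\<rangle> j < y \<langle>$\<rangle> i}"
    by (rule bij_betw_byWitness[where f' = uminus]) (auto simp: apply_star)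
  then show ?thesis unfolding cyc_code_def right_code_def by (rule bij_betw_same_card)
qed

text \<open>The restriction to \<open>1 \<le> j\<close> is automatic, as a point moved by
  \<open>y\<close> is positive.\<close>

lemma inv_code_right_code:
  assumes y: "y \<in> involutions_pos"
  shows "inv_code y i = right_code y i"
proof -
  have yy: "y \<langle>$\<rangle> (y \<langle>$\<rangle> x) = x" for x using y involution_apply by (simp add: involutions_pos_def)
  have pos: "1 \<le> y \<langle>$\<rangle> j" if "y \<langle>$\<rangle> j \<noteq> j" for j
  proof -
    have "y \<langle>$\<rangle> j \<in> affected y" unfolding apply_affected using that by (simp add: in_affected)
    then show ?thesis using y unfolding involutions_pos_def by blast
  qed
  have "bij_betw (apply y) {j. 1 \<le> j \<and> j \<le> i \<and> i < y \<langle>$\<rangle> j \<and> j < y \<langle>$\<rangle> i}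
      {j. i < j \<and> y \<langle>$\<rangle> j \<le> i \<and> y \<langle>$\<rangle> j < y \<langle>$\<rangle> i}"
    by (rule bij_betw_byWitness[where f' = "apply y"]) (use pos in \<open>force simp: yy\<close>)+
  then show ?thesis unfolding inv_code_def right_code_def by (rule bij_betw_same_card)
qed

text \<open>At fixed points both codes count the arcs above. At left endpoints
  \<open>right_code\<close>, at right endpoints \<open>cyc_code\<close>, counts these arcs and the
  point's own arc. The remaining values are not evaluated, but identified with the other code at the
  other end of the arc.\<close>

lemma card_straddle_involution:
  assumes y: "y * y = 1"
  shows "right_code y x = (if x < y \<langle>$\<rangle> x then Suc (card (straddle y x))
      else if y \<langle>$\<rangle> x = x then card (straddle y x) else cyc_code y (y \<langle>$\<rangle> x))"
    and "cyc_code y x = (if y \<langle>$\<rangle> x < x then Suc (card (straddle y x))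
      else if y \<langle>$\<rangle> x = x then card (straddle y x) else right_code y (y \<langle>$\<rangle> x))"
proof -
  note yy = involution_apply[OF y]
  have inj: "y \<langle>$\<rangle> m = x \<longleftrightarrow> m = y \<langle>$\<rangle> x" for m x using yy by metis
  have bij: "card {j. x < j \<and> y \<langle>$\<rangle> j < z} = card {m. m < z \<and> x < y \<langle>$\<rangle> m}" for x z
    by (rule bij_betw_same_card[of "apply y"], rule bij_betw_byWitness[where f' = "apply y"])
      (auto simp: yy)
  have less_or: "card {j. x < j \<and> y \<langle>$\<rangle> j \<le> x} = Suc (card (straddle y x))" if "x < y \<langle>$\<rangle> x"
  proof -
    have "card {j. x < j \<and> y \<langle>$\<rangle> j \<le> x} = card (insert (y \<langle>$\<rangle> x) {j. x < j \<and> y \<langle>$\<rangle> j < x})"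
    proof (rule arg_cong[of _ _ card], rule set_eqI)
      fix j show "j \<in> {j. x < j \<and> y \<langle>$\<rangle> j \<le> x} \<longleftrightarrow> j \<in> insert (y \<langle>$\<rangle> x) {j. x < j \<and> y \<langle>$\<rangle> j < x}"
        using that inj[of j x] yy[of x] by auto
    qed
    also have "\<dots> = Suc (card {j. x < j \<and> y \<langle>$\<rangle> j < x})"
    proof (rule card_insert_disjoint)
      show "finite {j. x < j \<and> y \<langle>$\<rangle> j < x}"
        by (rule finite_subset[of _ "affected y"]) (auto simp: in_affected)
    qed (simp add: yy)
    finally show ?thesis using bij[of x x] by (simp add: straddle_def)
  qed
  have less_or': "card {j. j < x \<and> x \<le> y \<langle>$\<rangle> j} = Suc (card (straddle y x))" if "y \<langle>$\<rangle> x < x"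
  proof -
    have "card {j. j < x \<and> x \<le> y \<langle>$\<rangle> j} = card (insert (y \<langle>$\<rangle> x) (straddle y x))"
    proof (rule arg_cong[of _ _ card], rule set_eqI)
      fix j show "j \<in> {j. j < x \<and> x \<le> y \<langle>$\<rangle> j} \<longleftrightarrow> j \<in> insert (y \<langle>$\<rangle> x) (straddle y x)"
        using that inj[of j x] yy[of x] by (auto simp: straddle_def)
    qed
    also have "\<dots> = Suc (card (straddle y x))"
      by (rule card_insert_disjoint[OF finite_straddle]) (simp add: straddle_def yy)
    finally show ?thesis .
  qed
  have L: "right_code y (y \<langle>$\<rangle> x) = cyc_code y x" if "x < y \<langle>$\<rangle> x" for x
  proof -
    have "right_code y (y \<langle>$\<rangle> x) = card {j. y \<langle>$\<rangle> x < j \<and> y \<langle>$\<rangle> j < x}"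
      unfolding right_code_def by (rule arg_cong[of _ _ card]) (use that in \<open>auto simp: yy\<close>)
    also have "\<dots> = card {m. m < x \<and> y \<langle>$\<rangle> x < y \<langle>$\<rangle> m}" by (rule bij)
    also have "\<dots> = cyc_code y x"
      unfolding cyc_code_def by (rule arg_cong[of _ _ card]) (use that in auto)
    finally show ?thesis .
  qed
  consider "x < y \<langle>$\<rangle> x" | "y \<langle>$\<rangle> x = x" | "y \<langle>$\<rangle> x < x" by linarith
  then show "right_code y x = (if x < y \<langle>$\<rangle> x then Suc (card (straddle y x))
      else if y \<langle>$\<rangle> x = x then card (straddle y x) else cyc_code y (y \<langle>$\<rangle> x))"
  proof cases
    case 1
    then have "right_code y x = card {j. x < j \<and> y \<langle>$\<rangle> j \<le> x}"
      unfolding right_code_def by (intro arg_cong[of _ _ card]) auto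
    then show ?thesis using 1 less_or by simp
  next
    case 2
    then have "right_code y x = card {j. x < j \<and> y \<langle>$\<rangle> j < x}"
      unfolding right_code_def by (intro arg_cong[of _ _ card]) auto
    then show ?thesis using 2 bij[of x x] by (simp add: straddle_def)
  next
    case 3
    then show ?thesis using L[of "y \<langle>$\<rangle> x"] by (simp add: yy)
  qed
  consider "x < y \<langle>$\<rangle> x" | "y \<langle>$\<rangle> x = x" | "y \<langle>$\<rangle> x < x" by linarith
  then show "cyc_code y x = (if y \<langle>$\<rangle> x < x then Suc (card (straddle y x))
      else if y \<langle>$\<rangle> x = x then card (straddle y x) else right_code y (y \<langle>$\<rangle> x))"
  proof cases
    case 1
    then show ?thesis using L[of x] by simp
  next
    case 2
    then have "cyc_code y x = card (straddle y x)"
      unfolding cyc_code_def straddle_def by (intro arg_cong[of _ _ card]) auto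
    then show ?thesis using 2 by simp
  next
    case 3
    then have "cyc_code y x = card {j. j < x \<and> x \<le> y \<langle>$\<rangle> j}"
      unfolding cyc_code_def by (intro arg_cong[of _ _ card]) auto
    then show ?thesis using 3 less_or' by simp
  qed
qed

lemma height_step:
  assumes y: "y * y = 1"
  shows "height y x = card (straddle y x) + (if x < y \<langle>$\<rangle> x then 1 else 0)"
    and "height y (x - 1) = card (straddle y x) + (if y \<langle>$\<rangle> x < x then 1 else 0)"
proof -
  note yy = involution_apply[OF y]
  have inj: "y \<langle>$\<rangle> m = x \<longleftrightarrow> m = y \<langle>$\<rangle> x" for m using yy by metis
  have "{m. m \<le> x \<and> x < y \<langle>$\<rangle> m} = (if x < y \<langle>$\<rangle> x then insert x (straddle y x) else straddle y x)"
    by (auto simp: straddle_def order.order_iff_strict)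
  then show "height y x = card (straddle y x) + (if x < y \<langle>$\<rangle> x then 1 else 0)"
    using finite_straddle[of y x] by (simp add: height_def straddle_def)
  have "{m. m \<le> x - 1 \<and> x - 1 < y \<langle>$\<rangle> m} =
      (if y \<langle>$\<rangle> x < x then insert (y \<langle>$\<rangle> x) (straddle y x) else straddle y x)"
  proof (rule set_eqI)
    fix m
    show "m \<in> {m. m \<le> x - 1 \<and> x - 1 < y \<langle>$\<rangle> m} \<longleftrightarrow>
        m \<in> (if y \<langle>$\<rangle> x < x then insert (y \<langle>$\<rangle> x) (straddle y x) else straddle y x)"
      using inj[of m] yy[of x] by (cases "y \<langle>$\<rangle> m = x") (auto simp: straddle_def)
  qed
  then show "height y (x - 1) = card (straddle y x) + (if y \<langle>$\<rangle> x < x then 1 else 0)"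
    using finite_straddle[of y x] by (simp add: height_def) (simp add: straddle_def yy)
qed

lemma telescope_int: "(\<Sum>x\<in>{a..<a + int n}. g x - g (x - 1)) = g (a + int n - 1) - (g (a - 1) :: int)"
proof (induction n)
  case (Suc n)
  have "{a..<a + int (Suc n)} = insert (a + int n) {a..<a + int n}" by auto
  then show ?case using Suc by (simp add: algebra_simps)
qed simp

text \<open>The path of heights starts and ends at 0, so at each level it has as many up steps (at left
  endpoints of cycles) as down steps (at right endpoints).\<close>

lemma card_endpoints:
  assumes y: "y * y = 1"
  shows "card {x. x < y \<langle>$\<rangle> x \<and> j \<le> card (straddle y x)} =
    card {x. y \<langle>$\<rangle> x < x \<and> j \<le> card (straddle y x)}"
proof -
  obtain N where N: "affected y \<subseteq> {-N..N}" by (rule affected_bound)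
  define n where "n = nat (2 * N + 1)"
  have fixp: "y \<langle>$\<rangle> x = x" if "x < -N \<or> N < x" for x using apply_outside[OF N] that by auto
  define A where "A = {-N..<-N + int n}"
  have A: "x \<in> A" if "y \<langle>$\<rangle> x \<noteq> x" for x
    using fixp[of x] that by (force simp: A_def n_def)
  have zero: "height y x = 0" if "x < -N \<or> N \<le> x" for x
  proof -
    have "\<not> (m \<le> x \<and> x < y \<langle>$\<rangle> m)" for m
      using apply_inside[OF N, of m] fixp[of m] that by fastforce
    then have "{m. m \<le> x \<and> x < y \<langle>$\<rangle> m} = {}" by blast
    then show ?thesis unfolding height_def by (simp only: card.empty)
  qed
  \<comment> \<open>Cutting off the heights below \<open>j\<close> cancels all steps under level
    \<open>j\<close>, so the telescoping sum sees exactly the endpoints with at least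
    \<open>j\<close> arcs above.\<close>
  define g where "g x = max (int (height y x)) (int j)" for x
  have "(\<Sum>x\<in>A. g x - g (x - 1)) = g (-N + int n - 1) - g (-N - 1)"
    unfolding A_def by (rule telescope_int)
  also have "\<dots> = 0" unfolding g_def by (subst (1 2) zero) (auto simp: n_def)
  finally have 0: "(\<Sum>x\<in>A. g x - g (x - 1)) = 0" .
  have "g x - g (x - 1) = (if x < y \<langle>$\<rangle> x \<and> j \<le> card (straddle y x) then 1 else 0) -
      (if y \<langle>$\<rangle> x < x \<and> j \<le> card (straddle y x) then 1 else 0)" for x
    unfolding g_def height_step[OF y, of x] by auto
  with 0 have "(\<Sum>x\<in>A. if x < y \<langle>$\<rangle> x \<and> j \<le> card (straddle y x) then 1 else 0) =
      (\<Sum>x\<in>A. if y \<langle>$\<rangle> x < x \<and> j \<le> card (straddle y x) then 1 else (0::int))"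
    by (simp add: sum_subtractf)
  moreover have "A \<inter> {x. x < y \<langle>$\<rangle> x \<and> j \<le> card (straddle y x)} = {x. x < y \<langle>$\<rangle> x \<and> j \<le> card (straddle y x)}"
    "A \<inter> {x. y \<langle>$\<rangle> x < x \<and> j \<le> card (straddle y x)} = {x. y \<langle>$\<rangle> x < x \<and> j \<le> card (straddle y x)}"
    using A by force+
  moreover have "finite A" by (simp add: A_def)
  ultimately show ?thesis by (simp add: sum.If_cases)
qed

text \<open>Fixed points have equal codes, and \<open>y\<close> matches left endpoints for
  \<open>cyc_code\<close> with right endpoints for \<open>right_code\<close>. What is left are the
  endpoints where arcs above are counted, and \<open>card_endpoints\<close> settles them.\<close>

lemma card_codes:
  assumes y: "y * y = 1"
  shows "card {x. j < cyc_code y x} = card {x. j < right_code y x}"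
proof -
  note yy = involution_apply[OF y]
  note codes = card_straddle_involution[OF y]
  define Lft Rgt Fx where "Lft = {x. x < y \<langle>$\<rangle> x}" and "Rgt = {x. y \<langle>$\<rangle> x < x}" and "Fx = {x. y \<langle>$\<rangle> x = x}"
  obtain N where N: "affected y \<subseteq> {-N..N}" by (rule affected_bound)
  have fin_aff: "finite Lft" "finite Rgt"
    by (rule finite_subset[of _ "affected y"]; auto simp: Lft_def Rgt_def in_affected)+
  have finF: "finite {x \<in> Fx. j < card (straddle y x)}"
  proof (rule finite_subset)
    show "{x \<in> Fx. j < card (straddle y x)} \<subseteq> {-N..N}"
    proof clarify
      fix x assume "j < card (straddle y x)"
      then have "straddle y x \<noteq> {}" by force
      then obtain m where m: "m < x" "x < y \<langle>$\<rangle> m" by (auto simp: straddle_def)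
      then have "m \<in> affected y" by (simp add: in_affected)
      then have "m \<in> {-N..N}" "y \<langle>$\<rangle> m \<in> {-N..N}" using N apply_inside[OF N] by blast+
      then show "x \<in> {-N..N}" using m by auto
    qed
  qed simp
  have U: "UNIV = Lft \<union> (Rgt \<union> Fx)" by (auto simp: Lft_def Rgt_def Fx_def)
  have split: "card {x. P x} = card {x \<in> Lft. P x} + card {x \<in> Rgt. P x} + card {x \<in> Fx. P x}"
    if "finite {x \<in> Fx. P x}" for P
  proof -
    have "card {x. P x} = card ({x \<in> Lft. P x} \<union> ({x \<in> Rgt. P x} \<union> {x \<in> Fx. P x}))"
      by (rule arg_cong[of _ _ card]) (use U in blast)
    moreover have "card ({x \<in> Lft. P x} \<union> ({x \<in> Rgt. P x} \<union> {x \<in> Fx. P x})) =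
        card {x \<in> Lft. P x} + card ({x \<in> Rgt. P x} \<union> {x \<in> Fx. P x})"
      by (rule card_Un_disjoint) (use that fin_aff in \<open>auto simp: Lft_def Rgt_def Fx_def\<close>)
    moreover have "card ({x \<in> Rgt. P x} \<union> {x \<in> Fx. P x}) = card {x \<in> Rgt. P x} + card {x \<in> Fx. P x}"
      by (rule card_Un_disjoint) (use that fin_aff in \<open>auto simp: Lft_def Rgt_def Fx_def\<close>)
    ultimately show ?thesis by linarith
  qed
  have F: "{x \<in> Fx. j < cyc_code y x} = {x \<in> Fx. j < card (straddle y x)}"
    "{x \<in> Fx. j < right_code y x} = {x \<in> Fx. j < card (straddle y x)}"
    by (auto simp: Fx_def codes)
  have "card {x \<in> Lft. j < cyc_code y x} = card {x \<in> Rgt. j < right_code y x}"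
  proof (rule bij_betw_same_card[of "apply y"], rule bij_betw_byWitness[where f' = "apply y"])
    have *: "right_code y (y \<langle>$\<rangle> x) = cyc_code y x" if "x < y \<langle>$\<rangle> x" for x
      using codes(2)[of x] that by simp
    show "apply y ` {x \<in> Lft. j < cyc_code y x} \<subseteq> {x \<in> Rgt. j < right_code y x}"
      using * by (auto simp: Lft_def Rgt_def yy)
    show "apply y ` {x \<in> Rgt. j < right_code y x} \<subseteq> {x \<in> Lft. j < cyc_code y x}"
    proof (rule image_subsetI)
      fix x assume "x \<in> {x \<in> Rgt. j < right_code y x}"
      then show "y \<langle>$\<rangle> x \<in> {x \<in> Lft. j < cyc_code y x}"
        using *[of "y \<langle>$\<rangle> x"] by (simp add: Lft_def Rgt_def yy)
    qed
  qed (simp_all add: yy)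
  moreover have "{x \<in> Rgt. j < cyc_code y x} = {x. y \<langle>$\<rangle> x < x \<and> j \<le> card (straddle y x)}"
    "{x \<in> Lft. j < right_code y x} = {x. x < y \<langle>$\<rangle> x \<and> j \<le> card (straddle y x)}"
    by (auto simp: Rgt_def Lft_def codes)
  ultimately show ?thesis
    using split[of "\<lambda>x. j < cyc_code y x"] split[of "\<lambda>x. j < right_code y x"] finF card_endpoints[OF y, of j]
    by (simp add: F)
qed

lemma card_cyc_code_star: "card {x. j < cyc_code (star y) x} = card {x. j < right_code y x}"
proof (rule bij_betw_same_card[of uminus], rule bij_betw_byWitness[where f' = uminus])
  show "uminus ` {x. j < cyc_code (star y) x} \<subseteq> {x. j < right_code y x}"
    by (auto simp flip: cyc_code_star)
  show "uminus ` {x. j < right_code y x} \<subseteq> {x. j < cyc_code (star y) x}"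
    by (auto simp: cyc_code_star)
qed auto

lemma involution_star: "y * y = 1 \<Longrightarrow> star y * star y = 1"
  by (metis star_mult star_one)

text \<open>For every atom but the extreme one, some partial sum of its bound is strictly smaller.
  So the leading monomial cannot occur for it, and the coefficient 1 survives the summation.\<close>

lemma inv_stanley_dominance:
  assumes y: "y * y = 1" and M: "\<And>j. card {x. j < cyc_code y x} = M j" and r: "\<And>j. r \<le> j \<Longrightarrow> M j = 0"
  shows "inv_stanley y (mset (blocks 0 (map M [0..<r]))) = 1"
    and "inv_stanley y (mset (blocks 0 ks)) \<noteq> 0 \<Longrightarrow>
      sum_list (take k ks) \<le> sum_list (take k (map M [0..<r]))"
proof -
  obtain w where w: "w \<in> atoms y" "top_atom w y"
    and dom: "\<And>v. v \<in> atoms y \<Longrightarrow> v = w \<or>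
      (\<forall>k. psum (lcode v) k \<le> psum (lcode w) k) \<and> (\<exists>k. psum (lcode v) k < psum (lcode w) k)"
  proof -
    obtain u where "u \<in> atoms y" using atoms_nonempty[OF y] by blast
    then obtain w where w: "w \<in> atoms y" "top_atom w y" using atoms_dominated by blast
    moreover have "v = w \<or>
      (\<forall>k. psum (lcode v) k \<le> psum (lcode w) k) \<and> (\<exists>k. psum (lcode v) k < psum (lcode w) k)"
      if "v \<in> atoms y" for v
      using atoms_dominated[OF that] top_atom_unique[OF w(2)] by blast
    ultimately show ?thesis using that by blast
  qed
  have code: "card {p. j < lcode w p} = M j" for j using M by (simp add: top_atom_lcode[OF w(2)])
  have fin: "finite {p. j < lcode w p}" for j
    by (rule finite_subset[OF _ finite_lcode_support[of w]]) auto
  have bound: "lcode w p \<le> j" if "r \<le> j" for j p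
  proof (rule ccontr)
    assume "\<not> lcode w p \<le> j"
    then have "p \<in> {p. j < lcode w p}" by simp
    then have "{p. j < lcode w p} \<noteq> {}" by blast
    then have "card {p. j < lcode w p} \<noteq> 0" using fin[of j] by simp
    then show False using code[of j] r[OF that] by simp
  qed
  have lead: "stanley w (mset (blocks 0 (map M [0..<r]))) = 1"
    using stanley_leading[of r w] bound by (simp add: code)
  have ps: "psum (lcode w) k = sum_list (take k (map M [0..<r]))" for k
  proof -
    have "psum (lcode w) k = (\<Sum>j<k. M j)" by (simp add: psum_def code)
    also have "\<dots> = (\<Sum>j<min k r. M j)"
      by (rule sum.mono_neutral_right) (use r in auto)
    also have "\<dots> = sum_list (map M [0..<min k r])" by (simp add: interv_sum_list_conv_sum_set_nat atLeast0LessThan)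
    finally show ?thesis by (simp add: take_map take_upt min_def)
  qed
  have "stanley v (mset (blocks 0 (map M [0..<r]))) = 0" if "v \<in> atoms y - {w}" for v
  proof (rule ccontr)
    assume *: "stanley v (mset (blocks 0 (map M [0..<r]))) \<noteq> 0"
    have "v \<in> atoms y" "v \<noteq> w" using that by simp_all
    then obtain k where "psum (lcode v) k < psum (lcode w) k" using dom by blast
    then show False using stanley_bound[OF *, of k] ps[of k] by simp
  qed
  then show "inv_stanley y (mset (blocks 0 (map M [0..<r]))) = 1"
    unfolding inv_stanley_def using lead by (simp add: sum.remove[OF finite_atoms w(1)])
  assume "inv_stanley y (mset (blocks 0 ks)) \<noteq> 0"
  then obtain v where v: "v \<in> atoms y" "stanley v (mset (blocks 0 ks)) \<noteq> 0"
    unfolding inv_stanley_def by (meson sum.not_neutral_contains_not_neutral)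
  have "sum_list (take k ks) \<le> psum (lcode v) k" by (rule stanley_bound[OF v(2)])
  also have "\<dots> \<le> psum (lcode w) k" using dom[OF v(1)] by auto
  finally show "sum_list (take k ks) \<le> sum_list (take k (map M [0..<r]))" using ps by simp
qed

text \<open>Removes the sorting from the shape: a part of the conjugate only counts the code entries
  exceeding its index. The number \<open>r\<close> is the largest entry.\<close>

lemma inv_shape_eq:
  obtains r where "inv_shape y = map (\<lambda>j. card {i. 1 \<le> i \<and> j < inv_code y i}) [0..<r]"
    "\<And>j. r \<le> j \<Longrightarrow> card {i. 1 \<le> i \<and> j < inv_code y i} = 0" "is_partition (inv_shape y)"
proof -
  define I where "I = {i. 1 \<le> i \<and> inv_code y i \<noteq> 0}"
  define A where "A = image_mset (inv_code y) (mset_set I)"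
  define l where "l = rev (sorted_list_of_multiset A)"
  have fin: "finite I" unfolding I_def by (rule finite_inv_code)
  have ml: "mset l = A" by (simp add: l_def)
  have "sorted_wrt (\<ge>) l" by (simp add: l_def sorted_wrt_rev)
  moreover have "set l = inv_code y ` I" using fin by (simp add: l_def A_def)
  ultimately have part: "is_partition l" by (auto simp: is_partition_def I_def)
  have count: "card {n. n < length l \<and> j < l ! n} = card {i. 1 \<le> i \<and> j < inv_code y i}" for j
  proof -
    have "card {n. n < length l \<and> j < l ! n} = size (filter_mset (\<lambda>x. j < x) (mset l))"
      by (simp add: length_filter_conv_card flip: mset_filter)
    also have "filter_mset (\<lambda>x. j < x) (mset l) =
        image_mset (inv_code y) (mset_set {i \<in> I. j < inv_code y i})"
      unfolding ml A_def using fin by (simp add: filter_mset_image_mset comp_def filter_mset_mset_set)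
    also have "{i \<in> I. j < inv_code y i} = {i. 1 \<le> i \<and> j < inv_code y i}" by (auto simp: I_def)
    finally show ?thesis by simp
  qed
  define r where "r = (case l of [] \<Rightarrow> 0 | k # _ \<Rightarrow> k)"
  have sh: "inv_shape y = conj_partition l" by (simp add: inv_shape_def l_def A_def I_def)
  have "inv_shape y = map (\<lambda>j. card {i. 1 \<le> i \<and> j < inv_code y i}) [0..<r]"
    unfolding sh conj_partition_def r_def[symmetric] count ..
  moreover have "card {i. 1 \<le> i \<and> j < inv_code y i} = 0" if "r \<le> j" for j
  proof -
    have le: "l ! n \<le> j" if n: "n < length l" for n
      using is_partition_nth[OF part, of 0 n] n \<open>r \<le> j\<close> by (cases l) (auto simp: r_def)
    then have "{n. n < length l \<and> j < l ! n} = {}" by (metis (mono_tags, lifting) empty_Collect_eq not_less)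
    then show ?thesis by (metis count card.empty)
  qed
  moreover have "is_partition (inv_shape y)" unfolding sh by (rule is_partition_conj[OF part])
  ultimately show ?thesis by (rule that)
qed

lemma right_code_pos:
  assumes y: "y \<in> involutions_pos" and "0 < right_code y i"
  shows "1 \<le> i"
proof -
  have "{j. i < j \<and> y \<langle>$\<rangle> j \<le> i \<and> y \<langle>$\<rangle> j < y \<langle>$\<rangle> i} \<noteq> {}" using assms(2) by (force simp: right_code_def)
  then obtain j where j: "i < j" "y \<langle>$\<rangle> j \<le> i" by blast
  then have "y \<langle>$\<rangle> j \<in> affected y" unfolding apply_affected by (auto simp: in_affected)
  then have "1 \<le> y \<langle>$\<rangle> j" using y unfolding involutions_pos_def by blast
  then show ?thesis using j by simp
qed

text \<open>One exponent serves for \<open>y\<close> and \<open>star y\<close>, because their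
  extreme atoms have codes with the same multiset of nonzero entries.\<close>

lemma inv_stanley_shape:
  assumes y: "y \<in> involutions_pos" and z: "z = y \<or> z = star y"
  shows "inv_stanley z (mset (blocks 0 (inv_shape y))) = 1"
    and "inv_stanley z (mset (blocks 0 ks)) \<noteq> 0 \<Longrightarrow>
      sum_list (take k ks) \<le> sum_list (take k (inv_shape y))"
proof -
  have yy: "y * y = 1" using y by (simp add: involutions_pos_def)
  define M where "M j = card {i. 1 \<le> i \<and> j < inv_code y i}" for j
  obtain r where r: "inv_shape y = map M [0..<r]" "\<And>j. r \<le> j \<Longrightarrow> M j = 0"
    unfolding M_def by (rule inv_shape_eq[of y]) blast
  have "{i. 1 \<le> i \<and> j < inv_code y i} = {i. j < right_code y i}" for j
    using right_code_pos[OF y] by (auto simp: inv_code_right_code[OF y])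
  then have "card {x. j < cyc_code z x} = M j" for j
    using z card_codes[OF yy] card_cyc_code_star by (auto simp: M_def)
  moreover have "z * z = 1" using z yy involution_star by blast
  ultimately have dom: "inv_stanley z (mset (blocks 0 (map M [0..<r]))) = 1"
    "inv_stanley z (mset (blocks 0 ks)) \<noteq> 0 \<Longrightarrow>
      sum_list (take k ks) \<le> sum_list (take k (map M [0..<r]))" for k ks
    using inv_stanley_dominance[of z M r] r(2) by blast+
  show "inv_stanley z (mset (blocks 0 (inv_shape y))) = 1"
    unfolding r(1) by (rule dom(1))
  show "inv_stanley z (mset (blocks 0 ks)) \<noteq> 0 \<Longrightarrow>
      sum_list (take k ks) \<le> sum_list (take k (inv_shape y))"
    unfolding r(1) by (rule dom(2))
qed


section \<open>Dominance order and the Schur expansion\<close>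

lemma sum_take_diagram: "sum_list (take k p) = card {c \<in> diagram p. fst c < k}"
proof -
  have "diagram (take k p) = {c \<in> diagram p. fst c < k}" by (auto simp: diagram_def)
  then show ?thesis by (metis card_diagram)
qed

lemma card_diagram_conj:
  assumes "is_partition p"
  shows "card {c \<in> diagram (conj_partition p). fst c < k} = card {c \<in> diagram p. snd c < k}"
proof (rule bij_betw_same_card[of prod.swap], rule bij_betw_byWitness[where f' = prod.swap])
qed (use diagram_conj_partition[OF assms] in auto)

lemma sum_list_conj:
  assumes "is_partition p"
  shows "sum_list (conj_partition p) = sum_list p"
proof -
  have "card (diagram (conj_partition p)) = card (diagram p)"
    by (rule bij_betw_same_card[of prod.swap], rule bij_betw_byWitness[where f' = prod.swap])
      (use diagram_conj_partition[OF assms] in auto)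
  then show ?thesis by (simp add: card_diagram)
qed

lemma dominance_antisym:
  assumes p: "is_partition p" and q: "is_partition q" and pq: "dominance_le p q" "dominance_le q p"
  shows "p = q"
proof -
  have eq: "sum_list (take k p) = sum_list (take k q)" for k
    using pq unfolding dominance_le_def by (meson le_antisym)
  have len: "length b \<le> length a"
    if ab: "is_partition b" "\<And>k. sum_list (take k a) = sum_list (take k b)" for a b
  proof (rule ccontr)
    assume "\<not> length b \<le> length a"
    then have l: "length a < length b" by simp
    then have "take (Suc (length a)) b = take (length a) b @ [b ! length a]"
      by (simp add: take_Suc_conv_app_nth)
    moreover have "b ! length a \<noteq> 0" using ab(1) l unfolding is_partition_def by (metis nth_mem)
    ultimately have "sum_list (take (length a) b) < sum_list (take (Suc (length a)) b)" by simp
    then show False using ab(2)[of "length a"] ab(2)[of "Suc (length a)"] by simp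
  qed
  have l: "length p = length q" using len[OF q eq] len[OF p eq[symmetric]] by simp
  show ?thesis
  proof (rule nth_equalityI[OF l])
    fix i assume i: "i < length p"
    then show "p ! i = q ! i"
      using eq[of i] eq[of "Suc i"] l by (simp add: take_Suc_conv_app_nth)
  qed
qed

text \<open>Let \<open>r\<close> be the number of rows of \<open>a\<close> longer than
  \<open>k\<close>. The first \<open>r\<close> rows of \<open>a\<close> consist of all its cells
  outside the first \<open>k\<close> columns and a full rectangle with \<open>r\<close> rows and
  \<open>k\<close> columns; for \<open>b\<close>, these two kinds of cells cover the first
  \<open>r\<close> rows. So comparing these rows compares the cells outside the first
  \<open>k\<close> columns.\<close>

lemma dominance_le_conj:
  assumes a: "is_partition a" and b: "is_partition b" and ab: "dominance_le a b"
  shows "dominance_le (conj_partition b) (conj_partition a)"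
proof -
  have sum: "sum_list a = sum_list b" using ab by (simp add: dominance_le_def)
  have "card {c \<in> diagram b. snd c < k} \<le> card {c \<in> diagram a. snd c < k}" for k
  proof -
    have split: "card (diagram p) = card {c \<in> diagram p. snd c < k} + card {c \<in> diagram p. k \<le> snd c}" for p
    proof -
      have "card (diagram p) = card ({c \<in> diagram p. snd c < k} \<union> {c \<in> diagram p. k \<le> snd c})"
        by (rule arg_cong[of _ _ card]) auto
      also have "\<dots> = card {c \<in> diagram p. snd c < k} + card {c \<in> diagram p. k \<le> snd c}"
        by (rule card_Un_disjoint) (use finite_diagram[of p] in auto)
      finally show ?thesis .
    qed
    define R where "R = {i. i < length a \<and> k < a ! i}"
    define r where "r = card R"
    have R: "R = {..<r}"
      unfolding r_def
      by (rule initial_segment) (use is_partition_nth[OF a] in \<open>fastforce simp: R_def\<close>)+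
    have "{c \<in> diagram a. fst c < r} = {c \<in> diagram a. k \<le> snd c} \<union> {..<r} \<times> {..<k}"
    proof (rule set_eqI, clarify)
      fix i j
      have 1: "i < r" if "(i, j) \<in> diagram a" "k \<le> j"
      proof -
        have "i \<in> R" using that by (auto simp: diagram_def R_def)
        then show ?thesis using R by simp
      qed
      have 2: "(i, j) \<in> diagram a" if "i < r" "j < k"
      proof -
        have "i \<in> R" using that R by simp
        then show ?thesis using that by (auto simp: diagram_def R_def)
      qed
      show "(i, j) \<in> {c \<in> diagram a. fst c < r} \<longleftrightarrow>
          (i, j) \<in> {c \<in> diagram a. k \<le> snd c} \<union> {..<r} \<times> {..<k}"
        using 1 2 by auto
    qed
    moreover have "card ({c \<in> diagram a. k \<le> snd c} \<union> {..<r} \<times> {..<k}) =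
        card {c \<in> diagram a. k \<le> snd c} + card ({..<r} \<times> {..<k})"
      by (rule card_Un_disjoint) (use finite_diagram[of a] in auto)
    ultimately have "card {c \<in> diagram a. fst c < r} = card {c \<in> diagram a. k \<le> snd c} + r * k"
      by simp
    moreover have "card {c \<in> diagram a. fst c < r} \<le> card {c \<in> diagram b. fst c < r}"
      using ab by (simp add: dominance_le_def flip: sum_take_diagram)
    moreover have "card {c \<in> diagram b. fst c < r} \<le> card ({c \<in> diagram b. k \<le> snd c} \<union> {..<r} \<times> {..<k})"
      by (rule card_mono) (use finite_diagram[of b] in auto)
    moreover have "card ({c \<in> diagram b. k \<le> snd c} \<union> {..<r} \<times> {..<k}) \<le>
        card {c \<in> diagram b. k \<le> snd c} + r * k"
      using card_Un_le[of "{c \<in> diagram b. k \<le> snd c}" "{..<r} \<times> {..<k}"] by simp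
    ultimately have "card {c \<in> diagram a. k \<le> snd c} \<le> card {c \<in> diagram b. k \<le> snd c}" by simp
    then show ?thesis using split[of a] split[of b] sum by (simp add: card_diagram)
  qed
  then show ?thesis
    using sum by (simp add: dominance_le_def sum_list_conj a b sum_take_diagram card_diagram_conj)
qed

section \<open>Leading terms of Schur functions\<close>

lemma schur_fun_nonneg: "0 \<le> schur_fun p m"
  by (simp add: schur_fun_def)

lemma filter_blocks: "length (filter (\<lambda>x. x < i + k) (blocks i q)) = sum_list (take k q)"
proof (induction q arbitrary: i k)
  case (Cons n q)
  show ?case
  proof (cases k)
    case 0
    have "filter (\<lambda>x. x < i) (blocks i (n # q)) = []"
      using set_blocks[of _ i "n # q"] by (auto simp: filter_empty_conv not_less)
    then show ?thesis using 0 by simp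
  next
    case (Suc l)
    then show ?thesis using Cons[of "Suc i" l] by (simp add: filter_replicate)
  qed
qed simp

text \<open>Columns increase strictly from at least 0, so row \<open>i\<close> has entries at least
  \<open>i\<close>, and all entries less than \<open>k\<close> lie in the first \<open>k\<close>
  rows.\<close>

lemma schur_fun_dominance:
  assumes p: "is_partition p" and nz: "schur_fun p (mset (blocks 0 q)) \<noteq> 0"
  shows "dominance_le q p"
proof -
  have "{t \<in> semistandard_tableaux p. mset (concat t) = mset (blocks 0 q)} \<noteq> {}"
    using nz by (force simp: schur_fun_def)
  then obtain t where t: "t \<in> semistandard_tableaux p" "mset (concat t) = mset (blocks 0 q)" by blast
  have len: "map length t = p" using t by (simp add: semistandard_tableaux_def)
  have entry: "i \<le> t ! i ! j" if "i < length t" "j < length (t ! i)" for i j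
    using that
  proof (induction i)
    case (Suc i)
    have "t ! i ! j < t ! Suc i ! j"
      using semistandard_column[OF t(1) p, of i "Suc i" j] Suc.prems by simp
    moreover have "length (t ! Suc i) \<le> length (t ! i)"
      using is_partition_nth[OF p, of i "Suc i"] Suc.prems len by auto
    ultimately show ?case using Suc by simp
  qed simp
  have "sum_list (take k q) \<le> sum_list (take k p)" for k
  proof -
    have "k \<le> x" if x: "x \<in> set (concat (drop k t))" for x
    proof -
      obtain r where r: "r \<in> set (drop k t)" "x \<in> set r" using x by auto
      then obtain i where i: "i < length (drop k t)" "drop k t ! i = r" by (auto simp: in_set_conv_nth)
      obtain j where j: "j < length r" "r ! j = x" using r by (auto simp: in_set_conv_nth)
      have "k + i \<le> t ! (k + i) ! j" by (rule entry) (use i j in auto)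
      then show ?thesis using i j by simp
    qed
    then have "filter (\<lambda>x. x < k) (concat (drop k t)) = []" by (auto simp: filter_empty_conv not_less)
    moreover have "concat t = concat (take k t) @ concat (drop k t)"
      by (metis append_take_drop_id concat_append)
    ultimately have "size (filter_mset (\<lambda>x. x < k) (mset (concat t))) \<le> length (concat (take k t))"
      by (simp flip: mset_filter)
    also have "\<dots> = sum_list (take k p)" by (simp add: length_concat take_map flip: len)
    finally have "size (filter_mset (\<lambda>x. x < k) (mset (blocks 0 q))) \<le> sum_list (take k p)"
      unfolding t(2) .
    moreover have "size (filter_mset (\<lambda>x. x < k) (mset (blocks 0 q))) = sum_list (take k q)"
      using filter_blocks[of 0 k q] by (simp flip: mset_filter)
    ultimately show ?thesis by simp
  qed
  moreover have "sum_list q = sum_list p"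
  proof -
    have "sum_list q = size (mset (concat t))" using t(2) by simp
    also have "\<dots> = sum_list p" by (simp add: length_concat flip: len)
    finally show ?thesis .
  qed
  ultimately show ?thesis by (simp add: dominance_le_def)
qed

lemma blocks_conv_concat: "blocks i p = concat (map (\<lambda>j. replicate (p ! j) (i + j)) [0..<length p])"
proof (induction p arbitrary: i)
  case (Cons n p)
  have "[0..<length (n # p)] = 0 # map Suc [0..<length p]" by (simp add: map_Suc_upt upt_conv_Cons del: upt_Suc)
  then show ?case using Cons[of "Suc i"] by (simp add: comp_def del: upt_Suc)
qed simp

text \<open>Witnessed by the tableau whose row \<open>i\<close> is filled with
  \<open>i\<close>.\<close>

lemma schur_fun_leading:
  assumes p: "is_partition p"
  shows "1 \<le> schur_fun p (mset (blocks 0 p))"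
proof -
  define t where "t = map (\<lambda>j. replicate (p ! j) j) [0..<length p]"
  have len: "map length t = p" by (rule nth_equalityI) (simp_all add: t_def)
  have "t ! i ! j < t ! Suc i ! j" if "Suc i < length t" "j < length (t ! Suc i)" for i j
    using that is_partition_nth[OF p, of i "Suc i"] by (simp add: t_def)
  then have "t \<in> semistandard_tableaux p"
    using len by (auto simp: semistandard_tableaux_def t_def)
  moreover have "mset (concat t) = mset (blocks 0 p)" by (simp add: t_def blocks_conv_concat)
  ultimately have t: "t \<in> {t \<in> semistandard_tableaux p. mset (concat t) = mset (blocks 0 p)}" by simp
  \<comment> \<open>A witness alone does not give a positive count, since \<open>card\<close> is 0
    on infinite sets.\<close>
  have "finite {t \<in> semistandard_tableaux p. mset (concat t) = mset (blocks 0 p)}"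
  proof (rule finite_subset)
    let ?R = "{r. set r \<subseteq> set (blocks 0 p) \<and> length r \<le> sum_list p}"
    show "{t \<in> semistandard_tableaux p. mset (concat t) = mset (blocks 0 p)} \<subseteq>
      {t. set t \<subseteq> ?R \<and> length t = length p}"
    proof clarify
      fix u assume u: "u \<in> semistandard_tableaux p" "mset (concat u) = mset (blocks 0 p)"
      have lu: "map length u = p" using u by (simp add: semistandard_tableaux_def)
      have "set (concat u) = set (blocks 0 p)" using u(2) by (rule mset_eq_setD)
      moreover have "length r \<le> sum_list p" if "r \<in> set u" for r
      proof -
        have "length r \<in> set p" using that unfolding lu[symmetric] by simp
        then show ?thesis by (intro member_le_sum_list) auto
      qed
      ultimately show "set u \<subseteq> ?R \<and> length u = length p" using lu by auto
    qed
    show "finite {t. set t \<subseteq> ?R \<and> length t = length p}"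
      by (intro finite_lists_length_eq finite_lists_length_le) simp
  qed
  then have "card {t \<in> semistandard_tableaux p. mset (concat t) = mset (blocks 0 p)} > 0"
    using t by (auto simp: card_gt_0_iff)
  then show ?thesis by (simp add: schur_fun_def)
qed

text \<open>Nothing cancels, so the exponent \<open>sh x\<close> occurs in the sum and
  \<open>bound\<close> applies to it. A summand that contributes at \<open>\<mu>\<close> has a shape
  above \<open>\<mu>\<close>, hence equal to it, and the total coefficient 1 leaves room for one
  such summand.\<close>

lemma schur_sum_leading:
  assumes X: "finite X" "\<And>x. x \<in> X \<Longrightarrow> is_partition (sh x)" and \<mu>: "is_partition \<mu>"
    and size: "\<And>x x'. x \<in> X \<Longrightarrow> x' \<in> X \<Longrightarrow> sum_list (sh x) = sum_list (sh x')"
    and lead: "(\<Sum>x\<in>X. schur_fun (sh x) (mset (blocks 0 \<mu>))) = 1"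
    and bound: "\<And>ks k. (\<Sum>x\<in>X. schur_fun (sh x) (mset (blocks 0 ks))) \<noteq> 0 \<Longrightarrow>
      sum_list (take k ks) \<le> sum_list (take k \<mu>)"
  shows "\<And>x. x \<in> X \<Longrightarrow> dominance_le (sh x) \<mu>" "\<exists>!x. x \<in> X \<and> sh x = \<mu>"
proof -
  let ?s = "\<lambda>x. schur_fun (sh x) (mset (blocks 0 \<mu>))"
  have "\<exists>x0\<in>X. ?s x0 \<noteq> 0" using lead by (metis sum.neutral zero_neq_one)
  \<comment> \<open>This summand also ties the common size of all shapes to that of
    \<open>\<mu>\<close>.\<close>
  then obtain x0 where x0: "x0 \<in> X" "dominance_le \<mu> (sh x0)" using schur_fun_dominance X(2) by blast
  then have n: "sum_list (sh x) = sum_list \<mu>" if "x \<in> X" for x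
    using size[OF that x0(1)] by (simp add: dominance_le_def)
  show dom: "dominance_le (sh x) \<mu>" if x: "x \<in> X" for x
  proof -
    have "1 \<le> schur_fun (sh x) (mset (blocks 0 (sh x)))" by (rule schur_fun_leading[OF X(2)[OF x]])
    also have "\<dots> \<le> (\<Sum>z\<in>X. schur_fun (sh z) (mset (blocks 0 (sh x))))"
      by (rule member_le_sum) (use X x schur_fun_nonneg in auto)
    finally show ?thesis using bound[of "sh x"] n[OF x] by (simp add: dominance_le_def)
  qed
  have eq: "sh x = \<mu>" if "x \<in> X" "?s x \<noteq> 0" for x
    using dominance_antisym[OF X(2)[OF that(1)] \<mu> dom[OF that(1)]] schur_fun_dominance[OF X(2) that(2)] that(1)
    by blast
  have "sh x0 = \<mu>" using dominance_antisym[OF X(2)[OF x0(1)] \<mu> dom[OF x0(1)] x0(2)] .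
  moreover have "x = x0" if "x \<in> X" "sh x = \<mu>" for x
  proof (rule ccontr)
    assume ne: "x \<noteq> x0"
    have "1 \<le> ?s x" "1 \<le> ?s x0" using schur_fun_leading[OF \<mu>] that \<open>sh x0 = \<mu>\<close> by simp_all
    moreover have "(\<Sum>z\<in>{x, x0}. ?s z) \<le> (\<Sum>z\<in>X. ?s z)"
      by (rule sum_mono2) (use X x0 that schur_fun_nonneg in auto)
    ultimately show False using lead ne by simp
  qed
  ultimately show "\<exists>!x. x \<in> X \<and> sh x = \<mu>" using x0(1) by blast
qed

text \<open>Different indices may give the same function, so the coefficient of a function is the
  size of its fibre.\<close>

lemma sum_in_nat_span:
  assumes X: "finite X" "\<And>x. x \<in> X \<Longrightarrow> f x \<in> S"
  shows "(\<lambda>m. \<Sum>x\<in>X. f x m) \<in> nat_span S"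
proof -
  define c where "c g = card {x \<in> X. f x = g}" for g
  have "(\<Sum>x\<in>X. f x m) = (\<Sum>g\<in>f ` X. int (c g) * g m)" for m
  proof -
    have "(\<Sum>x\<in>X. f x m) = (\<Sum>g\<in>f ` X. \<Sum>x\<in>{x \<in> X. f x = g}. f x m)"
      by (rule sum.image_gen[OF X(1)])
    also have "\<dots> = (\<Sum>g\<in>f ` X. int (c g) * g m)"
    proof (rule sum.cong[OF refl])
      fix g
      have "(\<Sum>x\<in>{x \<in> X. f x = g}. f x m) = (\<Sum>x\<in>{x \<in> X. f x = g}. g m)"
        by (rule sum.cong) auto
      then show "(\<Sum>x\<in>{x \<in> X. f x = g}. f x m) = int (c g) * g m" by (simp add: c_def)
    qed
    finally show ?thesis .
  qed
  moreover have "finite (f ` X)" "f ` X \<subseteq> S" using X by auto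
  ultimately show ?thesis unfolding nat_span_def by blast
qed

text \<open>The index set is the same for \<open>y\<close> and \<open>star y\<close>, so a statement
  about one term of the second sum is a statement about the conjugate shape in the first.\<close>

lemma inv_stanley_schur:
  defines "X \<equiv> \<lambda>y. SIGMA w:atoms y. eg_tableaux w"
  shows "inv_stanley y m = (\<Sum>x\<in>X y. schur_fun (conj_partition (map card (snd x))) m)"
    and "inv_stanley (star y) m = (\<Sum>x\<in>X y. schur_fun (map card (snd x)) m)"
proof -
  show "inv_stanley y m = (\<Sum>x\<in>X y. schur_fun (conj_partition (map card (snd x))) m)"
    by (simp add: inv_stanley_def stanley_schur X_def sum.Sigma finite_atoms finite_eg_tableaux case_prod_beta)
  have "inj_on star (atoms y)" by (metis inj_onI star_star)
  then show "inv_stanley (star y) m = (\<Sum>x\<in>X y. schur_fun (map card (snd x)) m)"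
    by (simp add: inv_stanley_def atoms_star sum.reindex stanley_star X_def sum.Sigma
        finite_atoms finite_eg_tableaux case_prod_beta)
qed

theorem theorem4p41:
  fixes y :: "int perm" and \<mu> :: "nat list"
  assumes "y \<in> involutions_pos" and "\<mu> = inv_shape y"
  shows "dominance_le (conj_partition \<mu>) \<mu> \<and>
    (conj_partition \<mu> = \<mu> \<longrightarrow> inv_stanley y = schur_fun \<mu>) \<and>
    (conj_partition \<mu> \<noteq> \<mu> \<longrightarrow>
      (\<exists>g \<in> nat_span {schur_fun l | l. is_partition l \<and>
                dominance_less (conj_partition \<mu>) l \<and> dominance_less l \<mu>}.
        inv_stanley y = (\<lambda>m. schur_fun (conj_partition \<mu>) m + schur_fun \<mu> m + g m)))"
proof -
  define X where "X = (SIGMA w:atoms y. eg_tableaux w)"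
  define sh where "sh x = conj_partition (map card (snd x))" for x :: "zperm \<times> int set list"
  have fin: "finite X" by (simp add: X_def finite_atoms finite_eg_tableaux)
  have tab: "is_partition (map card (snd x))" if "x \<in> X" for x
    using that tableau_partition by (auto simp: X_def eg_tableaux_def)
  have sh: "is_partition (sh x)" "conj_partition (sh x) = map card (snd x)" if "x \<in> X" for x
    using is_partition_conj[OF tab[OF that]] conj_conj[OF tab[OF that]] by (simp_all add: sh_def)
  have \<mu>: "is_partition \<mu>" unfolding assms(2) by (rule inv_shape_eq[of y])
  \<comment> \<open>All atoms of \<open>y\<close> have the same length, which is the size of each of
    their tableaux.\<close>
  have size: "sum_list (map card (snd x)) = sum_list (map card (snd x'))" if "x \<in> X" "x' \<in> X" for x x'
  proof -
    have *: "sum_list (map card (snd x)) = perm_length (fst x) \<and> fst x \<in> atoms y" if "x \<in> X" for x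
    proof -
      have "tableau (snd x)" "reading_word (snd x) \<in> reduced_words (fst x)" "fst x \<in> atoms y"
        using that by (auto simp: X_def eg_tableaux_def)
      then show ?thesis using length_reading_word[of "snd x"] by (simp add: reduced_words_def)
    qed
    have "fst x \<in> atoms y" "fst x' \<in> atoms y" using *[OF that(1)] *[OF that(2)] by blast+
    then have "perm_length (fst x) = perm_length (fst x')"
      unfolding atoms_iff by (metis le_antisym)
    then show ?thesis using *[OF that(1)] *[OF that(2)] by simp
  qed
  have size': "sum_list (sh x) = sum_list (sh x')" if "x \<in> X" "x' \<in> X" for x x'
    using size[OF that] that tab by (simp add: sh_def sum_list_conj)
  have F: "inv_stanley y m = (\<Sum>x\<in>X. schur_fun (sh x) m)" for m
    unfolding X_def sh_def by (rule inv_stanley_schur)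
  have F': "inv_stanley (star y) m = (\<Sum>x\<in>X. schur_fun (map card (snd x)) m)" for m
    unfolding X_def by (rule inv_stanley_schur)
  note Y = inv_stanley_shape[OF assms(1), folded assms(2)]
  have upper: "dominance_le (sh x) \<mu>" if "x \<in> X" for x
    using schur_sum_leading(1)[of X sh \<mu>] fin sh(1) \<mu> size' Y[of y] that unfolding F by blast
  obtain x1 where x1: "x1 \<in> X" "sh x1 = \<mu>" "\<And>x. x \<in> X \<Longrightarrow> sh x = \<mu> \<Longrightarrow> x = x1"
    using schur_sum_leading(2)[of X sh \<mu>] fin sh(1) \<mu> size' Y[of y] unfolding F by blast
  have upper': "dominance_le (map card (snd x)) \<mu>" if "x \<in> X" for x
    using schur_sum_leading(1)[of X "\<lambda>x. map card (snd x)" \<mu>] fin tab \<mu> size Y[of "star y"] that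
    unfolding F' by blast
  obtain x2 where x2: "x2 \<in> X" "map card (snd x2) = \<mu>"
    "\<And>x. x \<in> X \<Longrightarrow> map card (snd x) = \<mu> \<Longrightarrow> x = x2"
    using schur_sum_leading(2)[of X "\<lambda>x. map card (snd x)" \<mu>] fin tab \<mu> size Y[of "star y"]
    unfolding F' by blast
  \<comment> \<open>The bound for \<open>star y\<close>, turned around by conjugation.\<close>
  have lower: "dominance_le (conj_partition \<mu>) (sh x)" if "x \<in> X" for x
    unfolding sh_def by (rule dominance_le_conj[OF tab[OF that] \<mu> upper'[OF that]])
  have sh2: "sh x2 = conj_partition \<mu>" using x2(2) by (simp add: sh_def)
  have x2': "x = x2" if "x \<in> X" "sh x = conj_partition \<mu>" for x
    using x2(3)[OF that(1)] sh(2)[OF that(1)] that(2) conj_conj[OF \<mu>] by simp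
  \<comment> \<open>Both bounds hold at the existing term \<open>x1\<close>, which makes the two
    partitions comparable.\<close>
  have "dominance_le (conj_partition \<mu>) \<mu>" using lower[OF x1(1)] x1(2) by simp
  moreover have "inv_stanley y = schur_fun \<mu>" if self: "conj_partition \<mu> = \<mu>"
  proof
    fix m
    \<comment> \<open>The two bounds coincide, so every shape is squeezed to \<open>\<mu>\<close>,
      which occurs once.\<close>
    have "sh x = \<mu>" if "x \<in> X" for x
      using dominance_antisym[OF sh(1)[OF that] \<mu> upper[OF that]] lower[OF that] self by simp
    then have "X = {x1}" using x1 by blast
    then show "inv_stanley y m = schur_fun \<mu> m" unfolding F using x1(2) by simp
  qed
  moreover have "\<exists>g \<in> nat_span {schur_fun l | l. is_partition l \<and>
                dominance_less (conj_partition \<mu>) l \<and> dominance_less l \<mu>}.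
        inv_stanley y = (\<lambda>m. schur_fun (conj_partition \<mu>) m + schur_fun \<mu> m + g m)"
    if ne: "conj_partition \<mu> \<noteq> \<mu>"
  proof (rule bexI[of _ "\<lambda>m. \<Sum>x\<in>X - {x1, x2}. schur_fun (sh x) m"])
    have "x1 \<noteq> x2" using x1(2) sh2 ne by auto
    show "inv_stanley y = (\<lambda>m. schur_fun (conj_partition \<mu>) m + schur_fun \<mu> m +
        (\<Sum>x\<in>X - {x1, x2}. schur_fun (sh x) m))"
    proof
      fix m
      have "(\<Sum>x\<in>X. schur_fun (sh x) m) =
          (\<Sum>x\<in>X - {x1, x2}. schur_fun (sh x) m) + (\<Sum>x\<in>{x1, x2}. schur_fun (sh x) m)"
        by (rule sum.subset_diff) (use fin x1(1) x2(1) in auto)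
      then show "inv_stanley y m = schur_fun (conj_partition \<mu>) m + schur_fun \<mu> m +
          (\<Sum>x\<in>X - {x1, x2}. schur_fun (sh x) m)"
        unfolding F using \<open>x1 \<noteq> x2\<close> x1(2) sh2 by simp
    qed
    show "(\<lambda>m. \<Sum>x\<in>X - {x1, x2}. schur_fun (sh x) m) \<in> nat_span {schur_fun l | l. is_partition l \<and>
        dominance_less (conj_partition \<mu>) l \<and> dominance_less l \<mu>}"
    proof (rule sum_in_nat_span)
      fix x assume x: "x \<in> X - {x1, x2}"
      then have "sh x \<noteq> \<mu>" "conj_partition \<mu> \<noteq> sh x" using x1(3) x2' by fastforce+
      then show "schur_fun (sh x) \<in> {schur_fun l | l. is_partition l \<and>
          dominance_less (conj_partition \<mu>) l \<and> dominance_less l \<mu>}"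
        using upper lower sh(1) x unfolding dominance_less_def by blast
    qed (use fin in simp)
  qed
  ultimately show ?thesis by blast
qed

end
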